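(* Let $G$ be a finite cyclic group of order $m$, let $L\cong\mathbb{Z}^n$ be a finitely generated free abelian group of rank $n$, let $\rho\colon G\to \mathrm{aut}_{\mathbb{Z}}(L)$ be a group homomorphism and let $\Gamma=L\rtimes_\rho G$ be the associated semi-direct product. Suppose that $G$ acts freely on $L$ outside the origin. Let $\mathcal{M}$ be a complete system of representatives of the conjugacy classes of maximal finite subgroups of $\Gamma$. Then for $2k>n$ the map $$\varphi^{2k}\colon H^{2k}(\Gamma)\longrightarrow \bigoplus_{M\in\mathcal{M}}\widetilde{H}^{2k}(M)$$ induced by the various inclusions $M\to\Gamma$ for $M\in\mathcal{M}$ is an isomorphism, and for $2k+1>n$ we have $$H^{2k+1}(\Gamma)\cong 0.$$
   Context: Group cohomology is taken with (trivial) integral coefficients. $\widetilde{H}^{*}$ is reduced cohomology, i.e. $\widetilde{H}^{2k}(M)=H^{2k}(M)$ for $k\ge1$ and $\widetilde{H}^0(M)=0$. "$G$ acts freely on $L$ outside the origin" means: if $g\in G$, $x\in L$ and $gx=x$ then $g=1$ or $x=0$. *)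

theory Defs
  imports "HOL-Algebra.Algebra"
begin

text \<open>
  \<open>H\<^sup>n(G; \<int>)\<close> is the cohomology of the inhomogeneous bar cochain complex: an \<open>n\<close>-cochain is a function
  \<open>G\<^sup>n \<rightarrow> \<int>\<close>, where \<open>n\<close>-tuples are lists of length \<open>n\<close>. The groups are written
  multiplicatively, as always in HOL-Algebra, so \<open>\<one>\<close> is the zero cochain.
\<close>

definition tuples :: "('a, 'b) monoid_scheme \<Rightarrow> nat \<Rightarrow> 'a list set" where
  "tuples G n = {gs. length gs = n \<and> set gs \<subseteq> carrier G}"

definition cochain_group :: "('a, 'b) monoid_scheme \<Rightarrow> nat \<Rightarrow> ('a list \<Rightarrow> int) monoid" where
  "cochain_group G n = product_group (tuples G n) (\<lambda>_. integer_group)"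

text \<open>
  With entries numbered from \<open>0\<close>, as list positions are:
  \<open>(\<delta>c)(g\<^sub>0,\<dots>,g\<^sub>n) = c(g\<^sub>1,\<dots>,g\<^sub>n) + (\<Sum>i<n. (-1)\<^sup>i\<^sup>+\<^sup>1 c(g\<^sub>0,\<dots>,g\<^sub>ig\<^sub>i\<^sub>+\<^sub>1,\<dots>,g\<^sub>n)) + (-1)\<^sup>n\<^sup>+\<^sup>1 c(g\<^sub>0,\<dots>,g\<^sub>n\<^sub>-\<^sub>1)\<close>.
\<close>

definition coboundary ::
  "('a, 'b) monoid_scheme \<Rightarrow> nat \<Rightarrow> ('a list \<Rightarrow> int) \<Rightarrow> ('a list \<Rightarrow> int)" where
  "coboundary G n c = (\<lambda>gs \<in> tuples G (Suc n).
     c (tl gs)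
     + (\<Sum>i<n. (-1) ^ Suc i * c (take i gs @ [gs ! i \<otimes>\<^bsub>G\<^esub> gs ! Suc i] @ drop (i + 2) gs))
     + (-1) ^ Suc n * c (butlast gs))"

definition cocycles :: "('a, 'b) monoid_scheme \<Rightarrow> nat \<Rightarrow> ('a list \<Rightarrow> int) set" where
  "cocycles G n = kernel (cochain_group G n) (cochain_group G (Suc n)) (coboundary G n)"

definition coboundaries :: "('a, 'b) monoid_scheme \<Rightarrow> nat \<Rightarrow> ('a list \<Rightarrow> int) set" where
  "coboundaries G n =
     (case n of 0 \<Rightarrow> {\<one>\<^bsub>cochain_group G 0\<^esub>}
              | Suc k \<Rightarrow> coboundary G k ` carrier (cochain_group G k))"

definition cocycle_group :: "('a, 'b) monoid_scheme \<Rightarrow> nat \<Rightarrow> ('a list \<Rightarrow> int) monoid" where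
  "cocycle_group G n = (cochain_group G n)\<lparr>carrier := cocycles G n\<rparr>"

definition cohomology :: "('a, 'b) monoid_scheme \<Rightarrow> nat \<Rightarrow> ('a list \<Rightarrow> int) set monoid" where
  "cohomology G n = cocycle_group G n Mod coboundaries G n"

text \<open>The homomorphism \<open>f\<^sup>* : H\<^sup>n(G) \<rightarrow> H\<^sup>n(H)\<close> induced by a group homomorphism \<open>f : H \<rightarrow> G\<close>.
  A cohomology class is a coset \<open>C\<close> of cocycles; all its members have pullbacks in the same
  coset, and that coset is the value.\<close>

definition cochain_pullback ::
  "('h, 'c) monoid_scheme \<Rightarrow> ('h \<Rightarrow> 'g) \<Rightarrow> nat \<Rightarrow> ('g list \<Rightarrow> int) \<Rightarrow> ('h list \<Rightarrow> int)" where
  "cochain_pullback H f n c = (\<lambda>hs \<in> tuples H n. c (map f hs))"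

definition cohomology_map ::
  "('h, 'c) monoid_scheme \<Rightarrow> ('h \<Rightarrow> 'g) \<Rightarrow> nat \<Rightarrow> ('g list \<Rightarrow> int) set \<Rightarrow> ('h list \<Rightarrow> int) set" where
  "cohomology_map H f n C =
     the_elem ((\<lambda>c. coboundaries H n #>\<^bsub>cocycle_group H n\<^esub> cochain_pullback H f n c) ` C)"

definition reduced_cohomology ::
  "('a, 'b) monoid_scheme \<Rightarrow> nat \<Rightarrow> ('a list \<Rightarrow> int) set monoid" where
  "reduced_cohomology G n =
     (if n = 0 then (cohomology G 0)\<lparr>carrier := {\<one>\<^bsub>cohomology G 0\<^esub>}\<rparr> else cohomology G n)"

definition to_reduced ::
  "('a, 'b) monoid_scheme \<Rightarrow> nat \<Rightarrow> ('a list \<Rightarrow> int) set \<Rightarrow> ('a list \<Rightarrow> int) set" where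
  "to_reduced G n C = (if n = 0 then \<one>\<^bsub>cohomology G 0\<^esub> else C)"

definition restriction_map ::
  "('a, 'b) monoid_scheme \<Rightarrow> 'a set set \<Rightarrow> nat
     \<Rightarrow> ('a list \<Rightarrow> int) set \<Rightarrow> ('a set \<Rightarrow> ('a list \<Rightarrow> int) set)" where
  "restriction_map \<Gamma> \<M> n C =
     (\<lambda>M \<in> \<M>. to_reduced (\<Gamma>\<lparr>carrier := M\<rparr>) n
                 (cohomology_map (\<Gamma>\<lparr>carrier := M\<rparr>) (\<lambda>x. x) n C))"


definition semidirect_product ::
  "('l, 'b) monoid_scheme \<Rightarrow> ('g, 'c) monoid_scheme \<Rightarrow> ('g \<Rightarrow> 'l \<Rightarrow> 'l) \<Rightarrow> ('l \<times> 'g) monoid" where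
  "semidirect_product L G \<rho> =
     \<lparr>carrier = carrier L \<times> carrier G,
      monoid.mult = (\<lambda>(x, g) (y, h). (x \<otimes>\<^bsub>L\<^esub> \<rho> g y, g \<otimes>\<^bsub>G\<^esub> h)),
      one = (\<one>\<^bsub>L\<^esub>, \<one>\<^bsub>G\<^esub>)\<rparr>"

definition acts_freely_outside_origin ::
  "('g, 'c) monoid_scheme \<Rightarrow> ('l, 'b) monoid_scheme \<Rightarrow> ('g \<Rightarrow> 'l \<Rightarrow> 'l) \<Rightarrow> bool" where
  "acts_freely_outside_origin G L \<rho> \<longleftrightarrow>
     (\<forall>g \<in> carrier G. \<forall>x \<in> carrier L. \<rho> g x = x \<longrightarrow> g = \<one>\<^bsub>G\<^esub> \<or> x = \<one>\<^bsub>L\<^esub>)"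

definition maximal_finite_subgroup :: "'a set \<Rightarrow> ('a, 'b) monoid_scheme \<Rightarrow> bool" where
  "maximal_finite_subgroup M \<Gamma> \<longleftrightarrow>
     subgroup M \<Gamma> \<and> finite M \<and> (\<forall>N. subgroup N \<Gamma> \<and> finite N \<and> M \<subseteq> N \<longrightarrow> N = M)"

definition conjugate_subgroups :: "('a, 'b) monoid_scheme \<Rightarrow> 'a set \<Rightarrow> 'a set \<Rightarrow> bool" where
  "conjugate_subgroups \<Gamma> M N \<longleftrightarrow>
     (\<exists>g \<in> carrier \<Gamma>. N = g <#\<^bsub>\<Gamma>\<^esub> M #>\<^bsub>\<Gamma>\<^esub> inv\<^bsub>\<Gamma>\<^esub> g)"

definition complete_maximal_finite_representatives ::
  "'a set set \<Rightarrow> ('a, 'b) monoid_scheme \<Rightarrow> bool" where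
  "complete_maximal_finite_representatives \<M> \<Gamma> \<longleftrightarrow>
     (\<forall>M \<in> \<M>. maximal_finite_subgroup M \<Gamma>) \<and>
     (\<forall>N. maximal_finite_subgroup N \<Gamma> \<longrightarrow> (\<exists>!M. M \<in> \<M> \<and> conjugate_subgroups \<Gamma> M N))"

end

theory Submission
  imports Defs "HOL-Library.Function_Algebras" "HOL-Library.Sublist"
begin

text \<open>
  Let \<open>\<Gamma>\<close> act on the set \<open>X = L\<close> by \<open>(x, g) y = m x + g y\<close>. Freeness outside the origin makes every
  nontrivial element fix at most one point, stabilizers are finite, and averaging shows that every
  finite subgroup fixes a point; so the maximal finite subgroups are point stabilizers, and by Shapiro's
  lemma \<open>H\<^sup>i(\<Gamma>; \<int>\<^sup>X)\<close> is the product of the \<open>H\<^sup>i(M)\<close> for \<open>i > 0\<close>. One has to see that \<open>\<int> \<rightarrow> \<int>\<^sup>X\<close> induces an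
  isomorphism in degrees \<open>i > n\<close>.

  The quotient \<open>Q = \<int>\<^sup>X / \<int>\<close> is acyclic over every finite subgroup, since such a subgroup acts freely on
  the complement of its fixed point. The group \<open>\<Gamma>\<close> acts with finite stabilizers on the standard
  triangulation of \<open>\<real>\<^sup>N\<close> for the coinduced lattice of rank \<open>N = m n\<close>; this gives a finite resolution of
  \<open>Q\<close> by acyclic modules, hence \<open>H\<^sup>i(\<Gamma>; Q) = 0\<close> for \<open>i > N\<close>, and the comparison map is an isomorphism for
  large \<open>i\<close>. Because \<open>\<Gamma>/L\<close> is cyclic and \<open>H\<^sup>i(L; \<int>) = 0\<close> for \<open>i > n\<close> (by the same triangulation argument
  for \<open>L\<close> acting on \<open>\<real>\<^sup>n\<close>), the sequence \<open>0 \<rightarrow> A \<rightarrow> A[\<Gamma>/L] \<rightarrow> A[\<Gamma>/L] \<rightarrow> A \<rightarrow> 0\<close> makes both sides periodic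
  with period 2 in degrees above \<open>n\<close>, so the isomorphism descends to all \<open>i > n\<close>. Periodicity also reduces
  the vanishing of \<open>H\<^sup>2\<^sup>k\<^sup>+\<^sup>1(\<Gamma>; \<int>\<^sup>X)\<close> to that of \<open>H\<^sup>1\<close> of finite groups.
\<close>

section \<open>Alternating sums over the faces of a list\<close>

text \<open>The affine action of \<open>\<Gamma>\<close> on \<open>L\<close> need not preserve any
  coordinate order, so the triangulation of R^n itself serves the translations only. Coinduction
  restores an order-preserving action at the price of the dimension m n, and the periodicity is
  there to win back the degrees between n and m n. Its inputs on the translation group are that Z is
  acyclic above n, and that Z^X is acyclic in all degrees because nontrivial translations move every
  point of X.

  All of X is used, not only the points with nontrivial stabilizer, so that the comparison map is
  the inclusion of the constants and rebasing functions at a fixed point describes Q. Orbits with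
  trivial stabilizer contribute nothing in positive degrees. A nontrivial finite subgroup has
  exactly one fixed point, so the other orbits match the conjugacy classes of nontrivial maximal
  finite subgroups. Shapiro's lemma gives a product over orbits, the theorem a direct sum: these
  agree since a translation in \<open>L\<close> shifts X by a multiple of m, which leaves at most
  m^n orbits.\<close>

fun bd :: "('x list \<Rightarrow> 'a::ab_group_add) \<Rightarrow> 'x list \<Rightarrow> 'a" where
  "bd F [] = 0"
| "bd F (x # xs) = F xs - bd (\<lambda>ys. F (x # ys)) xs"

text \<open>The prism operator of a homotopy from \<open>\<phi>\<close> to \<open>\<psi>\<close>: an
  alternating sum over cut points, where the entry at the cut occurs under both maps. As in
  \<open>bd\<close>, the signs come from nested subtraction, which spares index arithmetic. Since
  \<open>bd F [x] = F []\<close>, the empty list acts as augmentation.\<close>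

fun prism :: "('x \<Rightarrow> 'y) \<Rightarrow> ('x \<Rightarrow> 'y) \<Rightarrow> ('y list \<Rightarrow> 'a::ab_group_add) \<Rightarrow> 'x list \<Rightarrow> 'a" where
  "prism \<phi> \<psi> F [] = 0"
| "prism \<phi> \<psi> F (x # xs) = F (\<phi> x # \<psi> x # map \<psi> xs) - prism \<phi> \<psi> (\<lambda>ys. F (\<phi> x # ys)) xs"

lemma bd_cong:
  assumes "\<And>ys. subseq ys xs \<Longrightarrow> Suc (length ys) = length xs \<Longrightarrow> F ys = F' ys"
  shows "bd F xs = bd F' xs"
  using assms
proof (induction xs arbitrary: F F')
  case (Cons x xs)
  have "bd (\<lambda>ys. F (x # ys)) xs = bd (\<lambda>ys. F' (x # ys)) xs"
    by (rule Cons.IH) (use Cons.prems in auto)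
  moreover have "F xs = F' xs"
    by (rule Cons.prems) auto
  ultimately show ?case by simp
qed simp

lemma bd_zero [simp]: "bd (\<lambda>ys. 0) xs = 0"
  by (induction xs) auto

lemma bd_diff: "bd (\<lambda>ys. F ys - F' ys) xs = bd F xs - bd F' xs"
  by (induction xs arbitrary: F F') auto

lemma bd_add: "bd (\<lambda>ys. F ys + F' ys) xs = bd F xs + bd F' xs"
  by (induction xs arbitrary: F F') auto

lemma bd_sum: "bd (\<lambda>ys. \<Sum>j\<in>J. F j ys) xs = (\<Sum>j\<in>J. bd (F j) xs)"
  by (induction J rule: infinite_finite_induct) (auto simp: bd_add)

lemma bd_bd [simp]: "bd (bd F) xs = 0"
  by (induction xs arbitrary: F) (auto simp: bd_diff)

lemma bd_map: "bd F (map f xs) = bd (\<lambda>ys. F (map f ys)) xs"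
  by (induction xs arbitrary: F) auto

lemma bd_apply: "bd F xs y = bd (\<lambda>ys. F ys y) xs"
  by (induction xs arbitrary: F) auto

lemma prism_diff:
  "prism \<phi> \<psi> (\<lambda>ys. F ys - F' ys) xs = prism \<phi> \<psi> F xs - prism \<phi> \<psi> F' xs"
  by (induction xs arbitrary: F F') auto

text \<open>The chain homotopy identity. The induction hypothesis is applied to \<open>F\<close>
  with \<open>\<phi> x\<close> put in front; the mixed terms of the first entry cancel.\<close>

lemma bd_prism:
  "bd (prism \<phi> \<psi> F) xs + prism \<phi> \<psi> (bd F) xs = F (map \<psi> xs) - F (map \<phi> xs)"
proof (induction xs arbitrary: F)
  case (Cons x xs)
  show ?case
    using Cons.IH[of "\<lambda>ys. F (\<phi> x # ys)"]
    by (simp add: bd_diff prism_diff bd_map algebra_simps)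
qed simp

text \<open>Only lists occurring in the prism matter; they are enumerated by the cuts of
  \<open>xs\<close> into \<open>us\<close> and a nonempty \<open>vs\<close>, whose head appears
  under both maps.\<close>

lemma prism_cong:
  assumes "\<And>us vs. xs = us @ vs \<Longrightarrow> vs \<noteq> [] \<Longrightarrow>
             F (map \<phi> us @ \<phi> (hd vs) # map \<psi> vs) = F' (map \<phi> us @ \<phi> (hd vs) # map \<psi> vs)"
  shows "prism \<phi> \<psi> F xs = prism \<phi> \<psi> F' xs"
  using assms
proof (induction xs arbitrary: F F')
  case (Cons x xs)
  have "prism \<phi> \<psi> (\<lambda>ys. F (\<phi> x # ys)) xs = prism \<phi> \<psi> (\<lambda>ys. F' (\<phi> x # ys)) xs"
  proof (rule Cons.IH)
    fix us vs assume "xs = us @ vs" "vs \<noteq> []"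
    then show "F (\<phi> x # map \<phi> us @ \<phi> (hd vs) # map \<psi> vs) = F' (\<phi> x # map \<phi> us @ \<phi> (hd vs) # map \<psi> vs)"
      using Cons.prems[of "x # us" vs] by simp
  qed
  moreover have "F (\<phi> x # \<psi> x # map \<psi> xs) = F' (\<phi> x # \<psi> x # map \<psi> xs)"
    using Cons.prems[of "[]" "x # xs"] by simp
  ultimately show ?case by simp
qed simp

lemma prism_zero [simp]: "prism \<phi> \<psi> (\<lambda>ys. 0) xs = 0"
  by (induction xs) auto

lemma prism_map:
  assumes "\<And>x. x \<in> set xs \<Longrightarrow> \<phi> (f x) = g (\<phi>' x)" "\<And>x. x \<in> set xs \<Longrightarrow> \<psi> (f x) = g (\<psi>' x)"
  shows "prism \<phi> \<psi> F (map f xs) = prism \<phi>' \<psi>' (\<lambda>ys. F (map g ys)) xs"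
  using assms
proof (induction xs arbitrary: F)
  case (Cons x xs)
  have "map (\<psi> \<circ> f) xs = map (g \<circ> \<psi>') xs" using Cons.prems by auto
  with Cons show ?case by (simp del: map_eq_conv)
qed simp

text \<open>Modules are subgroups of a type of abelian groups, so that kernels and normalized
  quotients live in the same type as the module they come from.\<close>

definition add_closed :: "'a::ab_group_add set \<Rightarrow> bool" where
  "add_closed A \<longleftrightarrow> 0 \<in> A \<and> (\<forall>x\<in>A. \<forall>y\<in>A. x - y \<in> A)"

lemma add_closedD:
  assumes "add_closed A"
  shows "0 \<in> A" "x \<in> A \<Longrightarrow> y \<in> A \<Longrightarrow> x - y \<in> A" "x \<in> A \<Longrightarrow> - x \<in> A"
        "x \<in> A \<Longrightarrow> y \<in> A \<Longrightarrow> x + y \<in> A"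
proof -
  show 0: "0 \<in> A" and d: "x \<in> A \<Longrightarrow> y \<in> A \<Longrightarrow> x - y \<in> A" for x y
    using assms by (auto simp: add_closed_def)
  show m: "- x \<in> A" if "x \<in> A" for x using d[OF 0 that] by simp
  show "x \<in> A \<Longrightarrow> y \<in> A \<Longrightarrow> x + y \<in> A"
    using d[OF _ m, of x y] by simp
qed

lemma add_closed_sum:
  assumes "add_closed A" "\<And>j. j \<in> J \<Longrightarrow> f j \<in> A"
  shows "sum f J \<in> A"
  using assms(2) by (induction J rule: infinite_finite_induct) (auto simp: add_closedD[OF assms(1)])

lemma bd_closed:
  assumes "add_closed A" "\<And>ys. subseq ys xs \<Longrightarrow> Suc (length ys) = length xs \<Longrightarrow> F ys \<in> A"
  shows "bd F xs \<in> A"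
  using assms(2)
proof (induction xs arbitrary: F)
  case (Cons x xs)
  have "bd (\<lambda>ys. F (x # ys)) xs \<in> A"
    by (rule Cons.IH) (use Cons.prems in auto)
  moreover have "F xs \<in> A" by (rule Cons.prems) auto
  ultimately show ?case by (simp add: add_closedD[OF assms(1)])
qed (simp add: add_closedD[OF assms(1)])

lemma prism_closed:
  assumes "add_closed A"
    and "\<And>us vs. xs = us @ vs \<Longrightarrow> vs \<noteq> [] \<Longrightarrow> F (map \<phi> us @ \<phi> (hd vs) # map \<psi> vs) \<in> A"
  shows "prism \<phi> \<psi> F xs \<in> A"
  using assms(2)
proof (induction xs arbitrary: F)
  case (Cons x xs)
  have "prism \<phi> \<psi> (\<lambda>ys. F (\<phi> x # ys)) xs \<in> A"
  proof (rule Cons.IH)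
    fix us vs assume "xs = us @ vs" "vs \<noteq> []"
    then show "F (\<phi> x # map \<phi> us @ \<phi> (hd vs) # map \<psi> vs) \<in> A"
      using Cons.prems[of "x # us" vs] by simp
  qed
  moreover have "F (\<phi> x # \<psi> x # map \<psi> xs) \<in> A"
    using Cons.prems[of "[]" "x # xs"] by simp
  ultimately show ?case by (simp add: add_closedD[OF assms(1)])
qed (simp add: add_closedD[OF assms(1)])

definition additive_on :: "'a::ab_group_add set \<Rightarrow> ('a \<Rightarrow> 'b::ab_group_add) \<Rightarrow> bool" where
  "additive_on A f \<longleftrightarrow> (\<forall>x\<in>A. \<forall>y\<in>A. f (x - y) = f x - f y)"

lemma additive_on_zero: "add_closed A \<Longrightarrow> additive_on A f \<Longrightarrow> f 0 = 0"
  unfolding add_closed_def additive_on_def by (metis diff_self)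

lemma additive_on_bd:
  assumes "add_closed A" "additive_on A f"
    and "\<And>ys. subseq ys xs \<Longrightarrow> Suc (length ys) = length xs \<Longrightarrow> F ys \<in> A"
  shows "f (bd F xs) = bd (\<lambda>ys. f (F ys)) xs"
  using assms(3)
proof (induction xs arbitrary: F)
  case Nil
  then show ?case using additive_on_zero[OF assms(1,2)] by simp
next
  case (Cons x xs)
  have "bd (\<lambda>ys. F (x # ys)) xs \<in> A"
    by (rule bd_closed[OF assms(1)]) (use Cons.prems in auto)
  moreover have "F xs \<in> A" by (rule Cons.prems) auto
  moreover have "f (bd (\<lambda>ys. F (x # ys)) xs) = bd (\<lambda>ys. f (F (x # ys))) xs"
    by (rule Cons.IH) (use Cons.prems in auto)
  ultimately show ?case using assms(2) by (simp add: additive_on_def)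
qed

lemma additive_on_prism:
  assumes "add_closed A" "additive_on A f"
    and "\<And>us vs. xs = us @ vs \<Longrightarrow> vs \<noteq> [] \<Longrightarrow> F (map \<phi> us @ \<phi> (hd vs) # map \<psi> vs) \<in> A"
  shows "f (prism \<phi> \<psi> F xs) = prism \<phi> \<psi> (\<lambda>ys. f (F ys)) xs"
  using assms(3)
proof (induction xs arbitrary: F)
  case Nil
  then show ?case using additive_on_zero[OF assms(1,2)] by simp
next
  case (Cons x xs)
  have F: "F (\<phi> x # map \<phi> us @ \<phi> (hd vs) # map \<psi> vs) \<in> A" if "xs = us @ vs" "vs \<noteq> []" for us vs
    using Cons.prems[of "x # us" vs] that by simp
  have "prism \<phi> \<psi> (\<lambda>ys. F (\<phi> x # ys)) xs \<in> A"
    by (rule prism_closed[OF assms(1)]) (use F in auto)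
  moreover have "F (\<phi> x # \<psi> x # map \<psi> xs) \<in> A"
    using Cons.prems[of "[]" "x # xs"] by simp
  moreover have "f (prism \<phi> \<psi> (\<lambda>ys. F (\<phi> x # ys)) xs) = prism \<phi> \<psi> (\<lambda>ys. f (F (\<phi> x # ys))) xs"
    by (rule Cons.IH) (use F in auto)
  ultimately show ?case using assms(2) by (simp add: additive_on_def)
qed

section \<open>Homogeneous cochains and long exact sequences\<close>

lemma face_tuples:
  "\<lbrakk>gs \<in> tuples G (Suc k); subseq hs gs; Suc (length hs) = length gs\<rbrakk> \<Longrightarrow> hs \<in> tuples G k"
  by (auto simp: tuples_def dest: list_emb_set)

text \<open>Index conventions: \<open>hcochain G A act k\<close> concerns functions of \<open>k\<close>-tuples, that is cochains of degree
  \<open>k - 1\<close>, whereas \<open>hcocycle\<close>, \<open>hexact\<close> and \<open>acyclic_at\<close> are indexed by the degree. The empty tuple augments the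
  complex by the invariants, so in degree \<open>0\<close> \<open>hexact\<close> does not mean that the class vanishes.\<close>

definition hcochain ::
  "('g, 'b) monoid_scheme \<Rightarrow> 'a::ab_group_add set \<Rightarrow> ('g \<Rightarrow> 'a \<Rightarrow> 'a) \<Rightarrow> nat \<Rightarrow> ('g list \<Rightarrow> 'a) \<Rightarrow> bool" where
  "hcochain G A act k F \<longleftrightarrow>
     (\<forall>gs\<in>tuples G k. F gs \<in> A \<and> (\<forall>g\<in>carrier G. F (map (\<lambda>x. g \<otimes>\<^bsub>G\<^esub> x) gs) = act g (F gs)))"

definition hcocycle ::
  "('g, 'b) monoid_scheme \<Rightarrow> 'a::ab_group_add set \<Rightarrow> ('g \<Rightarrow> 'a \<Rightarrow> 'a) \<Rightarrow> nat \<Rightarrow> ('g list \<Rightarrow> 'a) \<Rightarrow> bool" where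
  "hcocycle G A act i F \<longleftrightarrow> hcochain G A act (Suc i) F \<and> (\<forall>gs\<in>tuples G (Suc (Suc i)). bd F gs = 0)"

definition hexact ::
  "('g, 'b) monoid_scheme \<Rightarrow> 'a::ab_group_add set \<Rightarrow> ('g \<Rightarrow> 'a \<Rightarrow> 'a) \<Rightarrow> nat \<Rightarrow> ('g list \<Rightarrow> 'a) \<Rightarrow> bool" where
  "hexact G A act i F \<longleftrightarrow> (\<exists>E. hcochain G A act i E \<and> (\<forall>gs\<in>tuples G (Suc i). F gs = bd E gs))"

definition acyclic_at ::
  "('g, 'b) monoid_scheme \<Rightarrow> 'a::ab_group_add set \<Rightarrow> ('g \<Rightarrow> 'a \<Rightarrow> 'a) \<Rightarrow> nat \<Rightarrow> bool" where
  "acyclic_at G A act i \<longleftrightarrow> (\<forall>F. hcocycle G A act i F \<longrightarrow> hexact G A act i F)"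

lemma hexactI:
  "hcochain G A act i E \<Longrightarrow> (\<And>gs. gs \<in> tuples G (Suc i) \<Longrightarrow> F gs = bd E gs) \<Longrightarrow> hexact G A act i F"
  by (auto simp: hexact_def)

lemma hexactE:
  assumes "hexact G A act i F"
  obtains E where "hcochain G A act i E" "\<And>gs. gs \<in> tuples G (Suc i) \<Longrightarrow> F gs = bd E gs"
  using assms by (auto simp: hexact_def)

lemma hcochain_cong:
  assumes "hcochain G A act k F" "\<And>gs. gs \<in> tuples G k \<Longrightarrow> F' gs = F gs" "monoid G"
  shows "hcochain G A act k F'"
proof -
  have "map (\<lambda>x. g \<otimes>\<^bsub>G\<^esub> x) gs \<in> tuples G k" if "gs \<in> tuples G k" "g \<in> carrier G" for g gs
    using that assms(3) by (auto simp: tuples_def monoid.m_closed)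
  then show ?thesis using assms by (simp add: hcochain_def)
qed

lemma bd_tuples_cong:
  assumes "gs \<in> tuples G (Suc k)" "\<And>hs. hs \<in> tuples G k \<Longrightarrow> F hs = F' hs"
  shows "bd F gs = bd F' gs"
  using assms by (intro bd_cong) (auto dest: face_tuples)

lemma hcocycle_cong:
  assumes "hcocycle G A act i F" "\<And>gs. gs \<in> tuples G (Suc i) \<Longrightarrow> F' gs = F gs" "monoid G"
  shows "hcocycle G A act i F'"
  using assms bd_tuples_cong[of _ G "Suc i" F' F] by (auto simp: hcocycle_def intro: hcochain_cong)

lemma hexact_cong:
  assumes "hexact G A act i F" "\<And>gs. gs \<in> tuples G (Suc i) \<Longrightarrow> F' gs = F gs"
  shows "hexact G A act i F'"
  using assms by (auto simp: hexact_def)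

section \<open>Group actions, modules and equivariant cochains\<close>

locale gset = group G for G :: "('g, 'b) monoid_scheme" (structure) +
  fixes Y :: "'y set" and a :: "'g \<Rightarrow> 'y \<Rightarrow> 'y"
  assumes a_closed: "g \<in> carrier G \<Longrightarrow> y \<in> Y \<Longrightarrow> a g y \<in> Y"
    and a_one: "y \<in> Y \<Longrightarrow> a \<one> y = y"
    and a_mult: "g \<in> carrier G \<Longrightarrow> h \<in> carrier G \<Longrightarrow> y \<in> Y \<Longrightarrow> a (g \<otimes> h) y = a g (a h y)"
begin

lemma a_inv [simp]: "g \<in> carrier G \<Longrightarrow> y \<in> Y \<Longrightarrow> a (inv g) (a g y) = y"
  by (simp add: a_mult[symmetric] a_one)

lemma a_inv2 [simp]: "g \<in> carrier G \<Longrightarrow> y \<in> Y \<Longrightarrow> a g (a (inv g) y) = y"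
  by (simp add: a_mult[symmetric] a_one)

end

locale gmodule = gset G A act
  for G :: "('g, 'z) monoid_scheme" (structure) and A :: "'a::ab_group_add set" and act :: "'g \<Rightarrow> 'a \<Rightarrow> 'a" +
  assumes closed: "add_closed A"
    and act_additive: "g \<in> carrier G \<Longrightarrow> additive_on A (act g)"
begin

lemmas zero_mem = add_closedD(1)[OF closed]
lemmas diff_mem = add_closedD(2)[OF closed]
lemmas uminus_mem = add_closedD(3)[OF closed]
lemmas add_mem = add_closedD(4)[OF closed]

lemma act_zero: "g \<in> carrier G \<Longrightarrow> act g 0 = 0"
  by (rule additive_on_zero[OF closed act_additive])

lemma act_diff: "g \<in> carrier G \<Longrightarrow> x \<in> A \<Longrightarrow> y \<in> A \<Longrightarrow> act g (x - y) = act g x - act g y"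
  using act_additive by (auto simp: additive_on_def)

lemma act_add: "g \<in> carrier G \<Longrightarrow> x \<in> A \<Longrightarrow> y \<in> A \<Longrightarrow> act g (x + y) = act g x + act g y"
  using act_diff[of g "x + y" y] add_mem[of x y] by simp

lemma tuples_mult: "gs \<in> tuples G k \<Longrightarrow> g \<in> carrier G \<Longrightarrow> map (\<lambda>x. g \<otimes> x) gs \<in> tuples G k"
  by (auto simp: tuples_def)

lemma hcochain_mem: "hcochain G A act k F \<Longrightarrow> gs \<in> tuples G k \<Longrightarrow> F gs \<in> A"
  by (simp add: hcochain_def)

lemma hcochain_act:
  "hcochain G A act k F \<Longrightarrow> gs \<in> tuples G k \<Longrightarrow> g \<in> carrier G \<Longrightarrow>
     F (map (\<lambda>x. g \<otimes> x) gs) = act g (F gs)"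
  by (simp add: hcochain_def)

lemma hcochain_bd:
  assumes F: "hcochain G A act k F"
  shows "hcochain G A act (Suc k) (bd F)"
  unfolding hcochain_def
proof (intro ballI conjI)
  fix gs assume gs: "gs \<in> tuples G (Suc k)"
  have A: "F hs \<in> A" if "subseq hs gs" "Suc (length hs) = length gs" for hs
    using hcochain_mem[OF F face_tuples[OF gs that]] .
  show "bd F gs \<in> A"
    using bd_closed[OF closed] A by blast
  fix g assume g: "g \<in> carrier G"
  have "bd F (map (\<lambda>x. g \<otimes> x) gs) = bd (\<lambda>hs. act g (F hs)) gs"
    unfolding bd_map by (rule bd_tuples_cong[OF gs]) (use hcochain_act[OF F] g in auto)
  also have "\<dots> = act g (bd F gs)"
    using additive_on_bd[OF closed act_additive[OF g] A, of gs] by auto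
  finally show "bd F (map (\<lambda>x. g \<otimes> x) gs) = act g (bd F gs)" .
qed

lemma hcochain_diff:
  "hcochain G A act k F \<Longrightarrow> hcochain G A act k F' \<Longrightarrow> hcochain G A act k (\<lambda>gs. F gs - F' gs)"
  by (auto simp: hcochain_def diff_mem act_diff)

lemma hcochain_add:
  "hcochain G A act k F \<Longrightarrow> hcochain G A act k F' \<Longrightarrow> hcochain G A act k (\<lambda>gs. F gs + F' gs)"
  by (auto simp: hcochain_def add_mem act_add)

lemma hcochain_zero: "hcochain G A act k (\<lambda>gs. 0)"
  by (auto simp: hcochain_def zero_mem act_zero)

lemma hcocycle_diff:
  "hcocycle G A act i F \<Longrightarrow> hcocycle G A act i F' \<Longrightarrow> hcocycle G A act i (\<lambda>gs. F gs - F' gs)"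
  by (auto simp: hcocycle_def hcochain_diff bd_diff)

lemma hcocycle_bd: "hcochain G A act i E \<Longrightarrow> hcocycle G A act i (bd E)"
  by (auto simp: hcocycle_def hcochain_bd)

lemma hexact_bd: "hcochain G A act i E \<Longrightarrow> hexact G A act i (bd E)"
  by (auto simp: hexact_def)

lemma hexact_zero: "hexact G A act i (\<lambda>gs. 0)"
  unfolding hexact_def by (rule exI[of _ "\<lambda>gs. 0"]) (simp add: hcochain_zero)

lemma hexact_hcocycle: "hexact G A act i F \<Longrightarrow> hcocycle G A act i F"
  by (elim hexactE, rule hcocycle_cong[OF hcocycle_bd]) (auto simp: is_monoid)

lemma hexact_diff:
  "hexact G A act i F \<Longrightarrow> hexact G A act i F' \<Longrightarrow> hexact G A act i (\<lambda>gs. F gs - F' gs)"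
  unfolding hexact_def
proof (elim exE conjE)
  fix E E'
  assume "hcochain G A act i E" "hcochain G A act i E'" "\<forall>gs\<in>tuples G (Suc i). F gs = bd E gs"
    "\<forall>gs\<in>tuples G (Suc i). F' gs = bd E' gs"
  then show "\<exists>E. hcochain G A act i E \<and> (\<forall>gs\<in>tuples G (Suc i). F gs - F' gs = bd E gs)"
    by (intro exI[of _ "\<lambda>gs. E gs - E' gs"]) (simp add: hcochain_diff bd_diff)
qed

lemma hexact_add:
  "hexact G A act i F \<Longrightarrow> hexact G A act i F' \<Longrightarrow> hexact G A act i (\<lambda>gs. F gs + F' gs)"
  unfolding hexact_def
proof (elim exE conjE)
  fix E E'
  assume "hcochain G A act i E" "hcochain G A act i E'" "\<forall>gs\<in>tuples G (Suc i). F gs = bd E gs"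
    "\<forall>gs\<in>tuples G (Suc i). F' gs = bd E' gs"
  then show "\<exists>E. hcochain G A act i E \<and> (\<forall>gs\<in>tuples G (Suc i). F gs + F' gs = bd E gs)"
    by (intro exI[of _ "\<lambda>gs. E gs + E' gs"]) (simp add: hcochain_add bd_add)
qed

text \<open>Left translation acts freely on nonempty tuples, and every orbit contains exactly one
  tuple with head \<open>\<one>\<close>. Values there can be prescribed at will and spread by the
  action.\<close>

lemma hcochain_extend:
  assumes "\<And>gs. gs \<in> tuples G (Suc k) \<Longrightarrow> hd gs = \<one> \<Longrightarrow> E gs \<in> A"
  shows "hcochain G A act (Suc k) (\<lambda>gs. act (hd gs) (E (map (\<lambda>x. inv (hd gs) \<otimes> x) gs)))"
  unfolding hcochain_def
proof (intro ballI conjI)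
  fix gs assume gs: "gs \<in> tuples G (Suc k)"
  then have h: "hd gs \<in> carrier G" and ne: "gs \<noteq> []"
    by (auto simp: tuples_def) (metis Zero_not_Suc hd_in_set list.size(3) subsetD)
  have E: "E (map (\<lambda>x. inv (hd gs) \<otimes> x) gs) \<in> A"
    by (rule assms) (use gs h ne in \<open>auto intro: tuples_mult simp: hd_map\<close>)
  then show "act (hd gs) (E (map (\<lambda>x. inv (hd gs) \<otimes> x) gs)) \<in> A"
    using h by (simp add: a_closed)
  fix g assume g: "g \<in> carrier G"
  have "map (\<lambda>x. inv (g \<otimes> hd gs) \<otimes> x) (map (\<lambda>x. g \<otimes> x) gs) = map (\<lambda>x. inv (hd gs) \<otimes> x) gs"
    using gs g h by (auto simp: tuples_def inv_mult_group m_assoc subset_iff)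
       (metis inv_closed inv_solve_left m_assoc m_closed)
  then show "act (hd (map (\<lambda>x. g \<otimes> x) gs))
       (E (map (\<lambda>x. inv (hd (map (\<lambda>x. g \<otimes> x) gs)) \<otimes> x) (map (\<lambda>x. g \<otimes> x) gs))) =
     act g (act (hd gs) (E (map (\<lambda>x. inv (hd gs) \<otimes> x) gs)))"
    using ne g h E by (simp add: hd_map a_mult del: map_map map_eq_conv)
qed

end

section \<open>Module homomorphisms and lifting of cochains\<close>

locale gmodule_hom = A: gmodule G A aact + B: gmodule G B bact
  for G :: "('g, 'z) monoid_scheme" (structure) and A :: "'a::ab_group_add set" and aact :: "'g \<Rightarrow> 'a \<Rightarrow> 'a"
    and B :: "'b::ab_group_add set" and bact :: "'g \<Rightarrow> 'b \<Rightarrow> 'b" +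
  fixes f :: "'a \<Rightarrow> 'b"
  assumes f_closed: "x \<in> A \<Longrightarrow> f x \<in> B"
    and f_additive: "additive_on A f"
    and f_act: "g \<in> carrier G \<Longrightarrow> x \<in> A \<Longrightarrow> f (aact g x) = bact g (f x)"
begin

lemma f_zero: "f 0 = 0"
  by (rule additive_on_zero[OF A.closed f_additive])

lemma f_diff: "x \<in> A \<Longrightarrow> y \<in> A \<Longrightarrow> f (x - y) = f x - f y"
  using f_additive by (auto simp: additive_on_def)

lemma hcochain_hom: "hcochain G A aact k F \<Longrightarrow> hcochain G B bact k (\<lambda>gs. f (F gs))"
  by (auto simp: hcochain_def f_closed f_act)

lemma bd_hom:
  assumes "hcochain G A aact k F" "gs \<in> tuples G (Suc k)"
  shows "bd (\<lambda>hs. f (F hs)) gs = f (bd F gs)"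
  by (rule additive_on_bd[OF A.closed f_additive, symmetric])
     (use assms A.hcochain_mem face_tuples in blast)

lemma hcocycle_hom:
  assumes "hcocycle G A aact i F"
  shows "hcocycle G B bact i (\<lambda>gs. f (F gs))"
  using assms bd_hom by (auto simp: hcocycle_def hcochain_hom f_zero)

lemma hexact_hom:
  assumes "hexact G A aact i F"
  shows "hexact G B bact i (\<lambda>gs. f (F gs))"
proof -
  obtain E where E: "hcochain G A aact i E" "\<And>gs. gs \<in> tuples G (Suc i) \<Longrightarrow> F gs = bd E gs"
    using assms by (rule hexactE) blast
  show ?thesis
    by (rule hexactI[OF hcochain_hom[OF E(1)]]) (simp only: bd_hom[OF E(1)] E(2))
qed

text \<open>Preimages are chosen on tuples with head \<open>\<one>\<close> only and spread by the
  action. The empty tuple is excluded: its value is an invariant, and invariants need not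
  lift.\<close>

lemma hcochain_lift:
  assumes c: "hcochain G B bact (Suc k) c" and surj: "B \<subseteq> f ` A"
  obtains b where "hcochain G A aact (Suc k) b" "\<And>gs. gs \<in> tuples G (Suc k) \<Longrightarrow> f (b gs) = c gs"
proof -
  define s where "s = inv_into A f"
  have s: "s x \<in> A \<and> f (s x) = x" if "x \<in> B" for x
    using surj that by (auto simp: s_def inv_into_into f_inv_into_f subset_iff)
  define b where "b = (\<lambda>gs. aact (hd gs) (s (c (map (\<lambda>x. inv (hd gs) \<otimes> x) gs))))"
  have "hcochain G A aact (Suc k) b"
    unfolding b_def
    by (rule A.hcochain_extend[of k "\<lambda>gs. s (c gs)"]) (use c s in \<open>auto simp: hcochain_def\<close>)
  moreover have "f (b gs) = c gs" if gs: "gs \<in> tuples G (Suc k)" for gs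
  proof -
    have h: "hd gs \<in> carrier G"
      using gs by (auto simp: tuples_def) (metis Zero_not_Suc hd_in_set list.size(3) subsetD)
    have t: "map (\<lambda>x. inv (hd gs) \<otimes> x) gs \<in> tuples G (Suc k)"
      using h gs by (simp add: A.tuples_mult)
    have m: "map (\<lambda>x. hd gs \<otimes> x) (map (\<lambda>x. inv (hd gs) \<otimes> x) gs) = gs"
      using gs h by (auto simp: tuples_def subset_iff intro!: map_idI)
        (metis A.inv_closed A.l_one A.m_assoc A.r_inv)
    have "f (b gs) = bact (hd gs) (c (map (\<lambda>x. inv (hd gs) \<otimes> x) gs))"
      unfolding b_def using h s[OF B.hcochain_mem[OF c t]] by (simp add: f_act)
    also have "\<dots> = c gs"
      using B.hcochain_act[OF c t h] m by simp
    finally show ?thesis .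
  qed
  ultimately show thesis using that by blast
qed

text \<open>Injectivity of \<open>f\<close> makes the preimages equivariant by themselves, so here
  the empty tuple is allowed.\<close>

lemma hcochain_pull:
  assumes c: "hcochain G B bact k c" and inj: "inj_on f A"
    and im: "\<And>gs. gs \<in> tuples G k \<Longrightarrow> c gs \<in> f ` A"
  obtains b where "hcochain G A aact k b" "\<And>gs. gs \<in> tuples G k \<Longrightarrow> f (b gs) = c gs"
proof -
  define b where "b = (\<lambda>gs. inv_into A f (c gs))"
  have b: "b gs \<in> A" "f (b gs) = c gs" if "gs \<in> tuples G k" for gs
    using im[OF that] by (auto simp: b_def inv_into_into f_inv_into_f)
  have "b (map (\<lambda>x. g \<otimes> x) gs) = aact g (b gs)" if "gs \<in> tuples G k" "g \<in> carrier G" for gs g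
    by (rule inj_onD[OF inj])
       (use that b A.tuples_mult A.a_closed f_act B.hcochain_act[OF c] in auto)
  then show thesis using b that[of b] by (auto simp: hcochain_def)
qed

lemma hcocycle_pull:
  assumes "hcocycle G B bact i (\<lambda>gs. f (b gs))" "hcochain G A aact (Suc i) b" "inj_on f A"
  shows "hcocycle G A aact i b"
proof -
  have "bd b gs = 0" if gs: "gs \<in> tuples G (Suc (Suc i))" for gs
  proof (rule inj_onD[OF assms(3)])
    show "f (bd b gs) = f 0"
      using bd_hom[OF assms(2) gs] assms(1) gs by (simp add: hcocycle_def f_zero)
  qed (use gs A.hcochain_bd[OF assms(2)] A.zero_mem in \<open>auto simp: hcochain_def\<close>)
  then show ?thesis using assms(2) by (simp add: hcocycle_def)
qed

end

text \<open>\<open>r\<close> maps a primitive of the image cocycle under \<open>f\<close> to a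
  primitive of \<open>F\<close>.\<close>

lemma acyclic_retract:
  assumes "gmodule_hom G A aact B bact f" "gmodule_hom G B bact A aact r"
    and "\<And>x. x \<in> A \<Longrightarrow> r (f x) = x" "acyclic_at G B bact i"
  shows "acyclic_at G A aact i"
  unfolding acyclic_at_def
proof (intro allI impI)
  interpret f: gmodule_hom G A aact B bact f by fact
  interpret r: gmodule_hom G B bact A aact r by fact
  fix F assume F: "hcocycle G A aact i F"
  then have "hexact G B bact i (\<lambda>gs. f (F gs))"
    using assms(4) f.hcocycle_hom by (auto simp: acyclic_at_def)
  from r.hexact_hom[OF this] show "hexact G A aact i F"
    by (rule hexact_cong) (use F assms(3) in \<open>auto simp: hcocycle_def hcochain_def\<close>)
qed

section \<open>The snake lemma and the long exact cohomology sequence\<close>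

locale gses = \<iota>: gmodule_hom G A aact B bact \<iota> + \<pi>: gmodule_hom G B bact C cact \<pi>
  for G :: "('g, 'z) monoid_scheme" (structure) and A :: "'a::ab_group_add set" and aact :: "'g \<Rightarrow> 'a \<Rightarrow> 'a"
    and B :: "'b::ab_group_add set" and bact :: "'g \<Rightarrow> 'b \<Rightarrow> 'b"
    and C :: "'c::ab_group_add set" and cact :: "'g \<Rightarrow> 'c \<Rightarrow> 'c" and \<iota> \<pi> +
  assumes \<iota>_inj: "inj_on \<iota> A"
    and \<pi>_surj: "C \<subseteq> \<pi> ` B"
    and exact: "x \<in> B \<Longrightarrow> \<pi> x = 0 \<longleftrightarrow> x \<in> \<iota> ` A"
begin

text \<open>The connecting homomorphism as a relation on cocycles, witnessed by a lift
  \<open>b\<close> of \<open>c\<close> whose coboundary comes from \<open>a\<close>; neither a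
  choice of lift nor cohomology classes enter.\<close>

definition conn :: "nat \<Rightarrow> ('g list \<Rightarrow> 'c) \<Rightarrow> ('g list \<Rightarrow> 'a) \<Rightarrow> bool" where
  "conn i c a \<longleftrightarrow> (\<exists>b. hcochain G B bact (Suc i) b \<and> (\<forall>gs\<in>tuples G (Suc i). \<pi> (b gs) = c gs) \<and>
     (\<forall>gs\<in>tuples G (Suc (Suc i)). bd b gs = \<iota> (a gs)))"

lemma \<pi>_\<iota>: "x \<in> A \<Longrightarrow> \<pi> (\<iota> x) = 0"
  using exact \<iota>.f_closed by blast

lemma kernel_lift:
  assumes b: "hcochain G B bact k b" and "\<And>gs. gs \<in> tuples G k \<Longrightarrow> \<pi> (b gs) = 0"
  obtains a where "hcochain G A aact k a" "\<And>gs. gs \<in> tuples G k \<Longrightarrow> \<iota> (a gs) = b gs"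
  by (rule \<iota>.hcochain_pull[OF b \<iota>_inj]) (use assms exact \<iota>.B.hcochain_mem in blast)+

lemma conn_up:
  assumes c: "hcocycle G C cact i c"
  obtains a where "hcocycle G A aact (Suc i) a" "conn i c a"
proof -
  obtain b where b: "hcochain G B bact (Suc i) b" "\<And>gs. gs \<in> tuples G (Suc i) \<Longrightarrow> \<pi> (b gs) = c gs"
    using \<pi>.hcochain_lift[OF _ \<pi>_surj] c unfolding hcocycle_def by metis
  have "\<pi> (bd b gs) = 0" if "gs \<in> tuples G (Suc (Suc i))" for gs
    using \<pi>.bd_hom[OF b(1) that] bd_tuples_cong[OF that b(2)] c that
    by (simp add: hcocycle_def)
  then obtain a where a: "hcochain G A aact (Suc (Suc i)) a"
    "\<And>gs. gs \<in> tuples G (Suc (Suc i)) \<Longrightarrow> \<iota> (a gs) = bd b gs"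
    using kernel_lift[OF \<iota>.B.hcochain_bd[OF b(1)]] by metis
  have "hcocycle G B bact (Suc i) (\<lambda>gs. \<iota> (a gs))"
    by (rule hcocycle_cong[OF \<iota>.B.hcocycle_bd[OF b(1)]]) (use a \<iota>.A.is_monoid in auto)
  from \<iota>.hcocycle_pull[OF this a(1) \<iota>_inj] show thesis
    by (rule that) (use a(2) b in \<open>auto simp: conn_def intro!: exI[of _ b]\<close>)
qed

lemma conn_down:
  assumes a: "hcocycle G A aact (Suc i) a" and "acyclic_at G B bact (Suc i)"
  obtains c where "hcocycle G C cact i c" "conn i c a"
proof -
  obtain b where b: "hcochain G B bact (Suc i) b"
    "\<And>gs. gs \<in> tuples G (Suc (Suc i)) \<Longrightarrow> \<iota> (a gs) = bd b gs"
    using assms(2) \<iota>.hcocycle_hom[OF a] unfolding acyclic_at_def by (meson hexactE)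
  have "bd (\<lambda>gs. \<pi> (b gs)) gs = 0" if "gs \<in> tuples G (Suc (Suc i))" for gs
  proof -
    have "a gs \<in> A" using a that by (simp add: hcocycle_def hcochain_def)
    then show ?thesis
      using \<pi>.bd_hom[OF b(1) that] b(2)[OF that] \<pi>_\<iota>[of "a gs"] by simp
  qed
  then have "hcocycle G C cact i (\<lambda>gs. \<pi> (b gs))"
    using \<pi>.hcochain_hom[OF b(1)] by (simp add: hcocycle_def)
  moreover have "conn i (\<lambda>gs. \<pi> (b gs)) a"
    unfolding conn_def by (rule exI[of _ b]) (use b in auto)
  ultimately show thesis using that by blast
qed

text \<open>The connecting map is well defined: for \<open>c = bd e\<close> and a lift
  \<open>d\<close> of \<open>e\<close>, the difference \<open>b - bd d\<close> comes from
  \<open>A\<close> and has the same coboundary as \<open>b\<close>. The degree \<open>Suc i\<close>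
  makes \<open>e\<close> a function of nonempty tuples, as lifting requires.\<close>

lemma conn_hexact_A:
  assumes "conn (Suc i) c a" "hcocycle G A aact (Suc (Suc i)) a" "hexact G C cact (Suc i) c"
  shows "hexact G A aact (Suc (Suc i)) a"
proof -
  obtain b where b: "hcochain G B bact (Suc (Suc i)) b"
    "\<And>gs. gs \<in> tuples G (Suc (Suc i)) \<Longrightarrow> \<pi> (b gs) = c gs"
    "\<And>gs. gs \<in> tuples G (Suc (Suc (Suc i))) \<Longrightarrow> bd b gs = \<iota> (a gs)"
    using assms(1) unfolding conn_def by metis
  obtain e where e: "hcochain G C cact (Suc i) e" "\<And>gs. gs \<in> tuples G (Suc (Suc i)) \<Longrightarrow> c gs = bd e gs"
    using assms(3) by (rule hexactE) blast
  obtain d where d: "hcochain G B bact (Suc i) d" "\<And>gs. gs \<in> tuples G (Suc i) \<Longrightarrow> \<pi> (d gs) = e gs"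
    using \<pi>.hcochain_lift[OF e(1) \<pi>_surj] by metis
  have k: "\<pi> (b gs - bd d gs) = 0" if gs: "gs \<in> tuples G (Suc (Suc i))" for gs
  proof -
    have "\<pi> (bd d gs) = c gs"
      using \<pi>.bd_hom[OF d(1) gs] bd_tuples_cong[OF gs d(2)] e(2)[OF gs] by simp
    moreover have "b gs \<in> B" "bd d gs \<in> B"
      using b(1) \<iota>.B.hcochain_bd[OF d(1)] gs by (auto simp: hcochain_def)
    ultimately show ?thesis using b(2)[OF gs] by (simp add: \<pi>.f_diff)
  qed
  obtain a' where a': "hcochain G A aact (Suc (Suc i)) a'"
    "\<And>gs. gs \<in> tuples G (Suc (Suc i)) \<Longrightarrow> \<iota> (a' gs) = b gs - bd d gs"
    using kernel_lift[OF \<iota>.B.hcochain_diff[OF b(1) \<iota>.B.hcochain_bd[OF d(1)]]] k by blast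
  have "a gs = bd a' gs" if gs: "gs \<in> tuples G (Suc (Suc (Suc i)))" for gs
  proof (rule inj_onD[OF \<iota>_inj])
    have "\<iota> (bd a' gs) = bd (\<lambda>gs. b gs - bd d gs) gs"
      using \<iota>.bd_hom[OF a'(1) gs] bd_tuples_cong[OF gs a'(2)] by simp
    also have "\<dots> = \<iota> (a gs)" using b(3)[OF gs] by (simp add: bd_diff)
    finally show "\<iota> (a gs) = \<iota> (bd a' gs)" by simp
  qed (use assms(2) \<iota>.A.hcochain_bd[OF a'(1)] gs in \<open>auto simp: hcocycle_def hcochain_def\<close>)
  then show ?thesis using a'(1) by (auto simp: hexact_def)
qed

text \<open>Injectivity of the connecting map: if \<open>a = bd e\<close>, then \<open>b\<close>
  minus the image of \<open>e\<close> is a cocycle of \<open>B\<close>, hence exact, and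
  \<open>\<pi>\<close> maps it to \<open>c\<close>.\<close>

lemma conn_hexact_C:
  assumes "conn i c a" "acyclic_at G B bact i" "hexact G A aact (Suc i) a"
  shows "hexact G C cact i c"
proof -
  obtain b where b: "hcochain G B bact (Suc i) b"
    "\<And>gs. gs \<in> tuples G (Suc i) \<Longrightarrow> \<pi> (b gs) = c gs"
    "\<And>gs. gs \<in> tuples G (Suc (Suc i)) \<Longrightarrow> bd b gs = \<iota> (a gs)"
    using assms(1) unfolding conn_def by metis
  obtain e where e: "hcochain G A aact (Suc i) e" "\<And>gs. gs \<in> tuples G (Suc (Suc i)) \<Longrightarrow> a gs = bd e gs"
    using assms(3) by (rule hexactE) blast
  have "hcocycle G B bact i (\<lambda>gs. b gs - \<iota> (e gs))"
    using \<iota>.B.hcochain_diff[OF b(1) \<iota>.hcochain_hom[OF e(1)]] b(3) e \<iota>.bd_hom[OF e(1)]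
    by (auto simp: hcocycle_def bd_diff)
  then have "hexact G B bact i (\<lambda>gs. b gs - \<iota> (e gs))"
    using assms(2) by (simp add: acyclic_at_def)
  from \<pi>.hexact_hom[OF this] show ?thesis
  proof (rule hexact_cong)
    fix gs assume gs: "gs \<in> tuples G (Suc i)"
    have "e gs \<in> A" "b gs \<in> B" using e(1) b(1) gs by (auto simp: hcochain_def)
    then show "c gs = \<pi> (b gs - \<iota> (e gs))"
      using b(2)[OF gs] \<pi>_\<iota> \<iota>.f_closed by (simp add: \<pi>.f_diff)
  qed
qed

lemma conn_diff:
  assumes "conn i c a" "conn i c' a'" "hcocycle G A aact (Suc i) a" "hcocycle G A aact (Suc i) a'"
  shows "conn i (\<lambda>gs. c gs - c' gs) (\<lambda>gs. a gs - a' gs)"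
proof -
  obtain b where b: "hcochain G B bact (Suc i) b"
    "\<And>gs. gs \<in> tuples G (Suc i) \<Longrightarrow> \<pi> (b gs) = c gs"
    "\<And>gs. gs \<in> tuples G (Suc (Suc i)) \<Longrightarrow> bd b gs = \<iota> (a gs)"
    using assms(1) unfolding conn_def by metis
  obtain b' where b': "hcochain G B bact (Suc i) b'"
    "\<And>gs. gs \<in> tuples G (Suc i) \<Longrightarrow> \<pi> (b' gs) = c' gs"
    "\<And>gs. gs \<in> tuples G (Suc (Suc i)) \<Longrightarrow> bd b' gs = \<iota> (a' gs)"
    using assms(2) unfolding conn_def by metis
  show ?thesis unfolding conn_def
    by (rule exI[of _ "\<lambda>gs. b gs - b' gs"])
       (use b b' assms(3,4) in \<open>auto simp: \<iota>.B.diff_mem \<iota>.B.act_diff \<pi>.f_diff \<iota>.f_diff bd_diff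
          hcochain_def hcocycle_def\<close>)
qed

text \<open>Dimension shifting: the connecting map from \<open>C\<close> is onto because
  \<open>B\<close> is acyclic, and its source vanishes.\<close>

lemma acyclic_shift:
  assumes "acyclic_at G C cact (Suc i)" "acyclic_at G B bact (Suc (Suc i))"
  shows "acyclic_at G A aact (Suc (Suc i))"
  unfolding acyclic_at_def
proof (intro allI impI)
  fix a assume a: "hcocycle G A aact (Suc (Suc i)) a"
  then obtain c where "hcocycle G C cact (Suc i) c" "conn (Suc i) c a"
    using conn_down assms(2) by blast
  then show "hexact G A aact (Suc (Suc i)) a"
    using conn_hexact_A a assms(1) by (auto simp: acyclic_at_def)
qed

lemma \<iota>_injective:
  assumes "acyclic_at G C cact (Suc i)" "hcocycle G A aact (Suc (Suc i)) a"
    and "hexact G B bact (Suc (Suc i)) (\<lambda>gs. \<iota> (a gs))"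
  shows "hexact G A aact (Suc (Suc i)) a"
proof -
  obtain b where b: "hcochain G B bact (Suc (Suc i)) b"
    "\<And>gs. gs \<in> tuples G (Suc (Suc (Suc i))) \<Longrightarrow> \<iota> (a gs) = bd b gs"
    using assms(3) by (rule hexactE) blast
  have "bd (\<lambda>gs. \<pi> (b gs)) gs = 0" if gs: "gs \<in> tuples G (Suc (Suc (Suc i)))" for gs
    using \<pi>.bd_hom[OF b(1) gs] b(2)[OF gs] \<pi>_\<iota>[of "a gs"] assms(2) gs
    by (simp add: hcocycle_def hcochain_def)
  then have "hcocycle G C cact (Suc i) (\<lambda>gs. \<pi> (b gs))"
    using \<pi>.hcochain_hom[OF b(1)] by (simp add: hcocycle_def)
  then have "hexact G C cact (Suc i) (\<lambda>gs. \<pi> (b gs))"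
    using assms(1) by (simp add: acyclic_at_def)
  moreover have "conn (Suc i) (\<lambda>gs. \<pi> (b gs)) a"
    unfolding conn_def by (rule exI[of _ b]) (use b in auto)
  ultimately show ?thesis using conn_hexact_A assms(2) by blast
qed

lemma \<iota>_surjective:
  assumes "acyclic_at G C cact (Suc i)" "hcocycle G B bact (Suc i) b"
  obtains a where "hcocycle G A aact (Suc i) a" "hexact G B bact (Suc i) (\<lambda>gs. b gs - \<iota> (a gs))"
proof -
  obtain e where e: "hcochain G C cact (Suc i) e" "\<And>gs. gs \<in> tuples G (Suc (Suc i)) \<Longrightarrow> \<pi> (b gs) = bd e gs"
    using assms(1) \<pi>.hcocycle_hom[OF assms(2)] unfolding acyclic_at_def by (meson hexactE)
  obtain d where d: "hcochain G B bact (Suc i) d" "\<And>gs. gs \<in> tuples G (Suc i) \<Longrightarrow> \<pi> (d gs) = e gs"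
    using \<pi>.hcochain_lift[OF e(1) \<pi>_surj] by metis
  have cc: "hcocycle G B bact (Suc i) (\<lambda>gs. b gs - bd d gs)"
    by (rule \<iota>.B.hcocycle_diff[OF assms(2) \<iota>.B.hcocycle_bd[OF d(1)]])
  have "\<pi> (b gs - bd d gs) = 0" if gs: "gs \<in> tuples G (Suc (Suc i))" for gs
  proof -
    have "\<pi> (bd d gs) = \<pi> (b gs)"
      using \<pi>.bd_hom[OF d(1) gs] bd_tuples_cong[OF gs d(2)] e(2)[OF gs] by simp
    moreover have "b gs \<in> B" "bd d gs \<in> B"
      using assms(2) \<iota>.B.hcochain_bd[OF d(1)] gs by (auto simp: hcochain_def hcocycle_def)
    ultimately show ?thesis by (simp add: \<pi>.f_diff)
  qed
  then obtain a where a: "hcochain G A aact (Suc (Suc i)) a"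
    "\<And>gs. gs \<in> tuples G (Suc (Suc i)) \<Longrightarrow> \<iota> (a gs) = b gs - bd d gs"
    using kernel_lift[of "Suc (Suc i)" "\<lambda>gs. b gs - bd d gs"] cc unfolding hcocycle_def by blast
  have "hcocycle G B bact (Suc i) (\<lambda>gs. \<iota> (a gs))"
    by (rule hcocycle_cong[OF cc]) (use a \<iota>.A.is_monoid in auto)
  then have "hcocycle G A aact (Suc i) a"
    using \<iota>.hcocycle_pull a(1) \<iota>_inj by blast
  moreover have "hexact G B bact (Suc i) (\<lambda>gs. b gs - \<iota> (a gs))"
    by (rule hexact_cong[OF \<iota>.B.hexact_bd[OF d(1)]]) (use a in auto)
  ultimately show thesis using that by blast
qed

end

section \<open>Shapiro's lemma\<close>

text \<open>The value 0 off \<open>Y\<close> makes functions on \<open>Y\<close> unique elements of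
  the function type, so equality in the module is plain equality. For a transitive \<open>Y\<close>
  this is the module coinduced from a stabilizer.\<close>

definition map_mod :: "'y set \<Rightarrow> 'a::ab_group_add set \<Rightarrow> ('y \<Rightarrow> 'a) set" where
  "map_mod Y A = {f. (\<forall>y\<in>Y. f y \<in> A) \<and> (\<forall>y. y \<notin> Y \<longrightarrow> f y = 0)}"

definition map_act ::
  "('g, 'b) monoid_scheme \<Rightarrow> 'y set \<Rightarrow> ('g \<Rightarrow> 'y \<Rightarrow> 'y) \<Rightarrow> ('g \<Rightarrow> 'a \<Rightarrow> 'a) \<Rightarrow> 'g \<Rightarrow> ('y \<Rightarrow> 'a::ab_group_add) \<Rightarrow> 'y \<Rightarrow> 'a" where
  "map_act G Y a act g f = (\<lambda>y. if y \<in> Y then act g (f (a (inv\<^bsub>G\<^esub> g) y)) else 0)"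

lemma gmodule_map:
  assumes "gset G Y a" "gmodule G A act"
  shows "gmodule G (map_mod Y A) (map_act G Y a act)"
proof -
  interpret Y: gset G Y a by fact
  interpret A: gmodule G A act by fact
  show ?thesis
  proof unfold_locales
    fix g h f assume "g \<in> carrier G" "h \<in> carrier G" "f \<in> map_mod Y A"
    then show "map_act G Y a act (g \<otimes>\<^bsub>G\<^esub> h) f = map_act G Y a act g (map_act G Y a act h f)"
      by (auto simp: map_act_def map_mod_def fun_eq_iff A.a_mult Y.a_mult Y.a_closed Y.inv_mult_group)
  qed (auto simp: map_mod_def map_act_def add_closed_def additive_on_def A.zero_mem A.diff_mem A.a_closed
      Y.a_closed A.a_one Y.a_one A.act_diff)
qed

lemma subgroup_stabilizer:
  assumes "gset G Y a" "y \<in> Y"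
  shows "subgroup (stabilizer G a y) G"
proof -
  interpret gset G Y a by fact
  show ?thesis
  proof (rule subgroupI)
    show "stabilizer G a y \<noteq> {}" using assms(2) by (auto simp: stabilizer_def a_one)
    show "inv\<^bsub>G\<^esub> g \<in> stabilizer G a y" if "g \<in> stabilizer G a y" for g
      using that a_inv[of g y] assms(2) by (auto simp: stabilizer_def)
  qed (use assms(2) in \<open>auto simp: stabilizer_def a_mult\<close>)
qed

lemma gset_subgroup:
  assumes "gset G Y a" "subgroup H G"
  shows "gset (G\<lparr>carrier := H\<rparr>) Y a"
proof -
  interpret gset G Y a by fact
  interpret H: group "G\<lparr>carrier := H\<rparr>"
    using assms(2) by (rule subgroup.subgroup_is_group) (rule is_group)
  show ?thesis
    by unfold_locales (use subgroup.mem_carrier[OF assms(2)] in \<open>auto simp: a_closed a_one a_mult\<close>)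
qed

lemma gmodule_subgroup:
  assumes "gmodule G A act" "subgroup H G"
  shows "gmodule (G\<lparr>carrier := H\<rparr>) A act"
proof -
  interpret gmodule G A act by fact
  interpret H: gset "G\<lparr>carrier := H\<rparr>" A act
    by (rule gset_subgroup[OF gset_axioms assms(2)])
  show ?thesis
    by unfold_locales (use subgroup.mem_carrier[OF assms(2)] in \<open>auto simp: closed act_additive\<close>)
qed

lemma tuples_subgroup: "subgroup H G \<Longrightarrow> gs \<in> tuples (G\<lparr>carrier := H\<rparr>) k \<Longrightarrow> gs \<in> tuples G k"
  by (auto simp: tuples_def dest: subgroup.subset)

lemma hcochain_subgroup:
  assumes "hcochain G A act k F" "subgroup H G"
  shows "hcochain (G\<lparr>carrier := H\<rparr>) A act k F"
  using assms(1) tuples_subgroup[OF assms(2)] subgroup.mem_carrier[OF assms(2)]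
  by (auto simp: hcochain_def)

lemma hcocycle_subgroup:
  assumes "hcocycle G A act i F" "subgroup H G"
  shows "hcocycle (G\<lparr>carrier := H\<rparr>) A act i F"
  using assms hcochain_subgroup tuples_subgroup[OF assms(2)] by (fastforce simp: hcocycle_def)

lemma hexact_subgroup:
  assumes "hexact G A act i F" "subgroup H G"
  shows "hexact (G\<lparr>carrier := H\<rparr>) A act i F"
proof -
  obtain E where E: "hcochain G A act i E" "\<And>gs. gs \<in> tuples G (Suc i) \<Longrightarrow> F gs = bd E gs"
    using assms(1) by (rule hexactE) blast
  show ?thesis
    by (rule hexactI[OF hcochain_subgroup[OF E(1) assms(2)]])
       (rule E(2)[OF tuples_subgroup[OF assms(2)]])
qed

text \<open>Division by a chosen representative of the right coset of \<open>g\<close> gives a map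
  to \<open>H\<close> that commutes with left multiplication by \<open>H\<close>.\<close>

lemma coset_section:
  assumes "group G" "subgroup H G"
  obtains p where "\<And>g. g \<in> carrier G \<Longrightarrow> p g \<in> H"
    "\<And>g h. g \<in> carrier G \<Longrightarrow> h \<in> H \<Longrightarrow> p (h \<otimes>\<^bsub>G\<^esub> g) = h \<otimes>\<^bsub>G\<^esub> p g"
    "p \<one>\<^bsub>G\<^esub> = \<one>\<^bsub>G\<^esub>"
proof -
  interpret group G by fact
  interpret H: subgroup H G by fact
  define s where "s = (\<lambda>g. SOME x. x \<in> H #>\<^bsub>G\<^esub> g)"
  have s: "\<exists>h\<in>H. s g = h \<otimes>\<^bsub>G\<^esub> g" if "g \<in> carrier G" for g
  proof -
    have "s g \<in> H #>\<^bsub>G\<^esub> g"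
      unfolding s_def by (rule someI[of _ g]) (rule rcos_self[OF that assms(2)])
    then show ?thesis by (auto simp: r_coset_def)
  qed
  have s_mult: "s (h \<otimes>\<^bsub>G\<^esub> g) = s g" if "g \<in> carrier G" "h \<in> H" for g h
  proof -
    have "H #>\<^bsub>G\<^esub> (h \<otimes>\<^bsub>G\<^esub> g) = H #>\<^bsub>G\<^esub> g"
      using that coset_join2[of h H] coset_mult_assoc[of H h g] assms(2) H.subset by auto
    then show ?thesis by (simp add: s_def)
  qed
  have sc: "s g \<in> carrier G" if "g \<in> carrier G" for g
    using s[OF that] that by auto
  define p0 where "p0 = (\<lambda>g. g \<otimes>\<^bsub>G\<^esub> inv\<^bsub>G\<^esub> s g)"
  have p0: "p0 g \<in> H" if g: "g \<in> carrier G" for g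
  proof -
    obtain h where h: "h \<in> H" "s g = h \<otimes>\<^bsub>G\<^esub> g" using s[OF g] by blast
    then have "p0 g = inv\<^bsub>G\<^esub> h"
      using g by (simp add: p0_def inv_mult_group m_assoc[symmetric])
    then show ?thesis using h by simp
  qed
  have p0_mult: "p0 (h \<otimes>\<^bsub>G\<^esub> g) = h \<otimes>\<^bsub>G\<^esub> p0 g" if "g \<in> carrier G" "h \<in> H" for g h
    using that sc by (simp add: p0_def s_mult m_assoc)
  have c: "p0 g \<in> carrier G" if "g \<in> carrier G" for g using p0[OF that] by simp
  \<comment> \<open>Right multiplication by a constant of \<open>H\<close> keeps the equivariance
    and moves the value at the neutral element to the neutral element.\<close>
  show thesis
    by (rule that[of "\<lambda>g. p0 g \<otimes>\<^bsub>G\<^esub> inv\<^bsub>G\<^esub> p0 \<one>\<^bsub>G\<^esub>"])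
       (use p0 p0_mult c in \<open>auto simp: m_assoc\<close>)
qed

locale map_module = Y: gset G Y a + A: gmodule G A act
  for G :: "('g, 'z) monoid_scheme" (structure) and Y :: "'y set" and a
    and A :: "'a::ab_group_add set" and act
begin

sublocale M: gmodule G "map_mod Y A" "map_act G Y a act"
  by (rule gmodule_map) unfold_locales

lemma hcochain_mapI:
  assumes "\<And>gs y. gs \<in> tuples G k \<Longrightarrow> y \<in> Y \<Longrightarrow> F gs y \<in> A"
    and "\<And>gs y. gs \<in> tuples G k \<Longrightarrow> y \<notin> Y \<Longrightarrow> F gs y = 0"
    and "\<And>gs g y. gs \<in> tuples G k \<Longrightarrow> g \<in> carrier G \<Longrightarrow> y \<in> Y \<Longrightarrow>
           F (map (\<lambda>x. g \<otimes> x) gs) (a g y) = act g (F gs y)"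
  shows "hcochain G (map_mod Y A) (map_act G Y a act) k F"
  unfolding hcochain_def
proof (intro ballI conjI)
  fix gs g assume gs: "gs \<in> tuples G k" and g: "g \<in> carrier G"
  show "F (map (\<lambda>x. g \<otimes> x) gs) = map_act G Y a act g (F gs)"
  proof
    fix y show "F (map (\<lambda>x. g \<otimes> x) gs) y = map_act G Y a act g (F gs) y"
      using assms(2)[OF A.tuples_mult[OF gs g]] assms(3)[OF gs g, of "a (inv g) y"] g
      by (auto simp: map_act_def Y.a_closed)
  qed
qed (use assms in \<open>auto simp: map_mod_def\<close>)

lemma hcochain_mapD:
  assumes "hcochain G (map_mod Y A) (map_act G Y a act) k F" "gs \<in> tuples G k"
  shows "y \<in> Y \<Longrightarrow> F gs y \<in> A" "y \<notin> Y \<Longrightarrow> F gs y = 0"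
    "g \<in> carrier G \<Longrightarrow> y \<in> Y \<Longrightarrow> F (map (\<lambda>x. g \<otimes> x) gs) (a g y) = act g (F gs y)"
proof -
  show "y \<in> Y \<Longrightarrow> F gs y \<in> A" "y \<notin> Y \<Longrightarrow> F gs y = 0"
    using assms by (auto simp: hcochain_def map_mod_def)
  assume "g \<in> carrier G" "y \<in> Y"
  then show "F (map (\<lambda>x. g \<otimes> x) gs) (a g y) = act g (F gs y)"
    using M.hcochain_act[OF assms] by (simp add: map_act_def Y.a_closed)
qed

text \<open>Evaluation at \<open>y\<close>, with the group cut down to the stabilizer, is the map of
  Shapiro's lemma.\<close>

lemma evaluation_hcochain:
  assumes F: "hcochain G (map_mod Y A) (map_act G Y a act) k F" and y: "y \<in> Y"
  shows "hcochain (G\<lparr>carrier := stabilizer G a y\<rparr>) A act k (\<lambda>hs. F hs y)"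
proof -
  have s: "subgroup (stabilizer G a y) G"
    by (rule subgroup_stabilizer[OF Y.gset_axioms y])
  show ?thesis
    unfolding hcochain_def
  proof (intro ballI conjI)
    fix hs h assume hs: "hs \<in> tuples (G\<lparr>carrier := stabilizer G a y\<rparr>) k"
    note t = tuples_subgroup[OF s hs]
    show "F hs y \<in> A" using hcochain_mapD(1)[OF F t y] .
    assume "h \<in> carrier (G\<lparr>carrier := stabilizer G a y\<rparr>)"
    then have "h \<in> carrier G" "a h y = y" by (auto simp: stabilizer_def)
    then show "F (map (\<lambda>x. h \<otimes>\<^bsub>G\<lparr>carrier := stabilizer G a y\<rparr>\<^esub> x) hs) y = act h (F hs y)"
      using hcochain_mapD(3)[OF F t, of h y] y by simp
  qed
qed

lemma evaluation_hcocycle: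
  assumes F: "hcocycle G (map_mod Y A) (map_act G Y a act) i F" and y: "y \<in> Y"
  shows "hcocycle (G\<lparr>carrier := stabilizer G a y\<rparr>) A act i (\<lambda>hs. F hs y)"
proof -
  have s: "subgroup (stabilizer G a y) G"
    by (rule subgroup_stabilizer[OF Y.gset_axioms y])
  show ?thesis
    using F tuples_subgroup[OF s] evaluation_hcochain[OF _ y]
    by (auto simp: hcocycle_def bd_apply[symmetric])
qed

lemma evaluation_hexact:
  assumes F: "hexact G (map_mod Y A) (map_act G Y a act) i F" and y: "y \<in> Y"
  shows "hexact (G\<lparr>carrier := stabilizer G a y\<rparr>) A act i (\<lambda>hs. F hs y)"
proof -
  have s: "subgroup (stabilizer G a y) G"
    by (rule subgroup_stabilizer[OF Y.gset_axioms y])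
  obtain E where E: "hcochain G (map_mod Y A) (map_act G Y a act) i E"
    "\<And>gs. gs \<in> tuples G (Suc i) \<Longrightarrow> F gs = bd E gs"
    using F by (rule hexactE) blast
  show ?thesis
    by (rule hexactI[OF evaluation_hcochain[OF E(1) y]])
       (simp add: E(2) tuples_subgroup[OF s] bd_apply)
qed

text \<open>Reparametrizing the tuples by \<open>q y\<close> in the component \<open>y\<close> does
  not change the class: the prism from the identity to \<open>q y\<close> is a homotopy, and
  \<open>q_act\<close> makes it equivariant.\<close>

lemma homotopy:
  assumes q: "\<And>g y. g \<in> carrier G \<Longrightarrow> y \<in> Y \<Longrightarrow> q y g \<in> carrier G"
    and q_act: "\<And>g h y. g \<in> carrier G \<Longrightarrow> h \<in> carrier G \<Longrightarrow> y \<in> Y \<Longrightarrow> q (a h y) (h \<otimes> g) = h \<otimes> q y g"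
    and F: "hcocycle G (map_mod Y A) (map_act G Y a act) i F"
  shows "hexact G (map_mod Y A) (map_act G Y a act) i
     (\<lambda>gs y. if y \<in> Y then F (map (q y) gs) y - F gs y else 0)"
proof -
  have Fc: "hcochain G (map_mod Y A) (map_act G Y a act) (Suc i) F"
    using F by (simp add: hcocycle_def)
  define E where "E = (\<lambda>gs y. if y \<in> Y then prism (\<lambda>x. x) (q y) (\<lambda>hs. F hs y) gs else 0)"
  have t: "map (\<lambda>x. x) us @ hd vs # map (q y) vs \<in> tuples G (Suc k)"
    if "gs \<in> tuples G k" "gs = us @ vs" "vs \<noteq> []" "y \<in> Y" for gs us vs y k
    using that q by (cases vs) (auto simp: tuples_def)
  have "hcochain G (map_mod Y A) (map_act G Y a act) i E"
  proof (rule hcochain_mapI)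
    fix gs y assume gs: "gs \<in> tuples G i" and y: "y \<in> Y"
    show "E gs y \<in> A"
      unfolding E_def using y
      by (simp, intro prism_closed[OF A.closed] hcochain_mapD(1)[OF Fc t[OF gs]]) auto
    fix g assume g: "g \<in> carrier G"
    have "E (map (\<lambda>x. g \<otimes> x) gs) (a g y) =
        prism (\<lambda>x. x) (q (a g y)) (\<lambda>hs. F hs (a g y)) (map (\<lambda>x. g \<otimes> x) gs)"
      using y g by (simp add: E_def Y.a_closed)
    also have "\<dots> = prism (\<lambda>x. x) (q y) (\<lambda>hs. F (map (\<lambda>x. g \<otimes> x) hs) (a g y)) gs"
      by (rule prism_map) (use q_act gs g y in \<open>auto simp: tuples_def\<close>)
    also have "\<dots> = prism (\<lambda>x. x) (q y) (\<lambda>hs. act g (F hs y)) gs"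
      by (rule prism_cong, rule hcochain_mapD(3)[OF Fc t[OF gs] g y]) (use y in auto)
    also have "\<dots> = act g (E gs y)"
      unfolding E_def using y
      by (simp, intro additive_on_prism[OF A.closed A.act_additive[OF g], symmetric]
           hcochain_mapD(1)[OF Fc t[OF gs]]) auto
    finally show "E (map (\<lambda>x. g \<otimes> x) gs) (a g y) = act g (E gs y)" .
  qed (simp add: E_def)
  then show ?thesis
  proof (rule hexactI)
    fix gs assume gs: "gs \<in> tuples G (Suc i)"
    show "(\<lambda>y. if y \<in> Y then F (map (q y) gs) y - F gs y else 0) = bd E gs"
    proof
      fix y
      show "(if y \<in> Y then F (map (q y) gs) y - F gs y else 0) = bd E gs y"
      proof (cases "y \<in> Y")
        case True
        have "prism (\<lambda>x. x) (q y) (bd (\<lambda>hs. F hs y)) gs = prism (\<lambda>x. x) (q y) (\<lambda>hs. 0) gs"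
          by (rule prism_cong, subst bd_apply[symmetric])
             (use F t[OF gs _ _ True] in \<open>simp add: hcocycle_def\<close>)
        with bd_prism[of "\<lambda>x. x" "q y" "\<lambda>hs. F hs y" gs] True
        show ?thesis by (simp add: bd_apply E_def)
      qed (simp add: bd_apply E_def)
    qed
  qed
qed

end

text \<open>The choices behind an explicit inverse of Shapiro's map: an orbit representative
  \<open>r y\<close>, an element \<open>t y\<close> carrying it to \<open>y\<close>, and for each
  point a left equivariant retraction \<open>p y\<close> of \<open>G\<close> onto its
  stabilizer.\<close>

locale orbit_section = map_module G Y a A act
  for G :: "('g, 'z) monoid_scheme" (structure) and Y :: "'y set" and a
    and A :: "'a::ab_group_add set" and act +
  fixes r :: "'y \<Rightarrow> 'y" and t :: "'y \<Rightarrow> 'g" and p :: "'y \<Rightarrow> 'g \<Rightarrow> 'g"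
  assumes r_closed: "y \<in> Y \<Longrightarrow> r y \<in> Y"
    and t_closed: "y \<in> Y \<Longrightarrow> t y \<in> carrier G"
    and t_r: "y \<in> Y \<Longrightarrow> a (t y) (r y) = y"
    and r_act: "y \<in> Y \<Longrightarrow> g \<in> carrier G \<Longrightarrow> r (a g y) = r y"
    and p_closed: "y \<in> Y \<Longrightarrow> g \<in> carrier G \<Longrightarrow> p y g \<in> stabilizer G a y"
    and p_mult: "y \<in> Y \<Longrightarrow> g \<in> carrier G \<Longrightarrow> h \<in> stabilizer G a y \<Longrightarrow> p y (h \<otimes> g) = h \<otimes> p y g"
    and p_one: "y \<in> Y \<Longrightarrow> p y \<one> = \<one>"
begin

text \<open>Moves \<open>y\<close> back to its representative and retracts to the stabilizer there.
  By \<open>\<kappa>_mult\<close> it is equivariant up to the factor inv (t (h y)) h (t y) familiar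
  from induced representations.\<close>

definition \<kappa> :: "'y \<Rightarrow> 'g \<Rightarrow> 'g" where
  "\<kappa> y g = p (r y) (inv (t y) \<otimes> g)"

lemma \<kappa>_closed: "y \<in> Y \<Longrightarrow> g \<in> carrier G \<Longrightarrow> \<kappa> y g \<in> stabilizer G a (r y)"
  by (simp add: \<kappa>_def p_closed r_closed t_closed)

lemma stabilizer_carrier: "g \<in> stabilizer G a y \<Longrightarrow> g \<in> carrier G"
  by (simp add: stabilizer_def)

lemma shift_mem:
  assumes "y \<in> Y" "h \<in> carrier G"
  shows "inv (t (a h y)) \<otimes> h \<otimes> t y \<in> stabilizer G a (r y)"
proof -
  have "a (inv (t (a h y)) \<otimes> h \<otimes> t y) (r y) = a (inv (t (a h y))) (a h y)"
    using assms by (simp add: Y.a_mult Y.a_closed r_closed t_closed t_r)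
  also have "\<dots> = a (inv (t (a h y))) (a (t (a h y)) (r (a h y)))"
    using assms by (simp add: t_r Y.a_closed)
  also have "\<dots> = r y"
    using assms by (simp add: r_closed t_closed Y.a_closed r_act)
  finally show ?thesis
    using assms by (simp add: stabilizer_def t_closed Y.a_closed)
qed

lemma \<kappa>_mult:
  assumes "y \<in> Y" "g \<in> carrier G" "h \<in> carrier G"
  shows "\<kappa> (a h y) (h \<otimes> g) = inv (t (a h y)) \<otimes> h \<otimes> t y \<otimes> \<kappa> y g"
proof -
  have "inv (t (a h y)) \<otimes> (h \<otimes> g) = (inv (t (a h y)) \<otimes> h \<otimes> t y) \<otimes> (inv (t y) \<otimes> g)"
    using assms by (simp add: t_closed Y.a_closed Y.m_assoc)
       (metis Y.inv_closed Y.l_one Y.m_assoc Y.r_inv t_closed)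
  then show ?thesis
    using assms p_mult[OF r_closed[OF assms(1)] _ shift_mem[OF assms(1,3)], of "inv (t y) \<otimes> g"]
    by (simp add: \<kappa>_def r_act t_closed)
qed

text \<open>The inverse of evaluation: a cochain on the stabilizer of \<open>r y\<close> is pulled
  back along \<open>\<kappa> y\<close>, and its value is transported from \<open>r y\<close> to
  \<open>y\<close> by \<open>t y\<close>.\<close>

definition ind :: "('y \<Rightarrow> 'g list \<Rightarrow> 'a) \<Rightarrow> 'g list \<Rightarrow> 'y \<Rightarrow> 'a" where
  "ind E gs y = (if y \<in> Y then act (t y) (E (r y) (map (\<kappa> y) gs)) else 0)"

lemma \<kappa>_tuples:
  "y \<in> Y \<Longrightarrow> gs \<in> tuples G k \<Longrightarrow> map (\<kappa> y) gs \<in> tuples (G\<lparr>carrier := stabilizer G a (r y)\<rparr>) k"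
  using \<kappa>_closed by (auto simp: tuples_def)

lemma hcochain_ind:
  assumes E: "\<And>y. y \<in> Y \<Longrightarrow> hcochain (G\<lparr>carrier := stabilizer G a (r y)\<rparr>) A act k (E (r y))"
  shows "hcochain G (map_mod Y A) (map_act G Y a act) k (ind E)"
proof (rule hcochain_mapI)
  fix gs y assume gs: "gs \<in> tuples G k" and y: "y \<in> Y"
  have EA: "E (r y) (map (\<kappa> y) gs) \<in> A"
    using E[OF y] \<kappa>_tuples[OF y gs] by (simp add: hcochain_def)
  then show "ind E gs y \<in> A"
    using y by (simp add: ind_def A.a_closed t_closed)
  fix g assume g: "g \<in> carrier G"
  define h where "h = inv (t (a g y)) \<otimes> g \<otimes> t y"
  have h: "h \<in> stabilizer G a (r y)" unfolding h_def using shift_mem[OF y g] .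
  have "map (\<kappa> (a g y)) (map (\<lambda>x. g \<otimes> x) gs) = map (\<lambda>x. h \<otimes> x) (map (\<kappa> y) gs)"
    using \<kappa>_mult[OF y _ g] gs by (auto simp: tuples_def h_def subset_iff)
  then have "ind E (map (\<lambda>x. g \<otimes> x) gs) (a g y) = act (t (a g y)) (E (r y) (map (\<lambda>x. h \<otimes> x) (map (\<kappa> y) gs)))"
    using y g by (simp add: ind_def Y.a_closed r_act del: map_map)
  also have "E (r y) (map (\<lambda>x. h \<otimes> x) (map (\<kappa> y) gs)) = act h (E (r y) (map (\<kappa> y) gs))"
    using E[OF y] \<kappa>_tuples[OF y gs] h by (simp add: hcochain_def del: map_map)
  also have "act (t (a g y)) \<dots> = act (t (a g y) \<otimes> h) (E (r y) (map (\<kappa> y) gs))"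
    using EA h y g by (simp add: A.a_mult stabilizer_carrier t_closed Y.a_closed)
  also have "t (a g y) \<otimes> h = g \<otimes> t y"
    unfolding h_def using y g by (simp add: t_closed Y.a_closed Y.m_assoc[symmetric])
  finally show "ind E (map (\<lambda>x. g \<otimes> x) gs) (a g y) = act g (ind E gs y)"
    using y g EA by (simp add: ind_def A.a_mult t_closed)
qed (simp add: ind_def)

lemma bd_ind:
  assumes E: "\<And>y. y \<in> Y \<Longrightarrow> hcochain (G\<lparr>carrier := stabilizer G a (r y)\<rparr>) A act k (E (r y))"
    and gs: "gs \<in> tuples G (Suc k)"
  shows "bd (ind E) gs = ind (\<lambda>y. bd (E y)) gs"
proof
  fix y show "bd (ind E) gs y = ind (\<lambda>y. bd (E y)) gs y"
  proof (cases "y \<in> Y")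
    case True
    have "act (t y) (bd (\<lambda>hs. E (r y) (map (\<kappa> y) hs)) gs) = bd (\<lambda>hs. act (t y) (E (r y) (map (\<kappa> y) hs))) gs"
      by (rule additive_on_bd[OF A.closed A.act_additive[OF t_closed[OF True]]])
         (use E[OF True] \<kappa>_tuples[OF True face_tuples[OF gs]] in \<open>auto simp: hcochain_def\<close>)
    then show ?thesis using True by (simp add: bd_apply ind_def bd_map)
  qed (simp add: bd_apply ind_def)
qed

text \<open>\<open>F\<close> is homotopic to the cochain induced from its own values at the
  representatives, and \<open>ind\<close> turns primitives of these values into a primitive of that
  cochain.\<close>

lemma hexact_from_stabilizers:
  assumes F: "hcocycle G (map_mod Y A) (map_act G Y a act) i F"
    and ex: "\<And>y. y \<in> Y \<Longrightarrow> hexact (G\<lparr>carrier := stabilizer G a (r y)\<rparr>) A act i (\<lambda>hs. F hs (r y))"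
  shows "hexact G (map_mod Y A) (map_act G Y a act) i F"
proof -
  define E where "E = (\<lambda>x. SOME e. hcochain (G\<lparr>carrier := stabilizer G a x\<rparr>) A act i e \<and>
    (\<forall>hs\<in>tuples (G\<lparr>carrier := stabilizer G a x\<rparr>) (Suc i). F hs x = bd e hs))"
  have E: "hcochain (G\<lparr>carrier := stabilizer G a (r y)\<rparr>) A act i (E (r y)) \<and>
    (\<forall>hs\<in>tuples (G\<lparr>carrier := stabilizer G a (r y)\<rparr>) (Suc i). F hs (r y) = bd (E (r y)) hs)"
    if "y \<in> Y" for y
    using ex[OF that] unfolding E_def hexact_def by (rule someI_ex)
  \<comment> \<open>Chosen so that equivariance of \<open>F\<close> rewrites
    \<open>F (map (q y) gs) y\<close> as \<open>t y\<close> acting on the value of \<open>F\<close>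
    at \<open>r y\<close> and the tuple \<open>map (\<kappa> y) gs\<close>, that is, as an induced
    cochain.\<close>
  define q where "q = (\<lambda>y g. t y \<otimes> \<kappa> y g)"
  have q: "q y g \<in> carrier G" if "g \<in> carrier G" "y \<in> Y" for g y
    using t_closed stabilizer_carrier[OF \<kappa>_closed] that by (simp add: q_def)
  have q_act: "q (a h y) (h \<otimes> g) = h \<otimes> q y g" if "g \<in> carrier G" "h \<in> carrier G" "y \<in> Y" for g h y
  proof -
    have k: "\<kappa> y g \<in> carrier G" using that \<kappa>_closed stabilizer_carrier by blast
    have "q (a h y) (h \<otimes> g) = t (a h y) \<otimes> (inv (t (a h y)) \<otimes> (h \<otimes> (t y \<otimes> \<kappa> y g)))"
      using that k by (simp add: q_def \<kappa>_mult t_closed Y.a_closed Y.m_assoc)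
    then show ?thesis
      using that k by (simp add: q_def t_closed Y.a_closed Y.m_assoc[symmetric])
  qed
  have Fc: "hcochain G (map_mod Y A) (map_act G Y a act) (Suc i) F"
    using F by (simp add: hcocycle_def)
  have ind: "hexact G (map_mod Y A) (map_act G Y a act) i (bd (ind E))"
    by (rule M.hexact_bd, rule hcochain_ind) (simp add: E)
  from M.hexact_diff[OF ind homotopy[OF q q_act F]]
  show ?thesis
  proof (rule hexact_cong)
    fix gs assume gs: "gs \<in> tuples G (Suc i)"
    have "bd (ind E) gs y - (if y \<in> Y then F (map (q y) gs) y - F gs y else 0) = F gs y" for y
    proof (cases "y \<in> Y")
      case True
      have k: "map (\<kappa> y) gs \<in> tuples G (Suc i)"
        using \<kappa>_closed[OF True] stabilizer_carrier gs by (auto simp: tuples_def subset_iff)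
      have "bd (ind E) gs y = act (t y) (F (map (\<kappa> y) gs) (r y))"
        using bd_ind[of i E gs] E gs True \<kappa>_tuples[OF True gs] by (simp add: ind_def)
      also have "\<dots> = F (map (q y) gs) y"
        using hcochain_mapD(3)[OF Fc k t_closed r_closed, OF True True] t_r[OF True]
        by (simp add: q_def comp_def)
      finally show ?thesis using True by simp
    qed (use gs hcochain_mapD(2)[OF Fc gs] bd_ind[of i E gs] E in \<open>simp add: ind_def\<close>)
    then show "F gs = bd (ind E) gs - (\<lambda>y. if y \<in> Y then F (map (q y) gs) y - F gs y else 0)"
      by (simp add: fun_eq_iff)
  qed
qed

lemma hcocycle_ind:
  assumes c: "\<And>y. y \<in> Y \<Longrightarrow> hcocycle (G\<lparr>carrier := stabilizer G a (r y)\<rparr>) A act i (c (r y))"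
  shows "hcocycle G (map_mod Y A) (map_act G Y a act) i (ind c)"
  unfolding hcocycle_def
proof (intro conjI ballI)
  have c': "hcochain (G\<lparr>carrier := stabilizer G a (r y)\<rparr>) A act (Suc i) (c (r y))" if "y \<in> Y" for y
    using c[OF that] by (simp add: hcocycle_def)
  then show "hcochain G (map_mod Y A) (map_act G Y a act) (Suc i) (ind c)" by (rule hcochain_ind)
  fix gs assume gs: "gs \<in> tuples G (Suc (Suc i))"
  show "bd (ind c) gs = 0"
    using bd_ind[OF c' gs] c \<kappa>_tuples[OF _ gs]
    by (auto simp: ind_def fun_eq_iff hcocycle_def A.act_zero t_closed)
qed

text \<open>Evaluation after induction is the identity on the nose: \<open>p\<close> fixes the
  stabilizer pointwise, so \<open>t y\<close> times \<open>\<kappa> y h\<close> is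
  \<open>h\<close>.\<close>

lemma ind_restrict:
  assumes y: "y \<in> Y" "r y = y"
    and c: "hcochain (G\<lparr>carrier := stabilizer G a y\<rparr>) A act k (c y)"
    and hs: "hs \<in> tuples (G\<lparr>carrier := stabilizer G a y\<rparr>) k"
  shows "ind c hs y = c y hs"
proof -
  have ts: "t y \<in> stabilizer G a y"
    using t_r[OF y(1)] y t_closed by (simp add: stabilizer_def)
  have sg: "subgroup (stabilizer G a y) G"
    by (rule subgroup_stabilizer[OF Y.gset_axioms y(1)])
  then have "inv (t y) \<in> stabilizer G a y" using ts by (rule subgroup.m_inv_closed)
  then have "\<kappa> y h = inv (t y) \<otimes> h" if "h \<in> stabilizer G a y" for h
    using p_mult[OF y(1) Y.one_closed, of "inv (t y) \<otimes> h"] p_one[OF y(1)] that y t_closed[OF y(1)]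
      subgroup.m_closed[OF sg] stabilizer_carrier by (simp add: \<kappa>_def)
  then have m: "map (\<lambda>x. t y \<otimes> x) (map (\<kappa> y) hs) = hs"
    using hs t_closed[OF y(1)] stabilizer_carrier
    by (auto simp: tuples_def subset_iff Y.m_assoc[symmetric] intro!: map_idI)
  have k: "map (\<kappa> y) hs \<in> tuples (G\<lparr>carrier := stabilizer G a y\<rparr>) k"
    using \<kappa>_tuples[OF y(1) tuples_subgroup[OF sg hs]] y by simp
  show ?thesis
    using c k ts m y unfolding hcochain_def ind_def by (auto simp del: map_map) (metis)
qed

end

lemma (in map_module) obtain_orbit_section:
  assumes "\<And>y. y \<in> Y \<Longrightarrow> \<exists>g\<in>carrier G. P (a g y)"
  obtains r t p where "orbit_section G Y a A act r t p" "\<forall>y\<in>Y. P (r y)"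
    "\<forall>y\<in>Y. \<exists>g\<in>carrier G. r y = a g y"
proof -
  define orb where "orb y = {a g y |g. g \<in> carrier G}" for y
  have orb_act: "orb (a h y) = orb y" if "y \<in> Y" "h \<in> carrier G" for h y
  proof
    show "orb (a h y) \<subseteq> orb y"
      using that by (auto simp: orb_def Y.a_mult[symmetric])
    show "orb y \<subseteq> orb (a h y)"
    proof
      fix x assume "x \<in> orb y"
      then obtain g where g: "g \<in> carrier G" "x = a g y" by (auto simp: orb_def)
      then have "x = a (g \<otimes> inv h) (a h y)" using that by (simp add: Y.a_mult Y.a_closed)
      then show "x \<in> orb (a h y)" using g that by (auto simp: orb_def)
    qed
  qed
  \<comment> \<open>Chosen from the orbit as a set, so that \<open>r\<close> is constant on
    orbits.\<close>
  define r where "r y = (SOME x. x \<in> orb y \<and> P x)" for y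
  have r: "r y \<in> orb y \<and> P (r y)" if "y \<in> Y" for y
    unfolding r_def by (rule someI_ex) (use assms[OF that] in \<open>auto simp: orb_def\<close>)
  have r_Y: "r y \<in> Y" if "y \<in> Y" for y
    using r[OF that] that by (auto simp: orb_def Y.a_closed)
  define t where "t y = (SOME g. g \<in> carrier G \<and> a g (r y) = y)" for y
  have t: "t y \<in> carrier G \<and> a (t y) (r y) = y" if y: "y \<in> Y" for y
    unfolding t_def
  proof (rule someI_ex)
    obtain g where "g \<in> carrier G" "r y = a g y" using r[OF y] by (auto simp: orb_def)
    then show "\<exists>g. g \<in> carrier G \<and> a g (r y) = y"
      using y by (intro exI[of _ "inv g"]) simp
  qed
  have "\<exists>p. (\<forall>g\<in>carrier G. p g \<in> stabilizer G a y \<and> (\<forall>h\<in>stabilizer G a y. p (h \<otimes> g) = h \<otimes> p g)) \<and> p \<one> = \<one>"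
    if "y \<in> Y" for y
    using coset_section[OF Y.is_group subgroup_stabilizer[OF Y.gset_axioms that]] by metis
  then obtain p where p: "\<And>y. y \<in> Y \<Longrightarrow> (\<forall>g\<in>carrier G. p y g \<in> stabilizer G a y \<and>
      (\<forall>h\<in>stabilizer G a y. p y (h \<otimes> g) = h \<otimes> p y g)) \<and> p y \<one> = \<one>"
    by metis
  have "orbit_section G Y a A act r t p"
    by unfold_locales (use r r_Y t p orb_act in \<open>auto simp: r_def\<close>)
  then show thesis
    using that[of r t p] r by (auto simp: orb_def)
qed

text \<open>Exactness is tested at one freely chosen point of each orbit; these points become the
  representatives of an orbit section.\<close>

theorem (in map_module) shapiro_injective:
  assumes F: "hcocycle G (map_mod Y A) (map_act G Y a act) i F"
    and "\<And>y. y \<in> Y \<Longrightarrow> \<exists>g\<in>carrier G.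
      hexact (G\<lparr>carrier := stabilizer G a (a g y)\<rparr>) A act i (\<lambda>hs. F hs (a g y))"
  shows "hexact G (map_mod Y A) (map_act G Y a act) i F"
proof -
  obtain r t p where "orbit_section G Y a A act r t p" and
    "\<forall>y\<in>Y. hexact (G\<lparr>carrier := stabilizer G a (r y)\<rparr>) A act i (\<lambda>hs. F hs (r y))"
    by (rule obtain_orbit_section[OF assms(2)]) auto
  then show ?thesis by (intro orbit_section.hexact_from_stabilizers[OF _ F]) auto
qed

theorem (in map_module) shapiro_acyclic:
  assumes "\<And>y. y \<in> Y \<Longrightarrow> acyclic_at (G\<lparr>carrier := stabilizer G a y\<rparr>) A act i"
  shows "acyclic_at G (map_mod Y A) (map_act G Y a act) i"
  unfolding acyclic_at_def
proof (intro allI impI)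
  fix F assume F: "hcocycle G (map_mod Y A) (map_act G Y a act) i F"
  show "hexact G (map_mod Y A) (map_act G Y a act) i F"
  proof (rule shapiro_injective[OF F])
    fix y assume y: "y \<in> Y"
    then show "\<exists>g\<in>carrier G. hexact (G\<lparr>carrier := stabilizer G a (a g y)\<rparr>) A act i (\<lambda>hs. F hs (a g y))"
      using evaluation_hcocycle[OF F y] assms[OF y]
      by (intro bexI[of _ \<one>]) (auto simp: Y.a_one acyclic_at_def)
  qed
qed

text \<open>The assumption on \<open>R\<close> says that it meets every orbit at most once, so the
  cocycles can be prescribed independently.\<close>

theorem (in map_module) shapiro_surjective:
  assumes R: "R \<subseteq> Y" "\<And>y g. y \<in> R \<Longrightarrow> g \<in> carrier G \<Longrightarrow> a g y \<in> R \<Longrightarrow> a g y = y"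
    and c: "\<And>y. y \<in> R \<Longrightarrow> hcocycle (G\<lparr>carrier := stabilizer G a y\<rparr>) A act i (c y)"
  obtains F where "hcocycle G (map_mod Y A) (map_act G Y a act) i F"
    "\<And>y hs. y \<in> R \<Longrightarrow> hs \<in> tuples (G\<lparr>carrier := stabilizer G a y\<rparr>) (Suc i) \<Longrightarrow> F hs y = c y hs"
proof -
  \<comment> \<open>Forces the representative of an orbit that meets \<open>R\<close> to be the
    point in \<open>R\<close>; the other orbits receive the zero cocycle.\<close>
  define P where "P = (\<lambda>x. x \<in> R \<or> (\<forall>g\<in>carrier G. a g x \<notin> R))"
  have "\<exists>g\<in>carrier G. P (a g y)" if "y \<in> Y" for y
  proof (cases "\<exists>g\<in>carrier G. a g y \<in> R")
    case False
    then have "P (a \<one> y)" using that by (auto simp: P_def Y.a_one)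
    then show ?thesis by blast
  qed (auto simp: P_def)
  then obtain r t p where os: "orbit_section G Y a A act r t p" and P: "\<forall>y\<in>Y. P (r y)"
    and r: "\<forall>y\<in>Y. \<exists>g\<in>carrier G. r y = a g y"
    by (rule obtain_orbit_section) auto
  interpret orbit_section G Y a A act r t p by fact
  define c' where "c' = (\<lambda>y. if y \<in> R then c y else (\<lambda>hs. 0))"
  have zero: "hcocycle (G\<lparr>carrier := stabilizer G a y\<rparr>) A act i (\<lambda>hs. 0)" if "y \<in> Y" for y
  proof -
    interpret S: gmodule "G\<lparr>carrier := stabilizer G a y\<rparr>" A act
      by (rule gmodule_subgroup[OF A.gmodule_axioms subgroup_stabilizer[OF Y.gset_axioms that]])
    show ?thesis by (simp add: hcocycle_def S.hcochain_zero)
  qed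
  have c': "hcocycle (G\<lparr>carrier := stabilizer G a y\<rparr>) A act i (c' y)" if "y \<in> Y" for y
    using c zero[OF that] by (simp add: c'_def)
  have "r y = y" if y: "y \<in> R" for y
  proof -
    obtain g where g: "g \<in> carrier G" "r y = a g y" using r y R(1) by blast
    have "a (inv g) (r y) = y" using g y R(1) by auto
    then have "r y \<in> R" using P g y R(1) unfolding P_def by (metis Y.inv_closed subsetD)
    then show ?thesis using R(2)[OF y g(1)] g(2) by simp
  qed
  then have "ind c' hs y = c y hs"
    if "y \<in> R" "hs \<in> tuples (G\<lparr>carrier := stabilizer G a y\<rparr>) (Suc i)" for y hs
    using ind_restrict[of y "Suc i" c' hs] that c'[of y] R(1) by (auto simp: hcocycle_def c'_def)
  then show thesis
    by (intro that[of "ind c'"] hcocycle_ind c' r_closed) auto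
qed

section \<open>Acyclicity above the dimension of a lattice action\<close>

definition lattice :: "'s set \<Rightarrow> ('s \<Rightarrow> int) set" where
  "lattice S = {v. \<forall>s. s \<notin> S \<longrightarrow> v s = 0}"

text \<open>The simplices of the standard triangulation of \<open>\<real>\<^sup>S\<close> with vertex set \<open>\<int>\<^sup>S\<close>: the chains
  \<open>v\<^sub>0 < \<dots> < v\<^sub>k \<le> v\<^sub>0 + (1,\<dots>,1)\<close>. An action that preserves the order and commutes with this translation
  permutes them without reordering vertices, so no orientation characters arise.\<close>

definition cube_chain :: "'s set \<Rightarrow> ('s \<Rightarrow> int) list \<Rightarrow> bool" where
  "cube_chain S vs \<longleftrightarrow> set vs \<subseteq> lattice S \<and> sorted_wrt (\<le>) vs \<and>
     (\<forall>u\<in>set vs. \<forall>v\<in>set vs. \<forall>s. v s \<le> u s + 1)"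

definition simplices :: "'s set \<Rightarrow> nat \<Rightarrow> ('s \<Rightarrow> int) list set" where
  "simplices S k = {vs. cube_chain S vs \<and> distinct vs \<and> length vs = k}"

lemma set_subseq: "subseq us vs \<Longrightarrow> set us \<subseteq> set vs"
  by (auto dest: list_emb_set)

lemma sorted_wrt_subseq:
  assumes "subseq us vs" "sorted_wrt P vs"
  shows "sorted_wrt P us"
  using assms
proof (induction rule: list_emb.induct)
  case (list_emb_Cons2 x y xs ys)
  then show ?case using set_subseq[of xs ys] by auto
qed auto

lemma distinct_subseq:
  assumes "subseq us vs" "distinct vs"
  shows "distinct us"
  using assms
proof (induction rule: list_emb.induct)
  case (list_emb_Cons2 x y xs ys)
  then show ?case using set_subseq[of xs ys] by auto
qed auto

lemma cube_chain_subseq: "cube_chain S vs \<Longrightarrow> subseq us vs \<Longrightarrow> cube_chain S us"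
  unfolding cube_chain_def using set_subseq[of us vs] sorted_wrt_subseq[of us vs "(\<le>)"] by blast

lemma simplices_face:
  "vs \<in> simplices S (Suc k) \<Longrightarrow> subseq us vs \<Longrightarrow> Suc (length us) = length vs \<Longrightarrow> us \<in> simplices S k"
  by (auto simp: simplices_def intro: cube_chain_subseq distinct_subseq)

text \<open>Along a chain the coordinate sum grows by at least 1 at each step, while its total
  growth is at most the number of coordinates.\<close>

lemma simplices_empty:
  assumes "finite S" "k > card S + 1"
  shows "simplices S k = {}"
proof -
  have le: "(\<Sum>s\<in>S. hd vs s) + int (length vs) \<le> (\<Sum>s\<in>S. last vs s) + 1"
    if "vs \<noteq> []" "set vs \<subseteq> lattice S" "sorted_wrt (\<le>) vs" "distinct vs" for vs
    using that
  proof (induction vs rule: induct_list012)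
    case (3 v w vs)
    have vw: "v \<le> w" "v \<noteq> w" using 3 by auto
    have "\<exists>s\<in>S. v s < w s"
    proof (rule ccontr)
      assume "\<not> ?thesis"
      then have "v s = w s" for s
        using vw(1) 3(4) by (cases "s \<in> S") (force simp: le_fun_def lattice_def)+
      then show False using vw(2) by auto
    qed
    then have "(\<Sum>s\<in>S. v s) < (\<Sum>s\<in>S. w s)"
      using vw(1) assms(1) by (auto simp: le_fun_def intro: sum_strict_mono_ex1)
    moreover have "(\<Sum>s\<in>S. w s) + int (length (w # vs)) \<le> (\<Sum>s\<in>S. last (w # vs) s) + 1"
      using 3 by auto
    ultimately show ?case by simp
  qed auto
  have False if "vs \<in> simplices S k" for vs
  proof -
    have ne: "vs \<noteq> []" using that assms(2) by (auto simp: simplices_def)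
    have "last vs s \<le> hd vs s + 1" for s
      using that ne by (auto simp: simplices_def cube_chain_def)
    then have "(\<Sum>s\<in>S. last vs s) \<le> (\<Sum>s\<in>S. hd vs s + 1)" by (intro sum_mono)
    also have "\<dots> = (\<Sum>s\<in>S. hd vs s) + int (card S)" by (simp add: sum.distrib)
    finally show False
      using le[OF ne] that assms(2) by (auto simp: simplices_def cube_chain_def)
  qed
  then show ?thesis by blast
qed

text \<open>The maps \<open>clip j\<close> lead from the constant map \<open>0\<close> to the identity (locally, for large \<open>j\<close>) through
  steps that move each simplex inside a prism of simplices; the sum of the prism operators contracts the
  complex.\<close>

definition clip :: "nat \<Rightarrow> ('s \<Rightarrow> int) \<Rightarrow> 's \<Rightarrow> int" where
  "clip j v = (\<lambda>s. max (- int (j div 2)) (min (v s) (int (Suc j div 2))))"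

lemma clip_lattice: "v \<in> lattice S \<Longrightarrow> clip j v \<in> lattice S"
  by (auto simp: lattice_def clip_def)

lemma clip_0: "clip 0 v = (\<lambda>s. 0)"
  by (auto simp: clip_def)

lemma clip_eq: "(\<And>s. \<bar>v s\<bar> \<le> int N) \<Longrightarrow> 2 * N \<le> j \<Longrightarrow> clip j v = v"
proof
  fix s assume *: "\<And>s. \<bar>v s\<bar> \<le> int N" and "2 * N \<le> j"
  then have "N \<le> j div 2" "N \<le> Suc j div 2" by auto
  then have "int N \<le> int (j div 2)" "int N \<le> int (Suc j div 2)" by linarith+
  then show "clip j v s = v s" using *[of s] by (simp add: clip_def)
qed

text \<open>What the prism between \<open>\<phi>\<close> and \<open>\<psi>\<close> over a simplex
  needs in order to consist of chains of the triangulation, possibly with repetitions.\<close>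

definition close_maps :: "(('s \<Rightarrow> int) \<Rightarrow> 's \<Rightarrow> int) \<Rightarrow> (('s \<Rightarrow> int) \<Rightarrow> 's \<Rightarrow> int) \<Rightarrow> bool" where
  "close_maps \<phi> \<psi> \<longleftrightarrow> (\<forall>u v. u \<le> v \<longrightarrow> \<phi> u \<le> \<phi> v \<and> \<psi> u \<le> \<psi> v) \<and> (\<forall>v. \<phi> v \<le> \<psi> v) \<and>
     (\<forall>u v. (\<forall>s. v s \<le> u s + 1) \<longrightarrow> (\<forall>s. \<psi> v s \<le> \<phi> u s + 1))"

text \<open>One step widens the interval at one end only. Raising the upper end (even
  \<open>j\<close>) increases the map, lowering the lower end (odd \<open>j\<close>) decreases it;
  the smaller map of the pair comes first in both cases.\<close>

lemma close_clip:
  "even j \<Longrightarrow> close_maps (clip j) (clip (Suc j))"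
  "odd j \<Longrightarrow> close_maps (clip (Suc j)) (clip j)"
proof -
  have mono: "max (- l) (min x h) \<le> max (- l) (min y h)" if "x \<le> y" for x y l h :: int
    using that by linarith
  have step: "max (- l) (min x h) \<le> max (- l) (min x (h + 1))"
    "max (- (l + 1)) (min x h) \<le> max (- l) (min x h)"
    "y \<le> x + 1 \<Longrightarrow> max (- l) (min y (h + 1)) \<le> max (- l) (min x h) + 1"
    "y \<le> x + 1 \<Longrightarrow> max (- l) (min y h) \<le> max (- (l + 1)) (min x h) + 1"
    for x y l h :: int
    by linarith+
  show "close_maps (clip j) (clip (Suc j))" if "even j"
  proof -
    have "int (Suc j div 2) = int (j div 2)" "int (Suc (Suc j) div 2) = int (j div 2) + 1"
      using that by auto
    note eq = this
    show ?thesis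
      unfolding close_maps_def clip_def le_fun_def eq
      by (intro conjI allI impI; (rule mono | rule step(1) | rule step(3)); blast)
  qed
  show "close_maps (clip (Suc j)) (clip j)" if "odd j"
  proof -
    have "int (Suc j div 2) = int (j div 2) + 1" "int (Suc (Suc j) div 2) = int (j div 2) + 1"
      using that by auto
    note eq = this
    show ?thesis
      unfolding close_maps_def clip_def le_fun_def eq
      by (intro conjI allI impI; (rule mono | rule step(2) | rule step(4)); blast)
  qed
qed

lemma cube_chain_prism:
  assumes "close_maps \<phi> \<psi>" "cube_chain S (us @ vs)" "vs \<noteq> []"
    and "\<And>v. v \<in> lattice S \<Longrightarrow> \<phi> v \<in> lattice S" "\<And>v. v \<in> lattice S \<Longrightarrow> \<psi> v \<in> lattice S"
  shows "cube_chain S (map \<phi> us @ \<phi> (hd vs) # map \<psi> vs)"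
proof -
  have m: "\<phi> u \<le> \<phi> v" "\<psi> u \<le> \<psi> v" "\<phi> u \<le> \<psi> v" if "u \<le> v" for u v
    using assms(1) that unfolding close_maps_def by (blast intro: order_trans)+
  have c: "\<psi> v s \<le> \<phi> u s + 1" "\<phi> v s \<le> \<phi> u s + 1" "\<psi> v s \<le> \<psi> u s + 1" "\<phi> v s \<le> \<psi> u s + 1"
    if "\<forall>s. v s \<le> u s + 1" for u v s
  proof -
    have "\<psi> v s \<le> \<phi> u s + 1" "\<phi> v s \<le> \<psi> v s" "\<phi> u s \<le> \<psi> u s"
      using assms(1) that unfolding close_maps_def by (auto simp: le_fun_def)
    then show "\<psi> v s \<le> \<phi> u s + 1" "\<phi> v s \<le> \<phi> u s + 1" "\<psi> v s \<le> \<psi> u s + 1" "\<phi> v s \<le> \<psi> u s + 1"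
      by linarith+
  qed
  obtain w ws where vs: "vs = w # ws" using assms(3) by (cases vs) auto
  show ?thesis
    using assms(2,4,5) unfolding cube_chain_def vs
    by (auto simp: sorted_wrt_append sorted_wrt_map m c)
      (auto elim!: sorted_wrt_mono_rel[rotated] simp: m)
qed

text \<open>Repeated entries of a sorted list are adjacent. The two faces omitting one of an equal
  adjacent pair cancel, and every other face still has a repetition.\<close>

lemma bd_degenerate:
  assumes "\<And>us. \<not> distinct us \<Longrightarrow> F us = 0" "sorted_wrt (\<le>) vs" "\<not> distinct vs"
  shows "bd F (vs :: 'v::order list) = (0::'a::ab_group_add)"
  using assms
proof (induction vs arbitrary: F)
  case (Cons v vs)
  show ?case
  proof (cases "distinct vs")
    case True
    then obtain w ws where vs: "vs = w # ws" using Cons.prems(3) by (cases vs) auto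
    have "v = w" using Cons.prems(2,3) True by (auto simp: vs)
    then show ?thesis using Cons.prems(1) by (simp add: vs)
  next
    case False
    then have "bd (\<lambda>us. F (v # us)) vs = 0"
      by (intro Cons.IH) (use Cons.prems in auto)
    then show ?thesis using False Cons.prems(1) by simp
  qed
qed simp

lemma simplices_exact:
  fixes F :: "('s \<Rightarrow> int) list \<Rightarrow> 'a::ab_group_add"
  assumes S: "finite S" and A: "add_closed A"
    and FA: "\<And>vs. F vs \<in> A" and F0: "\<And>vs. vs \<notin> simplices S (Suc k) \<Longrightarrow> F vs = 0"
    and dF: "\<And>vs. vs \<in> simplices S (Suc (Suc k)) \<Longrightarrow> bd F vs = 0"
  obtains E where "\<And>vs. E vs \<in> A" "\<And>vs. vs \<notin> simplices S k \<Longrightarrow> E vs = 0"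
    "\<And>vs. vs \<in> simplices S (Suc k) \<Longrightarrow> F vs = bd E vs"
proof -
  have F_deg: "F vs = 0" if "\<not> distinct vs" for vs
    using F0 that by (auto simp: simplices_def)
  \<comment> \<open>Clipping is not injective, so the cocycle condition is also needed on chains
    with repetitions, where \<open>F\<close> vanishes.\<close>
  have dF': "bd F vs = 0" if "cube_chain S vs" "length vs = Suc (Suc k)" for vs
  proof (cases "distinct vs")
    case True
    then show ?thesis using dF that by (auto simp: simplices_def)
  next
    case False
    then show ?thesis using bd_degenerate[of F vs] F_deg that by (auto simp: cube_chain_def)
  qed
  \<comment> \<open>The prism runs from the smaller to the larger map, hence the sign for odd
    \<open>j\<close>.\<close>
  define T where "T = (\<lambda>j vs. if even j then prism (clip j) (clip (Suc j)) F vs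
      else - prism (clip (Suc j)) (clip j) F vs)"
  have bd_close: "bd (prism \<phi> \<psi> F) vs = F (map \<psi> vs) - F (map \<phi> vs)"
    if "close_maps \<phi> \<psi>" "cube_chain S vs" "length vs = Suc k"
      "\<And>v. v \<in> lattice S \<Longrightarrow> \<phi> v \<in> lattice S" "\<And>v. v \<in> lattice S \<Longrightarrow> \<psi> v \<in> lattice S"
    for \<phi> \<psi> vs
  proof -
    have "prism \<phi> \<psi> (bd F) vs = prism \<phi> \<psi> (\<lambda>_. 0) vs"
      by (rule prism_cong, rule dF') (use that in \<open>auto intro: cube_chain_prism simp del: map_append\<close>)
    then show ?thesis using bd_prism[of \<phi> \<psi> F vs] by simp
  qed
  have bd_T: "bd (T j) vs = F (map (clip (Suc j)) vs) - F (map (clip j) vs)"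
    if "cube_chain S vs" "length vs = Suc k" for j vs
  proof (cases "even j")
    case True
    then show ?thesis
      using bd_close[OF close_clip(1)[OF True] that] by (simp add: T_def clip_lattice)
  next
    case False
    have "bd (T j) vs = - bd (prism (clip (Suc j)) (clip j) F) vs"
      using False bd_diff[of "\<lambda>vs. 0" "prism (clip (Suc j)) (clip j) F" vs] by (simp add: T_def)
    then show ?thesis
      using bd_close[OF close_clip(2)[OF False] that] by (simp add: clip_lattice)
  qed
  \<comment> \<open>Once the interval contains all coordinates, both maps fix the vertices and each
    term of the prism repeats a vertex.\<close>
  have T_0: "T j us = 0" if "\<And>v s. v \<in> set us \<Longrightarrow> \<bar>v s\<bar> \<le> int N" "2 * N \<le> j" for j us N
  proof -
    have c: "clip j v = v" "clip (Suc j) v = v" if "v \<in> set us" for v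
      using clip_eq[of v N] that \<open>2 * N \<le> j\<close> \<open>\<And>v s. v \<in> set us \<Longrightarrow> \<bar>v s\<bar> \<le> int N\<close> by auto
    have "prism \<phi> \<psi> F us = prism \<phi> \<psi> (\<lambda>_. 0) us"
      if "\<And>v. v \<in> set us \<Longrightarrow> \<phi> v = v" "\<And>v. v \<in> set us \<Longrightarrow> \<psi> v = v" for \<phi> \<psi>
    proof (rule prism_cong, rule F_deg)
      fix xs ys assume "us = xs @ ys" "ys \<noteq> []"
      then show "\<not> distinct (map \<phi> xs @ \<phi> (hd ys) # map \<psi> ys)"
        using that by (cases ys) auto
    qed
    then show ?thesis using c by (simp add: T_def)
  qed
  have T_A: "T j us \<in> A" for j us
    unfolding T_def by (auto intro!: prism_closed[OF A] FA add_closedD(3)[OF A])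
  \<comment> \<open>An infinite sum in disguise: on each simplex only finitely many
    \<open>T j\<close> are nonzero, and summing over these indices avoids a bound that depends on
    the simplex.\<close>
  define E where "E = (\<lambda>us. if us \<in> simplices S k then (\<Sum>j | T j us \<noteq> 0. T j us) else 0)"
  have bd_E: "bd E vs = F vs - F (map (clip 0) vs)" if vs: "vs \<in> simplices S (Suc k)" for vs
  proof -
    have cc: "cube_chain S vs" "length vs = Suc k" using vs by (auto simp: simplices_def)
    define N where "N = nat (\<Sum>v\<in>set vs. \<Sum>s\<in>S. \<bar>v s\<bar>)"
    have N: "\<bar>v s\<bar> \<le> int N" if "v \<in> set vs" for v s
    proof (cases "s \<in> S")
      case True
      have "\<bar>v s\<bar> \<le> (\<Sum>s\<in>S. \<bar>v s\<bar>)"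
        by (rule member_le_sum[OF True]) (use S in auto)
      also have "\<dots> \<le> (\<Sum>v\<in>set vs. \<Sum>s\<in>S. \<bar>v s\<bar>)"
        by (rule member_le_sum[OF that]) (auto simp: sum_nonneg)
      finally show ?thesis by (simp add: N_def)
    next
      case False
      have "v \<in> lattice S" using cc(1) that unfolding cube_chain_def by blast
      then show ?thesis using False by (simp add: lattice_def)
    qed
    have "bd E vs = bd (\<lambda>us. \<Sum>j<2 * N. T j us) vs"
    proof (rule bd_cong)
      fix us assume us: "subseq us vs" "Suc (length us) = length vs"
      have z: "T j us = 0" if "2 * N \<le> j" for j
        by (rule T_0[OF _ that]) (use N set_subseq[OF us(1)] in blast)
      have "(\<Sum>j | T j us \<noteq> 0. T j us) = (\<Sum>j<2 * N. T j us)"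
        by (rule sum.mono_neutral_left) (use z not_le in auto)
      then show "E us = (\<Sum>j<2 * N. T j us)"
        using simplices_face[OF vs us] by (simp add: E_def)
    qed
    also have "\<dots> = (\<Sum>j<2 * N. F (map (clip (Suc j)) vs) - F (map (clip j) vs))"
      using cc by (simp add: bd_sum bd_T)
    also have "\<dots> = F (map (clip (2 * N)) vs) - F (map (clip 0) vs)"
      by (rule sum_lessThan_telescope)
    also have "map (clip (2 * N)) vs = vs"
      by (rule map_idI, rule clip_eq, rule N) auto
    finally show ?thesis .
  qed
  \<comment> \<open>\<open>clip 0\<close> collapses everything to the origin. For
    \<open>k > 0\<close> the collapsed simplex is degenerate and contributes nothing; for
    \<open>k = 0\<close> the value of \<open>F\<close> at the origin remains, and the empty simplex
    absorbs it.\<close>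
  show thesis
  proof (cases k)
    case 0
    define E' where "E' = (\<lambda>us::('s \<Rightarrow> int) list. if us = [] then F [\<lambda>s. 0] else 0)"
    have "F vs = bd E' vs" if vs: "vs \<in> simplices S (Suc k)" for vs
    proof -
      obtain v where v: "vs = [v]" using vs 0 by (auto simp: simplices_def length_Suc_conv)
      have "bd E [v] = 0" by (simp add: E_def T_def)
      then have "F [v] = F [\<lambda>s. 0]" using bd_E[OF vs] by (simp only: v list.map clip_0) simp
      then show ?thesis by (simp only: v bd.simps E'_def) simp
    qed
    then show thesis
      by (intro that[of E'])
        (use FA add_closedD(1)[OF A] 0 in \<open>auto simp: E'_def simplices_def cube_chain_def\<close>)
  next
    case (Suc k')
    have "F (map (clip 0) vs) = 0" if vs: "vs \<in> simplices S (Suc k)" for vs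
    proof (rule F_deg)
      obtain v w ws where "vs = v # w # ws" using vs Suc by (auto simp: simplices_def length_Suc_conv)
      then show "\<not> distinct (map (clip 0) vs)" by (simp add: clip_0)
    qed
    then have "F vs = bd E vs" if "vs \<in> simplices S (Suc k)" for vs
      using bd_E[OF that] that by simp
    then show thesis
      by (rule that[rotated 2]) (auto simp: E_def intro!: T_A add_closed_sum[OF A] add_closedD(1)[OF A])
  qed
qed

section \<open>The resolution by cochains on simplices\<close>

locale lattice_action = A: gmodule G A act + V: gset G "lattice S" a
  for G :: "('g, 'z) monoid_scheme" (structure) and A :: "'a::ab_group_add set" and act
    and S :: "'s set" and a +
  assumes S_finite: "finite S"
    and a_mono: "g \<in> carrier G \<Longrightarrow> u \<in> lattice S \<Longrightarrow> v \<in> lattice S \<Longrightarrow> u \<le> v \<Longrightarrow> a g u \<le> a g v"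
    and a_bounded: "g \<in> carrier G \<Longrightarrow> u \<in> lattice S \<Longrightarrow> v \<in> lattice S \<Longrightarrow>
          (\<And>s. v s \<le> u s + 1) \<Longrightarrow> a g v s \<le> a g u s + 1"
begin

abbreviation "C k \<equiv> map_mod (simplices S k) A"
abbreviation "C_act k \<equiv> map_act G (simplices S k) (\<lambda>g. map (a g)) act"

definition Z :: "nat \<Rightarrow> (('s \<Rightarrow> int) list \<Rightarrow> 'a) set" where
  "Z k = {F \<in> C k. \<forall>vs\<in>simplices S (Suc k). bd F vs = 0}"

definition \<delta> :: "nat \<Rightarrow> (('s \<Rightarrow> int) list \<Rightarrow> 'a) \<Rightarrow> ('s \<Rightarrow> int) list \<Rightarrow> 'a" where
  "\<delta> k F = (\<lambda>vs. if vs \<in> simplices S (Suc k) then bd F vs else 0)"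

lemma simplices_lattice: "vs \<in> simplices S k \<Longrightarrow> v \<in> set vs \<Longrightarrow> v \<in> lattice S"
  by (auto simp: simplices_def cube_chain_def)

sublocale chains: gset G "simplices S k" "\<lambda>g. map (a g)"
proof unfold_locales
  fix g vs assume g: "g \<in> carrier G" and vs: "vs \<in> simplices S k"
  have inj: "inj_on (a g) (lattice S)"
    by (rule inj_on_inverseI[of _ "a (inv g)"]) (use g in auto)
  then show "map (a g) vs \<in> simplices S k"
    using vs g a_mono a_bounded inj_on_subset[OF inj]
    by (auto simp: simplices_def cube_chain_def distinct_map sorted_wrt_map V.a_closed subset_iff
        elim!: sorted_wrt_mono_rel[rotated])
next
  fix vs assume "vs \<in> simplices S k"
  then show "map (a \<one>) vs = vs"
    using simplices_lattice V.a_one by (auto intro!: map_idI)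
next
  fix g h vs assume "g \<in> carrier G" "h \<in> carrier G" "vs \<in> simplices S k"
  then show "map (a (g \<otimes> h)) vs = map (a g) (map (a h) vs)"
    using simplices_lattice V.a_mult by auto
qed

sublocale C: map_module G "simplices S k" "\<lambda>g. map (a g)" A act
  by unfold_locales

lemma \<delta>_act:
  assumes F: "F \<in> C k" and g: "g \<in> carrier G"
  shows "\<delta> k (C_act k g F) = C_act (Suc k) g (\<delta> k F)"
proof
  fix vs
  show "\<delta> k (C_act k g F) vs = C_act (Suc k) g (\<delta> k F) vs"
  proof (cases "vs \<in> simplices S (Suc k)")
    case True
    have "bd (C_act k g F) vs = bd (\<lambda>us. act g (F (map (a (inv g)) us))) vs"
      by (rule bd_cong) (use simplices_face[OF True] in \<open>auto simp: map_act_def\<close>)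
    also have "\<dots> = act g (bd (\<lambda>us. F (map (a (inv g)) us)) vs)"
      by (rule additive_on_bd[OF A.closed A.act_additive[OF g], symmetric])
        (use simplices_face[OF True] chains.a_closed F g in \<open>auto simp: map_mod_def\<close>)
    finally show ?thesis
      using True g chains.a_closed[of "inv g" vs "Suc k"] by (simp add: \<delta>_def map_act_def bd_map)
  qed (auto simp: \<delta>_def map_act_def)
qed

lemma \<delta>_Z:
  assumes F: "F \<in> C k"
  shows "\<delta> k F \<in> Z (Suc k)"
proof -
  have "bd F vs \<in> A" if "vs \<in> simplices S (Suc k)" for vs
    by (rule bd_closed[OF A.closed]) (use simplices_face[OF that] F in \<open>auto simp: map_mod_def\<close>)
  moreover have "bd (\<delta> k F) vs = 0" if "vs \<in> simplices S (Suc (Suc k))" for vs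
    using bd_cong[of vs "\<delta> k F" "bd F"] simplices_face[OF that] by (simp add: \<delta>_def)
  ultimately show ?thesis by (auto simp: Z_def map_mod_def \<delta>_def)
qed

lemma gmodule_Z: "gmodule G (Z k) (C_act k)"
proof -
  have "C_act k g F \<in> Z k" if g: "g \<in> carrier G" and F: "F \<in> Z k" for g F
  proof -
    have Fk: "F \<in> C k" using F by (simp add: Z_def)
    have "\<delta> k (C_act k g F) = 0"
      unfolding \<delta>_act[OF Fk g] using F g
      by (auto simp: map_act_def \<delta>_def Z_def A.act_zero fun_eq_iff)
    then have "bd (C_act k g F) vs = 0" if "vs \<in> simplices S (Suc k)" for vs
      using that unfolding \<delta>_def fun_eq_iff by (metis zero_fun_apply)
    then show ?thesis using C.M.a_closed[OF g Fk] by (simp add: Z_def)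
  qed
  moreover have "add_closed (Z k)"
    using C.M.closed[of k] by (auto simp: add_closed_def Z_def fun_diff_def zero_fun_def bd_diff)
  ultimately show ?thesis
    by unfold_locales
      (auto simp: Z_def C.M.a_one C.M.a_mult additive_on_def C.M.act_diff)
qed

text \<open>These sequences cut the simplicial resolution A -> C 1 -> C 2 -> ... into short exact
  pieces; the index counts vertices. Surjectivity of \<open>\<delta> k\<close> is
  \<open>simplices_exact\<close>, the contractibility of the triangulated space.\<close>

lemma gses_Z: "gses G (Z k) (C_act k) (C k) (C_act k) (Z (Suc k)) (C_act (Suc k)) (\<lambda>F. F) (\<delta> k)"
proof -
  interpret Z: gmodule G "Z k" "C_act k" by (rule gmodule_Z)
  interpret Z': gmodule G "Z (Suc k)" "C_act (Suc k)" by (rule gmodule_Z)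
  show ?thesis
  proof unfold_locales
    show "additive_on (C k) (\<delta> k)"
      by (auto simp: additive_on_def \<delta>_def fun_eq_iff fun_diff_def bd_diff)
    show "Z (Suc k) \<subseteq> \<delta> k ` C k"
    proof
      fix F assume F: "F \<in> Z (Suc k)"
      obtain E where E: "\<And>vs. E vs \<in> A" "\<And>vs. vs \<notin> simplices S k \<Longrightarrow> E vs = 0"
        "\<And>vs. vs \<in> simplices S (Suc k) \<Longrightarrow> F vs = bd E vs"
      proof (rule simplices_exact[OF S_finite A.closed, of F k])
        show "F vs \<in> A" for vs
          using F A.zero_mem by (cases "vs \<in> simplices S (Suc k)") (auto simp: Z_def map_mod_def)
      qed (use F in \<open>auto simp: Z_def map_mod_def\<close>)
      have "F = \<delta> k E"
        using E F by (auto simp: \<delta>_def fun_eq_iff Z_def map_mod_def)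
      moreover have "E \<in> C k" using E by (auto simp: map_mod_def)
      ultimately show "F \<in> \<delta> k ` C k" by blast
    qed
    show "F \<in> C k \<Longrightarrow> (\<delta> k F = 0) = (F \<in> (\<lambda>F. F) ` Z k)" for F
      by (auto simp: Z_def \<delta>_def fun_eq_iff)
    show "F \<in> C k \<Longrightarrow> \<delta> k F \<in> Z (Suc k)" for F by (rule \<delta>_Z)
  qed (auto simp: Z_def \<delta>_act additive_on_def)
qed

text \<open>Dimension shifting: \<open>Z (card S + 1)\<close> is a full cochain module because there
  are no larger simplices, each of the \<open>card S\<close> steps down to \<open>Z 1\<close> costs
  one degree, and \<open>Z 1\<close> is a copy of \<open>A\<close>. Only nonempty simplices occur;
  the empty one is fixed by the whole group.\<close>

theorem acyclic_above_dimension: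
  assumes C: "\<And>k i. 0 < i \<Longrightarrow> acyclic_at G (C (Suc k)) (C_act (Suc k)) i" and i: "i > card S"
  shows "acyclic_at G A act i"
proof -
  let ?N = "card S"
  have acyc: "acyclic_at G (Z (?N + 1 - d)) (C_act (?N + 1 - d)) i" if "d \<le> ?N" "i > d" for d i
    using that
  proof (induction d arbitrary: i)
    case 0
    have "Z (?N + 1) = C (?N + 1)"
      using simplices_empty[OF S_finite, of "Suc (?N + 1)"] by (auto simp: Z_def)
    then show ?case using C[of i ?N] 0 by simp
  next
    case (Suc d)
    obtain j where j: "i = Suc (Suc j)" using Suc.prems(2) by (metis less_nat_zero_code not0_implies_Suc Suc_less_eq)
    obtain k where k: "?N + 1 - Suc d = Suc k" "?N + 1 - d = Suc (Suc k)"
      using Suc.prems(1) by (metis Suc_diff_le Suc_eq_plus1 diff_Suc_Suc le_Suc_eq not_less_eq_eq Suc_diff_Suc less_eq_Suc_le)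
    show ?case
      using gses.acyclic_shift[OF gses_Z[of "Suc k"], of j] Suc.IH[of "Suc j"] Suc.prems C[of "Suc (Suc j)" k]
      unfolding k j by simp
  qed
  \<comment> \<open>\<open>A\<close> sits in \<open>Z 1\<close> as the constant functions on
    vertices. Evaluation at the origin retracts onto it and is equivariant on \<open>Z 1\<close>
    because all elements of \<open>Z 1\<close> are constant.\<close>
  define f where "f = (\<lambda>x::'a. \<lambda>vs. if vs \<in> simplices S 1 then x else 0)"
  define r where "r = (\<lambda>F::('s \<Rightarrow> int) list \<Rightarrow> 'a. F [\<lambda>s. 0])"
  interpret Z: gmodule G "Z 1" "C_act 1" by (rule gmodule_Z)
  have o: "[\<lambda>s. 0] \<in> simplices S 1"
    by (auto simp: simplices_def cube_chain_def lattice_def)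
  have const: "F vs = r F" if F: "F \<in> Z 1" and vs: "vs \<in> simplices S 1" for F vs
  proof -
    obtain E where E: "\<And>vs. vs \<in> simplices S (Suc 0) \<Longrightarrow> F vs = bd E vs"
    proof (rule simplices_exact[OF S_finite A.closed, of F 0])
      show "F vs \<in> A" for vs
        using F A.zero_mem by (cases "vs \<in> simplices S 1") (auto simp: Z_def map_mod_def)
    qed (use F in \<open>auto simp: Z_def map_mod_def\<close>)
    have "bd E us = E []" if "length us = 1" for us
      using that by (auto simp: length_Suc_conv)
    then show ?thesis using E vs o by (simp add: r_def simplices_def)
  qed
  have Z1: "f x \<in> Z 1" if "x \<in> A" for x
  proof -
    have "bd (f x) vs = 0" if vs: "vs \<in> simplices S 2" for vs
    proof -
      obtain u v where uv: "vs = [u, v]"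
        using vs by (auto simp: simplices_def numeral_2_eq_2 length_Suc_conv)
      have "[u] \<in> simplices S 1" "[v] \<in> simplices S 1"
        using simplices_face[of vs S 1] vs uv by (auto simp: numeral_2_eq_2)
      then show ?thesis by (simp add: uv f_def)
    qed
    then show ?thesis using that by (auto simp: Z_def map_mod_def f_def numeral_2_eq_2)
  qed
  have "acyclic_at G (Z 1) (C_act 1) i" using acyc[of ?N i] i by simp
  moreover have "gmodule_hom G A act (Z 1) (C_act 1) f"
  proof unfold_locales
    show "f (act g x) = C_act 1 g (f x)" if "g \<in> carrier G" "x \<in> A" for g x
      using that chains.a_closed[of "inv g" _ 1] by (auto simp: f_def map_act_def fun_eq_iff)
    show "f x \<in> Z 1" if "x \<in> A" for x using that by (rule Z1)
    show "additive_on A f" unfolding additive_on_def f_def fun_eq_iff by simp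
  qed
  moreover have "gmodule_hom G (Z 1) (C_act 1) A act r"
  proof unfold_locales
    show "r (C_act 1 g F) = act g (r F)" if "g \<in> carrier G" "F \<in> Z 1" for g F
    proof -
      have "map (a (inv g)) [\<lambda>s. 0] \<in> simplices S 1"
        using that(1) o by (intro chains.a_closed) auto
      from const[OF that(2) this] show ?thesis
        using o unfolding r_def map_act_def by (simp only: if_True)
    qed
    show "additive_on (Z 1) r" unfolding additive_on_def r_def by simp
    show "r F \<in> A" if "F \<in> Z 1" for F using that o by (auto simp: r_def Z_def map_mod_def)
  qed
  moreover have "r (f x) = x" for x using o by (simp add: r_def f_def)
  ultimately show ?thesis by (intro acyclic_retract[of G A act "Z 1" "C_act 1" f r]) auto
qed

end

section \<open>Periodicity and the quotient by the constants\<close>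

text \<open>Injectivity and surjectivity of \<open>\<alpha>\<close> on cohomology, phrased with
  cocycles; for \<open>i > 0\<close> exactness means that the class vanishes.\<close>

definition cohomology_iso ::
  "('g, 'b) monoid_scheme \<Rightarrow> 'a::ab_group_add set \<Rightarrow> ('g \<Rightarrow> 'a \<Rightarrow> 'a) \<Rightarrow> 'c::ab_group_add set \<Rightarrow>
    ('g \<Rightarrow> 'c \<Rightarrow> 'c) \<Rightarrow> ('a \<Rightarrow> 'c) \<Rightarrow> nat \<Rightarrow> bool" where
  "cohomology_iso G A act C cact \<alpha> i \<longleftrightarrow>
     (\<forall>a. hcocycle G A act i a \<longrightarrow> hexact G C cact i (\<lambda>gs. \<alpha> (a gs)) \<longrightarrow> hexact G A act i a) \<and>
     (\<forall>c. hcocycle G C cact i c \<longrightarrow>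
        (\<exists>a. hcocycle G A act i a \<and> hexact G C cact i (\<lambda>gs. c gs - \<alpha> (a gs))))"

lemma (in gses) cohomology_iso_\<iota>:
  assumes "acyclic_at G C cact (Suc i)" "acyclic_at G C cact (Suc (Suc i))"
  shows "cohomology_iso G A aact B bact \<iota> (Suc (Suc i))"
  unfolding cohomology_iso_def
proof (intro conjI allI impI)
  show "hexact G A aact (Suc (Suc i)) a"
    if "hcocycle G A aact (Suc (Suc i)) a" "hexact G B bact (Suc (Suc i)) (\<lambda>gs. \<iota> (a gs))" for a
    by (rule \<iota>_injective[OF assms(1) that])
  show "\<exists>a. hcocycle G A aact (Suc (Suc i)) a \<and> hexact G B bact (Suc (Suc i)) (\<lambda>gs. c gs - \<iota> (a gs))"
    if "hcocycle G B bact (Suc (Suc i)) c" for c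
    by (rule \<iota>_surjective[OF assms(2) that]) blast
qed

lemma conn_hom:
  assumes "gses G A aact B bact C cact \<iota> \<pi>" "gses G A' aact' B' bact' C' cact' \<iota>' \<pi>'"
    and "gmodule_hom G B bact B' bact' \<beta>"
    and \<iota>: "\<And>x. x \<in> A \<Longrightarrow> \<beta> (\<iota> x) = \<iota>' (\<alpha> x)" and \<pi>: "\<And>x. x \<in> B \<Longrightarrow> \<gamma> (\<pi> x) = \<pi>' (\<beta> x)"
    and c: "gses.conn G B bact \<iota> \<pi> i c a" and a: "hcocycle G A aact (Suc i) a"
  shows "gses.conn G B' bact' \<iota>' \<pi>' i (\<lambda>gs. \<gamma> (c gs)) (\<lambda>gs. \<alpha> (a gs))"
proof -
  interpret gses G A aact B bact C cact \<iota> \<pi> by fact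
  interpret s: gses G A' aact' B' bact' C' cact' \<iota>' \<pi>' by fact
  interpret \<beta>: gmodule_hom G B bact B' bact' \<beta> by fact
  obtain b where b: "hcochain G B bact (Suc i) b" "\<And>gs. gs \<in> tuples G (Suc i) \<Longrightarrow> \<pi> (b gs) = c gs"
    "\<And>gs. gs \<in> tuples G (Suc (Suc i)) \<Longrightarrow> bd b gs = \<iota> (a gs)"
    using c unfolding conn_def by metis
  show ?thesis
    unfolding s.conn_def
  proof (intro exI[of _ "\<lambda>gs. \<beta> (b gs)"] conjI ballI)
    show "hcochain G B' bact' (Suc i) (\<lambda>gs. \<beta> (b gs))" by (rule \<beta>.hcochain_hom[OF b(1)])
    show "\<pi>' (\<beta> (b gs)) = \<gamma> (c gs)" if "gs \<in> tuples G (Suc i)" for gs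
      using \<pi>[of "b gs"] b(1) b(2)[OF that] that by (simp add: hcochain_def)
    show "bd (\<lambda>gs. \<beta> (b gs)) gs = \<iota>' (\<alpha> (a gs))" if gs: "gs \<in> tuples G (Suc (Suc i))" for gs
      using \<beta>.bd_hom[OF b(1) gs] b(3)[OF gs] \<iota>[of "a gs"] a gs by (simp add: hcocycle_def hcochain_def)
  qed
qed

text \<open>Connecting maps identify degree \<open>Suc i\<close> of the quotients with degree
  \<open>Suc (Suc i)\<close> of the submodules, and naturality (\<open>conn_hom\<close>) transfers
  the isomorphism. Surjectivity of the connecting map is used for the first sequence only, which
  explains the asymmetric assumptions.\<close>

lemma cohomology_iso_descent:
  assumes S: "gses G A aact B bact C cact \<iota> \<pi>" and S': "gses G A' aact' B' bact' C' cact' \<iota>' \<pi>'"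
    and \<alpha>: "gmodule_hom G A aact A' aact' \<alpha>" and \<beta>: "gmodule_hom G B bact B' bact' \<beta>"
    and \<gamma>: "gmodule_hom G C cact C' cact' \<gamma>"
    and \<iota>: "\<And>x. x \<in> A \<Longrightarrow> \<beta> (\<iota> x) = \<iota>' (\<alpha> x)" and \<pi>: "\<And>x. x \<in> B \<Longrightarrow> \<gamma> (\<pi> x) = \<pi>' (\<beta> x)"
    and B: "acyclic_at G B bact (Suc i)" "acyclic_at G B bact (Suc (Suc i))"
    and B': "acyclic_at G B' bact' (Suc i)"
    and iso: "cohomology_iso G A aact A' aact' \<alpha> (Suc (Suc i))"
  shows "cohomology_iso G C cact C' cact' \<gamma> (Suc i)"
proof -
  interpret s: gses G A aact B bact C cact \<iota> \<pi> by fact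
  interpret s': gses G A' aact' B' bact' C' cact' \<iota>' \<pi>' by fact
  interpret \<alpha>: gmodule_hom G A aact A' aact' \<alpha> by fact
  interpret \<gamma>: gmodule_hom G C cact C' cact' \<gamma> by fact
  note nat = conn_hom[OF S S' \<beta> \<iota> \<pi>]
  show ?thesis
    unfolding cohomology_iso_def
  proof (intro conjI allI impI)
    fix c assume c: "hcocycle G C cact (Suc i) c" and e: "hexact G C' cact' (Suc i) (\<lambda>gs. \<gamma> (c gs))"
    obtain a where a: "hcocycle G A aact (Suc (Suc i)) a" "s.conn (Suc i) c a"
      by (rule s.conn_up[OF c])
    have "hexact G A' aact' (Suc (Suc i)) (\<lambda>gs. \<alpha> (a gs))"
      by (rule s'.conn_hexact_A[OF nat[OF _ _ a(2,1)] \<alpha>.hcocycle_hom[OF a(1)] e])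
    then have "hexact G A aact (Suc (Suc i)) a"
      using iso a(1) by (simp add: cohomology_iso_def)
    then show "hexact G C cact (Suc i) c"
      by (rule s.conn_hexact_C[OF a(2) B(1)])
  next
    fix c' assume c': "hcocycle G C' cact' (Suc i) c'"
    obtain a' where a': "hcocycle G A' aact' (Suc (Suc i)) a'" "s'.conn (Suc i) c' a'"
      by (rule s'.conn_up[OF c'])
    obtain a where a: "hcocycle G A aact (Suc (Suc i)) a"
      "hexact G A' aact' (Suc (Suc i)) (\<lambda>gs. a' gs - \<alpha> (a gs))"
      using iso a'(1) unfolding cohomology_iso_def by blast
    obtain c where c: "hcocycle G C cact (Suc i) c" "s.conn (Suc i) c a"
      by (rule s.conn_down[OF a(1) B(2)])
    have "s'.conn (Suc i) (\<lambda>gs. c' gs - \<gamma> (c gs)) (\<lambda>gs. a' gs - \<alpha> (a gs))"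
      by (rule s'.conn_diff[OF a'(2) nat[OF _ _ c(2) a(1)] a'(1) \<alpha>.hcocycle_hom[OF a(1)]])
    then have "hexact G C' cact' (Suc i) (\<lambda>gs. c' gs - \<gamma> (c gs))"
      by (rule s'.conn_hexact_C[OF _ B' a(2)])
    then show "\<exists>c. hcocycle G C cact (Suc i) c \<and> hexact G C' cact' (Suc i) (\<lambda>gs. c' gs - \<gamma> (c gs))"
      using c(1) by blast
  qed
qed

lemma additive_on_sum:
  assumes "add_closed A" "additive_on A f" "\<And>j. j \<in> J \<Longrightarrow> x j \<in> A"
  shows "f (sum x J) = (\<Sum>j\<in>J. f (x j))"
proof -
  have add: "f (u + v) = f u + f v" if "u \<in> A" "v \<in> A" for u v
    using assms(2) add_closedD(4)[OF assms(1) that] that unfolding additive_on_def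
    by (metis add_diff_cancel_right' diff_add_cancel)
  show ?thesis
    using assms(3)
    by (induction J rule: infinite_finite_induct)
      (auto simp: additive_on_zero[OF assms(1,2)] add add_closed_sum[OF assms(1)])
qed

text \<open>\<open>e\<close> stands for a homomorphism to Z/m, given by the rotations of m points
  that it induces; \<open>P\<close> is the module of functions on Z/m.\<close>

locale cyclic_module = gmodule G A act
  for G :: "('g, 'z) monoid_scheme" (structure) and A :: "'a::ab_group_add set" and act +
  fixes m :: nat and e :: "'g \<Rightarrow> nat"
  assumes m_pos: "m > 0"
    and rot_gset: "gset G {..<m} (\<lambda>g k. (e g + k) mod m)"
begin

abbreviation "rot \<equiv> (\<lambda>g k. (e g + k) mod m)"
abbreviation "P \<equiv> map_mod {..<m} A"
abbreviation "P_act \<equiv> map_act G {..<m} rot act"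

text \<open>The middle of A -> P -> P -> A: image of the difference map \<open>\<tau>\<close> and
  kernel of the sum. Here the four-term sequence splits into \<open>gses_first\<close> and
  \<open>gses_second\<close>.\<close>

definition J :: "(nat \<Rightarrow> 'a) set" where
  "J = {f \<in> P. (\<Sum>k<m. f k) = 0}"

definition cst :: "'a \<Rightarrow> nat \<Rightarrow> 'a" where
  "cst x = (\<lambda>k. if k < m then x else 0)"

definition \<tau> :: "(nat \<Rightarrow> 'a) \<Rightarrow> nat \<Rightarrow> 'a" where
  "\<tau> f = (\<lambda>k. if k < m then f (Suc k mod m) - f k else 0)"

sublocale rot: gset G "{..<m}" rot
  by (rule rot_gset)

sublocale P: map_module G "{..<m}" rot A act
  by unfold_locales

lemma sum_cyclic:
  fixes f :: "nat \<Rightarrow> 'b::ab_group_add"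
  shows "(\<Sum>k<m. f (Suc k mod m)) = (\<Sum>k<m. f k)"
proof -
  obtain m' where m: "m = Suc m'" using m_pos by (cases m) auto
  have "(\<Sum>k<m. f (Suc k mod m)) = (\<Sum>k<m'. f (Suc k)) + f 0"
    unfolding m by (simp add: mod_less)
  also have "\<dots> = (\<Sum>k<m. f k)"
    unfolding m sum.lessThan_Suc_shift by (simp add: add.commute)
  finally show ?thesis .
qed

lemma sum_rot:
  assumes g: "g \<in> carrier G"
  shows "(\<Sum>k<m. f (rot (inv g) k)) = (\<Sum>k<m. f k)"
proof (rule sum.reindex_bij_witness[of _ "rot g" "rot (inv g)"])
  fix k assume k: "k \<in> {..<m}"
  show "rot g (rot (inv g) k) = k" "rot (inv g) (rot g k) = k"
    using rot.a_inv2[OF g k] rot.a_inv[OF g k] by simp_all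
  show "rot (inv g) k \<in> {..<m}" "rot g k \<in> {..<m}" using m_pos by auto
qed simp

lemma sum_P_act:
  assumes g: "g \<in> carrier G" and f: "f \<in> P"
  shows "(\<Sum>k<m. P_act g f k) = act g (\<Sum>k<m. f k)"
proof -
  have "(\<Sum>k<m. P_act g f k) = (\<Sum>k<m. act g (f (rot (inv g) k)))"
    by (rule sum.cong) (auto simp: map_act_def)
  also have "\<dots> = (\<Sum>k<m. act g (f k))"
    by (rule sum_rot[OF g])
  also have "\<dots> = act g (\<Sum>k<m. f k)"
    by (rule additive_on_sum[OF closed act_additive[OF g], symmetric]) (use f in \<open>auto simp: map_mod_def\<close>)
  finally show ?thesis .
qed

lemma gmodule_J: "gmodule G J P_act"
proof -
  have "P_act g f \<in> J" if "g \<in> carrier G" "f \<in> J" for g f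
    using that sum_P_act[of g f] P.M.a_closed[of g f] act_zero[of g] unfolding J_def by simp
  moreover have "add_closed J"
    using P.M.closed by (auto simp: add_closed_def J_def sum_subtractf)
  ultimately show ?thesis
    by unfold_locales (auto simp: J_def P.M.a_one P.M.a_mult additive_on_def P.M.act_diff)
qed

lemma \<tau>_J: "f \<in> P \<Longrightarrow> \<tau> f \<in> J"
  using m_pos sum_cyclic[of f] by (auto simp: J_def \<tau>_def map_mod_def diff_mem sum_subtractf)

lemma gses_first: "gses G A act P P_act J P_act cst \<tau>"
proof -
  interpret J: gmodule G J P_act by (rule gmodule_J)
  show ?thesis
  proof unfold_locales
    show "cst x \<in> P" if "x \<in> A" for x using that by (simp add: cst_def map_mod_def)
    show "additive_on A cst" by (auto simp: additive_on_def cst_def fun_eq_iff)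
    show "cst (act g x) = P_act g (cst x)" if "g \<in> carrier G" "x \<in> A" for g x
      using m_pos by (auto simp: cst_def map_act_def fun_eq_iff)
    show "\<tau> x \<in> J" if "x \<in> P" for x by (rule \<tau>_J[OF that])
    show "additive_on P \<tau>" by (auto simp: additive_on_def \<tau>_def fun_eq_iff)
    show "\<tau> (P_act g f) = P_act g (\<tau> f)" if g: "g \<in> carrier G" and f: "f \<in> P" for g f
    proof
      fix k show "\<tau> (P_act g f) k = P_act g (\<tau> f) k"
      proof (cases "k < m")
        case True
        \<comment> \<open>Rotations commute, so \<open>\<tau>\<close> is equivariant.\<close>
        have 1: "rot (inv g) (Suc k mod m) = Suc (rot (inv g) k) mod m"
          by (simp add: mod_simps)
        have "f (rot (inv g) k) \<in> A" "f (Suc (rot (inv g) k) mod m) \<in> A"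
          using f m_pos by (auto simp: map_mod_def)
        then show ?thesis
          using True m_pos g 1 by (simp add: \<tau>_def map_act_def act_diff)
      qed (simp add: \<tau>_def map_act_def)
    qed
    show "inj_on cst A"
      using m_pos by (auto simp: inj_on_def cst_def fun_eq_iff split: if_splits)
    show "J \<subseteq> \<tau> ` P"
    proof
      fix f assume f: "f \<in> J"
      \<comment> \<open>Summation inverts the difference map; going around from m - 1 to 0 is
        consistent because the total sum vanishes.\<close>
      define u where "u = (\<lambda>k. if k < m then \<Sum>j<k. f j else 0)"
      have "u \<in> P" using f by (auto simp: J_def u_def map_mod_def intro!: add_closed_sum[OF closed])
      moreover have "f = \<tau> u"
      proof
        fix k show "f k = \<tau> u k"
        proof (cases "Suc k < m")
          case False
          show ?thesis
          proof (cases "Suc k = m")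
            case True
            have "(\<Sum>j<Suc k. f j) = 0" using f True by (simp add: J_def)
            then show ?thesis using True by (auto simp: \<tau>_def u_def add_eq_0_iff)
          qed (use False f in \<open>auto simp: \<tau>_def J_def map_mod_def\<close>)
        qed (auto simp: \<tau>_def u_def)
      qed
      ultimately show "f \<in> \<tau> ` P" by blast
    qed
    show "(\<tau> f = 0) = (f \<in> cst ` A)" if f: "f \<in> P" for f
    proof
      assume t: "\<tau> f = 0"
      have "k < m \<longrightarrow> f k = f 0" for k
      proof (induction k)
        case (Suc k)
        show ?case
        proof
          assume k: "Suc k < m"
          have "\<tau> f k = 0" using t by simp
          then show "f (Suc k) = f 0" using Suc k by (simp add: \<tau>_def)
        qed
      qed simp
      then have const: "k < m \<Longrightarrow> f k = f 0" for k by blast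
      have "f k = cst (f 0) k" for k
      proof (cases "k < m")
        case True
        then show ?thesis unfolding cst_def if_P[OF True] by (rule const)
      next
        case False
        then show ?thesis using f by (simp add: cst_def map_mod_def)
      qed
      then have "f = cst (f 0)" by blast
      moreover have "f 0 \<in> A" using f m_pos by (simp add: map_mod_def)
      ultimately show "f \<in> cst ` A" by (rule image_eqI)
    next
      assume "f \<in> cst ` A"
      then show "\<tau> f = 0" using m_pos by (auto simp: \<tau>_def cst_def fun_eq_iff)
    qed
  qed
qed

lemma gses_second: "gses G J P_act P P_act A act (\<lambda>f. f) (\<lambda>f. \<Sum>k<m. f k)"
proof -
  interpret J: gmodule G J P_act by (rule gmodule_J)
  show ?thesis
  proof unfold_locales
    show "f \<in> J \<Longrightarrow> f \<in> P" for f by (simp add: J_def)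
    show "additive_on J (\<lambda>f. f)" by (simp add: additive_on_def)
    show "additive_on P (\<lambda>f. \<Sum>k<m. f k)" by (simp add: additive_on_def sum_subtractf)
    show "f \<in> P \<Longrightarrow> (\<Sum>k<m. f k) \<in> A" for f
      by (auto simp: map_mod_def intro!: add_closed_sum[OF closed])
    show "g \<in> carrier G \<Longrightarrow> f \<in> P \<Longrightarrow> (\<Sum>k<m. P_act g f k) = act g (\<Sum>k<m. f k)" for g f
      by (rule sum_P_act)
    show "A \<subseteq> (\<lambda>f. \<Sum>k<m. f k) ` P"
    proof
      fix x assume x: "x \<in> A"
      define f where "f = (\<lambda>k::nat. if k = 0 then x else 0)"
      have "f \<in> P" using x m_pos by (auto simp: f_def map_mod_def zero_mem)
      moreover have "(\<Sum>k<m. f k) = x" using m_pos by (simp add: f_def sum.delta)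
      ultimately show "x \<in> (\<lambda>f. \<Sum>k<m. f k) ` P" by blast
    qed
    show "f \<in> P \<Longrightarrow> ((\<Sum>k<m. f k) = 0) = (f \<in> (\<lambda>f. f) ` J)" for f by (simp add: J_def)
  qed (auto simp: J_def)
qed

lemma periodic_acyclic:
  assumes "acyclic_at G A act (Suc i)" "acyclic_at G P P_act (Suc (Suc i))" "acyclic_at G P P_act (Suc (Suc (Suc i)))"
  shows "acyclic_at G A act (Suc (Suc (Suc i)))"
  by (rule gses.acyclic_shift[OF gses_first gses.acyclic_shift[OF gses_second assms(1,2)] assms(3)])

end

lemma map_mod_hom:
  assumes "gset G Y a" "gmodule_hom G A act C cact \<alpha>"
  shows "gmodule_hom G (map_mod Y A) (map_act G Y a act) (map_mod Y C) (map_act G Y a cact) (\<lambda>f y. \<alpha> (f y))"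
proof -
  interpret gset G Y a by fact
  interpret \<alpha>: gmodule_hom G A act C cact \<alpha> by fact
  interpret M: map_module G Y a A act by unfold_locales
  interpret N: map_module G Y a C cact by unfold_locales
  have A: "f y \<in> A" if "f \<in> map_mod Y A" for f y
    using that \<alpha>.A.zero_mem by (cases "y \<in> Y") (auto simp: map_mod_def)
  show ?thesis
  proof unfold_locales
    show "(\<lambda>y. \<alpha> (f y)) \<in> map_mod Y C" if "f \<in> map_mod Y A" for f
      using that by (auto simp: map_mod_def \<alpha>.f_closed \<alpha>.f_zero)
    show "additive_on (map_mod Y A) (\<lambda>f y. \<alpha> (f y))"
      by (auto simp: additive_on_def fun_eq_iff \<alpha>.f_diff A)
    show "(\<lambda>y. \<alpha> (map_act G Y a act g f y)) = map_act G Y a cact g (\<lambda>y. \<alpha> (f y))"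
      if "g \<in> carrier G" "f \<in> map_mod Y A" for g f
      using that by (auto simp: map_act_def fun_eq_iff \<alpha>.f_zero \<alpha>.f_act A)
  qed
qed

text \<open>Two descents: from degree i + 3 to i + 2 through \<open>gses_first\<close>, and on to i
  + 1 through \<open>gses_second\<close>.\<close>

theorem periodic_iso_descent:
  assumes "cyclic_module G A act m e" "cyclic_module G C cact m e"
    and \<alpha>: "gmodule_hom G A act C cact \<alpha>"
  defines "rot \<equiv> (\<lambda>g k. (e g + k) mod m)"
  assumes PA: "\<And>j. j \<in> {i, Suc i, Suc (Suc i)} \<Longrightarrow> acyclic_at G (map_mod {..<m} A) (map_act G {..<m} rot act) (Suc j)"
    and PC: "\<And>j. j \<in> {i, Suc i} \<Longrightarrow> acyclic_at G (map_mod {..<m} C) (map_act G {..<m} rot cact) (Suc j)"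
    and iso: "cohomology_iso G A act C cact \<alpha> (Suc (Suc (Suc i)))"
  shows "cohomology_iso G A act C cact \<alpha> (Suc i)"
proof -
  interpret a: cyclic_module G A act m e by fact
  interpret c: cyclic_module G C cact m e by fact
  interpret \<alpha>: gmodule_hom G A act C cact \<alpha> by fact
  have \<beta>: "gmodule_hom G (map_mod {..<m} A) (map_act G {..<m} rot act) (map_mod {..<m} C)
      (map_act G {..<m} rot cact) (\<lambda>f k. \<alpha> (f k))"
    unfolding rot_def by (rule map_mod_hom[OF a.rot_gset \<alpha>])
  interpret \<beta>: gmodule_hom G "map_mod {..<m} A" "map_act G {..<m} rot act" "map_mod {..<m} C"
      "map_act G {..<m} rot cact" "\<lambda>f k. \<alpha> (f k)" by (rule \<beta>)
  have sum: "(\<Sum>k<m. \<alpha> (f k)) = \<alpha> (\<Sum>k<m. f k)" if "f \<in> map_mod {..<m} A" for f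
    by (rule additive_on_sum[OF a.closed \<alpha>.f_additive, symmetric]) (use that in \<open>auto simp: map_mod_def\<close>)
  interpret Ja: gmodule G a.J "map_act G {..<m} rot act" unfolding rot_def by (rule a.gmodule_J)
  interpret Jc: gmodule G c.J "map_act G {..<m} rot cact" unfolding rot_def by (rule c.gmodule_J)
  have J: "gmodule_hom G a.J (map_act G {..<m} rot act) c.J (map_act G {..<m} rot cact) (\<lambda>f k. \<alpha> (f k))"
  proof unfold_locales
    show "(\<lambda>k. \<alpha> (f k)) \<in> c.J" if "f \<in> a.J" for f
      using that \<beta>.f_closed sum[of f] by (auto simp: a.J_def c.J_def \<alpha>.f_zero)
    show "additive_on a.J (\<lambda>f k. \<alpha> (f k))"
      using \<beta>.f_additive by (auto simp: additive_on_def a.J_def)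
    show "(\<lambda>k. \<alpha> (map_act G {..<m} rot act g f k)) = map_act G {..<m} rot cact g (\<lambda>k. \<alpha> (f k))"
      if "g \<in> carrier G" "f \<in> a.J" for g f
      using that \<beta>.f_act by (simp add: a.J_def)
  qed
  have "cohomology_iso G a.J (map_act G {..<m} rot act) c.J (map_act G {..<m} rot cact)
      (\<lambda>f k. \<alpha> (f k)) (Suc (Suc i))"
  proof (rule cohomology_iso_descent[OF a.gses_first[folded rot_def] c.gses_first[folded rot_def] \<alpha> \<beta> J])
    show "(\<lambda>k. \<alpha> (a.cst x k)) = c.cst (\<alpha> x)" for x
      by (auto simp: a.cst_def c.cst_def \<alpha>.f_zero)
    show "(\<lambda>k. \<alpha> (a.\<tau> f k)) = c.\<tau> (\<lambda>k. \<alpha> (f k))" if "f \<in> map_mod {..<m} A" for f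
      using that a.m_pos by (auto simp: a.\<tau>_def c.\<tau>_def fun_eq_iff \<alpha>.f_zero map_mod_def \<alpha>.f_diff)
  qed (use PA PC iso in auto)
  then show ?thesis
    by (rule cohomology_iso_descent[OF a.gses_second[folded rot_def] c.gses_second[folded rot_def] J \<beta> \<alpha>, rotated -1])
       (use PA PC sum in auto)
qed

text \<open>Putting the neutral element in front of a tuple contracts the complex; this commutes
  with translation only because the group is trivial.\<close>

lemma acyclic_trivial_group:
  assumes "gmodule G A act" "carrier G = {\<one>\<^bsub>G\<^esub>}"
  shows "acyclic_at G A act i"
  unfolding acyclic_at_def
proof (intro allI impI)
  interpret gmodule G A act by fact
  fix F assume F: "hcocycle G A act i F"
  have "hcochain G A act i (\<lambda>hs. F (\<one>\<^bsub>G\<^esub> # hs))"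
    unfolding hcochain_def
  proof (intro ballI conjI)
    fix gs g assume gs: "gs \<in> tuples G i"
    then have A: "F (\<one>\<^bsub>G\<^esub> # gs) \<in> A" using F by (auto simp: hcocycle_def hcochain_def tuples_def)
    then show "F (\<one>\<^bsub>G\<^esub> # gs) \<in> A" .
    assume "g \<in> carrier G"
    then have g: "g = \<one>\<^bsub>G\<^esub>" using assms(2) by auto
    have "map (\<lambda>x. \<one>\<^bsub>G\<^esub> \<otimes>\<^bsub>G\<^esub> x) gs = gs" using gs by (auto simp: tuples_def intro!: map_idI)
    then show "F (\<one>\<^bsub>G\<^esub> # map (\<lambda>x. g \<otimes>\<^bsub>G\<^esub> x) gs) = act g (F (\<one>\<^bsub>G\<^esub> # gs))"
      using A by (simp add: g a_one)
  qed
  then show "hexact G A act i F"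
  proof (rule hexactI)
    fix gs assume "gs \<in> tuples G (Suc i)"
    then have "\<one>\<^bsub>G\<^esub> # gs \<in> tuples G (Suc (Suc i))" by (auto simp: tuples_def)
    then have "bd F (\<one>\<^bsub>G\<^esub> # gs) = 0" using F unfolding hcocycle_def by blast
    then show "F gs = bd (\<lambda>hs. F (\<one>\<^bsub>G\<^esub> # hs)) gs" by simp
  qed
qed

lemma (in map_module) acyclic_free:
  assumes "\<And>g y. g \<in> carrier G \<Longrightarrow> y \<in> Y \<Longrightarrow> a g y = y \<Longrightarrow> g = \<one>"
  shows "acyclic_at G (map_mod Y A) (map_act G Y a act) i"
proof (rule shapiro_acyclic)
  fix y assume y: "y \<in> Y"
  have "stabilizer G a y = {\<one>}"
    using y assms Y.a_one by (auto simp: stabilizer_def)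
  then show "acyclic_at (G\<lparr>carrier := stabilizer G a y\<rparr>) A act i"
    using gmodule_subgroup[OF A.gmodule_axioms subgroup_stabilizer[OF Y.gset_axioms y]]
    by (intro acyclic_trivial_group) auto
qed

abbreviation "trivial_act \<equiv> (\<lambda>g x. x)"

lemma gmodule_trivial: "group G \<Longrightarrow> gmodule G (UNIV :: int set) trivial_act"
  unfolding gmodule_def gmodule_axioms_def gset_def gset_axioms_def
  by (auto simp: add_closed_def additive_on_def)

text \<open>Averaging: summing the cocycle identity \<open>F [g, h] = F [g, x] - F [h, x]\<close>
  over \<open>x\<close> gives 0 on the right by translation invariance. So a multiple of
  \<open>F [g, h]\<close> vanishes, and with it \<open>F\<close> itself.\<close>

lemma acyclic_finite_1:
  assumes "group G" "finite (carrier G)"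
  shows "acyclic_at G (UNIV :: int set) trivial_act 1"
  unfolding acyclic_at_def
proof (intro allI impI)
  interpret gmodule G "UNIV :: int set" trivial_act by (rule gmodule_trivial) fact
  fix F assume F: "hcocycle G (UNIV :: int set) trivial_act 1 F"
  have inv: "(\<Sum>x\<in>carrier G. F [g, x]) = (\<Sum>x\<in>carrier G. F [\<one>\<^bsub>G\<^esub>, x])" if g: "g \<in> carrier G" for g
  proof (rule sum.reindex_bij_witness[of _ "\<lambda>x. g \<otimes>\<^bsub>G\<^esub> x" "\<lambda>x. inv\<^bsub>G\<^esub> g \<otimes>\<^bsub>G\<^esub> x"])
    fix x assume x: "x \<in> carrier G"
    have "[\<one>\<^bsub>G\<^esub>, inv\<^bsub>G\<^esub> g \<otimes>\<^bsub>G\<^esub> x] \<in> tuples G (Suc 1)" using g x by (simp add: tuples_def)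
    then show "F [\<one>\<^bsub>G\<^esub>, inv\<^bsub>G\<^esub> g \<otimes>\<^bsub>G\<^esub> x] = F [g, x]"
      using F g x unfolding hcocycle_def hcochain_def
      by (auto simp: m_assoc[symmetric] dest!: bspec[of _ _ "[\<one>\<^bsub>G\<^esub>, inv\<^bsub>G\<^esub> g \<otimes>\<^bsub>G\<^esub> x]"] bspec[of _ _ g])
  qed (use g in \<open>auto simp: m_assoc[symmetric]\<close>)
  have zero: "F [g, h] = 0" if g: "g \<in> carrier G" and h: "h \<in> carrier G" for g h
  proof -
    have "F [g, h] = F [g, x] - F [h, x]" if "x \<in> carrier G" for x
    proof -
      have "bd F [g, h, x] = 0"
        using F g h that by (simp add: hcocycle_def tuples_def del: bd.simps)
      then show ?thesis by simp
    qed
    then have "(\<Sum>x\<in>carrier G. F [g, h]) = (\<Sum>x\<in>carrier G. F [g, x] - F [h, x])"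
      by (intro sum.cong) auto
    also have "\<dots> = 0" unfolding sum_subtractf inv[OF g] inv[OF h] by simp
    finally have "int (card (carrier G)) * F [g, h] = 0" by simp
    moreover have "card (carrier G) \<noteq> 0" using assms(2) g by auto
    ultimately show ?thesis by simp
  qed
  show "hexact G (UNIV :: int set) trivial_act 1 F"
    by (rule hexact_cong[OF hexact_zero]) (use zero in \<open>auto simp: tuples_def length_Suc_conv\<close>)
qed

section \<open>Functions modulo constants\<close>

locale based_map_module = map_module G Y a A act
  for G :: "('g, 'z) monoid_scheme" (structure) and Y :: "'y set" and a
    and A :: "'a::ab_group_add set" and act +
  fixes y0 :: 'y
  assumes y0: "y0 \<in> Y"
begin

text \<open>The quotient of the functions on \<open>Y\<close> by the constants, represented by the functions that vanish at \<open>y0\<close>.\<close>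

definition normalize :: "('y \<Rightarrow> 'a) \<Rightarrow> 'y \<Rightarrow> 'a" where
  "normalize f = (\<lambda>y. if y \<in> Y then f y - f y0 else 0)"

definition Q :: "('y \<Rightarrow> 'a) set" where
  "Q = {f \<in> map_mod Y A. f y0 = 0}"

definition Q_act :: "'g \<Rightarrow> ('y \<Rightarrow> 'a) \<Rightarrow> 'y \<Rightarrow> 'a" where
  "Q_act g f = normalize (map_act G Y a act g f)"

definition cst :: "'a \<Rightarrow> 'y \<Rightarrow> 'a" where
  "cst x = (\<lambda>y. if y \<in> Y then x else 0)"

lemma normalize_Q: "f \<in> map_mod Y A \<Longrightarrow> normalize f \<in> Q"
  using y0 by (auto simp: normalize_def Q_def map_mod_def A.diff_mem)

lemma Q_map: "f \<in> Q \<Longrightarrow> f \<in> map_mod Y A"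
  by (simp add: Q_def)

lemma normalize_id: "f \<in> Q \<Longrightarrow> normalize f = f"
  by (auto simp: normalize_def Q_def map_mod_def)

lemma normalize_act:
  assumes "g \<in> carrier G" "f \<in> map_mod Y A"
  shows "normalize (map_act G Y a act g f) = Q_act g (normalize f)"
proof
  fix y
  have "f (a (inv g) y) \<in> A" "f (a (inv g) y0) \<in> A" "f y0 \<in> A" if "y \<in> Y"
    using assms that y0 by (auto simp: map_mod_def Y.a_closed)
  then show "normalize (map_act G Y a act g f) y = Q_act g (normalize f) y"
    using assms y0 by (auto simp: Q_act_def normalize_def map_act_def Y.a_closed A.act_diff)
qed

lemma gmodule_Q: "gmodule G Q Q_act"
proof unfold_locales
  show "Q_act g f \<in> Q" if "g \<in> carrier G" "f \<in> Q" for g f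
    unfolding Q_act_def by (intro normalize_Q M.a_closed Q_map that)
  show "Q_act \<one> f = f" if "f \<in> Q" for f
    unfolding Q_act_def using M.a_one[OF Q_map[OF that]] normalize_id[OF that] by simp
  show "Q_act (g \<otimes> h) f = Q_act g (Q_act h f)" if "g \<in> carrier G" "h \<in> carrier G" "f \<in> Q" for g h f
  proof -
    have "Q_act (g \<otimes> h) f = normalize (map_act G Y a act g (map_act G Y a act h f))"
      unfolding Q_act_def using M.a_mult[OF that(1,2) Q_map[OF that(3)]] by simp
    also have "\<dots> = Q_act g (Q_act h f)"
      using normalize_act[OF that(1) M.a_closed[OF that(2) Q_map[OF that(3)]]] by (simp add: Q_act_def)
    finally show ?thesis .
  qed
  show "add_closed Q"
    using M.closed by (auto simp: add_closed_def Q_def)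
  show "additive_on Q (Q_act g)" if "g \<in> carrier G" for g
    using M.act_diff[OF that] by (auto simp: additive_on_def Q_act_def normalize_def Q_map fun_eq_iff)
qed

lemma cst_hom: "gmodule_hom G A act (map_mod Y A) (map_act G Y a act) cst"
proof unfold_locales
  show "cst x \<in> map_mod Y A" if "x \<in> A" for x using that by (simp add: cst_def map_mod_def)
  show "additive_on A cst" by (auto simp: additive_on_def cst_def fun_eq_iff)
  show "cst (act g x) = map_act G Y a act g (cst x)" if "g \<in> carrier G" "x \<in> A" for g x
    using that by (auto simp: cst_def map_act_def fun_eq_iff Y.a_closed)
qed

lemma gses_Q: "gses G A act (map_mod Y A) (map_act G Y a act) Q Q_act cst normalize"
proof -
  interpret Q: gmodule G Q Q_act by (rule gmodule_Q)
  interpret cst: gmodule_hom G A act "map_mod Y A" "map_act G Y a act" cst by (rule cst_hom)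
  show ?thesis
  proof unfold_locales
    show "f \<in> map_mod Y A \<Longrightarrow> normalize f \<in> Q" for f by (rule normalize_Q)
    show "additive_on (map_mod Y A) normalize"
      by (auto simp: additive_on_def normalize_def fun_eq_iff)
    show "normalize (map_act G Y a act g f) = Q_act g (normalize f)"
      if "g \<in> carrier G" "f \<in> map_mod Y A" for g f by (rule normalize_act[OF that])
    show "inj_on cst A"
      using y0 by (auto simp: inj_on_def cst_def fun_eq_iff split: if_splits)
    show "Q \<subseteq> normalize ` map_mod Y A"
      using normalize_id Q_map by (metis image_eqI subsetI)
    show "(normalize f = 0) = (f \<in> cst ` A)" if f: "f \<in> map_mod Y A" for f
    proof
      assume n: "normalize f = 0"
      have const: "f y = f y0" if "y \<in> Y" for y
        using fun_cong[OF n, of y] that by (simp add: normalize_def)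
      have "f y = cst (f y0) y" for y
      proof (cases "y \<in> Y")
        case True
        then show ?thesis unfolding cst_def if_P[OF True] by (rule const)
      next
        case False
        then show ?thesis using f by (simp add: cst_def map_mod_def)
      qed
      then have "f = cst (f y0)" by blast
      moreover have "f y0 \<in> A" using f y0 by (simp add: map_mod_def)
      ultimately show "f \<in> cst ` A" by (rule image_eqI)
    next
      assume "f \<in> cst ` A"
      then show "normalize f = 0" using y0 by (auto simp: cst_def normalize_def fun_eq_iff)
    qed
  qed
qed

text \<open>Since the group fixes \<open>y1\<close>, normalizing at \<open>y1\<close> instead of
  \<open>y0\<close> turns the twisted action on \<open>Q\<close> into the plain action on functions
  away from \<open>y1\<close>, where the group acts freely.\<close>

lemma acyclic_Q:
  assumes y1: "y1 \<in> Y" "\<And>g. g \<in> carrier G \<Longrightarrow> a g y1 = y1"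
    and free: "\<And>g y. g \<in> carrier G \<Longrightarrow> y \<in> Y \<Longrightarrow> y \<noteq> y1 \<Longrightarrow> a g y = y \<Longrightarrow> g = \<one>"
  shows "acyclic_at G Q Q_act i"
proof -
  interpret Q: gmodule G Q Q_act by (rule gmodule_Q)
  have a_neq: "a g y \<noteq> y1" if "g \<in> carrier G" "y \<in> Y" "y \<noteq> y1" for g y
    using that y1 Y.a_inv[of g y] by (metis Y.inv_closed)
  interpret Y': gset G "Y - {y1}" a
    by unfold_locales (auto simp: Y.a_closed Y.a_one Y.a_mult a_neq)
  interpret M': map_module G "Y - {y1}" a A act by unfold_locales
  define f where "f = (\<lambda>q::'y \<Rightarrow> 'a. \<lambda>y. if y \<in> Y - {y1} then q y - q y1 else 0)"
  have f_norm: "f (normalize q) = f q" for q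
    using y1 by (auto simp: f_def normalize_def fun_eq_iff)
  show ?thesis
  proof (rule acyclic_retract)
    show "gmodule_hom G Q Q_act (map_mod (Y - {y1}) A) (map_act G (Y - {y1}) a act) f"
    proof unfold_locales
      show "f q \<in> map_mod (Y - {y1}) A" if "q \<in> Q" for q
        using that y1 by (auto simp: f_def map_mod_def Q_def A.diff_mem)
      show "additive_on Q f" by (auto simp: additive_on_def f_def fun_eq_iff)
      show "f (Q_act g q) = map_act G (Y - {y1}) a act g (f q)" if g: "g \<in> carrier G" and q: "q \<in> Q" for g q
      proof
        fix y
        have "q (a (inv g) y) \<in> A" "q y1 \<in> A" if "y \<in> Y"
          using q g that y1 by (auto simp: Q_def map_mod_def Y.a_closed)
        then show "f (Q_act g q) y = map_act G (Y - {y1}) a act g (f q) y"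
          unfolding Q_act_def f_norm
          using g y1 a_neq[of "inv g" y] by (auto simp: f_def map_act_def Y.a_closed A.act_diff)
      qed
    qed
    show "gmodule_hom G (map_mod (Y - {y1}) A) (map_act G (Y - {y1}) a act) Q Q_act normalize"
    proof unfold_locales
      fix h assume h: "h \<in> map_mod (Y - {y1}) A"
      then have hY: "h \<in> map_mod Y A" using A.zero_mem by (auto simp: map_mod_def)
      then show "normalize h \<in> Q" by (rule normalize_Q)
      fix g assume g: "g \<in> carrier G"
      have "map_act G (Y - {y1}) a act g h = map_act G Y a act g h"
        using h g y1 by (auto simp: map_act_def fun_eq_iff map_mod_def A.act_zero)
      then show "normalize (map_act G (Y - {y1}) a act g h) = Q_act g (normalize h)"
        using normalize_act[OF g hY] by simp
    qed (auto simp: additive_on_def normalize_def fun_eq_iff)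
    show "normalize (f q) = q" if "q \<in> Q" for q
      using that y0 y1 by (auto simp: normalize_def f_def Q_def map_mod_def fun_eq_iff)
    show "acyclic_at G (map_mod (Y - {y1}) A) (map_act G (Y - {y1}) a act) i"
      by (rule M'.acyclic_free) (use free in auto)
  qed
qed

end

section \<open>Fixed points of the affine action\<close>

locale free_semidirect =
  fixes G :: "('g, 'c) monoid_scheme" and L :: "('l, 'b) monoid_scheme"
    and n :: nat and \<rho> :: "'g \<Rightarrow> 'l \<Rightarrow> 'l" and co :: "'l \<Rightarrow> nat \<Rightarrow> int" and z :: 'g
  assumes G_group: "group G" and G_finite: "finite (carrier G)"
    and z: "z \<in> carrier G" "\<And>g. g \<in> carrier G \<Longrightarrow> \<exists>j. j < order G \<and> g = z [^]\<^bsub>G\<^esub> j"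
    and L_group: "comm_group L"
    and co_mult: "\<And>x y j. x \<in> carrier L \<Longrightarrow> y \<in> carrier L \<Longrightarrow> j < n \<Longrightarrow> co (x \<otimes>\<^bsub>L\<^esub> y) j = co x j + co y j"
    and co_inj: "\<And>x y. x \<in> carrier L \<Longrightarrow> y \<in> carrier L \<Longrightarrow> (\<And>j. j < n \<Longrightarrow> co x j = co y j) \<Longrightarrow> x = y"
    and co_surj: "\<And>f. \<exists>x\<in>carrier L. \<forall>j<n. co x j = f j"
    and \<rho>_closed: "\<And>g x. g \<in> carrier G \<Longrightarrow> x \<in> carrier L \<Longrightarrow> \<rho> g x \<in> carrier L"
    and \<rho>_mult: "\<And>g x y. g \<in> carrier G \<Longrightarrow> x \<in> carrier L \<Longrightarrow> y \<in> carrier L \<Longrightarrow>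
          \<rho> g (x \<otimes>\<^bsub>L\<^esub> y) = \<rho> g x \<otimes>\<^bsub>L\<^esub> \<rho> g y"
    and \<rho>_comp: "\<And>g h x. g \<in> carrier G \<Longrightarrow> h \<in> carrier G \<Longrightarrow> x \<in> carrier L \<Longrightarrow>
          \<rho> (g \<otimes>\<^bsub>G\<^esub> h) x = \<rho> g (\<rho> h x)"
    and \<rho>_one: "\<And>x. x \<in> carrier L \<Longrightarrow> \<rho> \<one>\<^bsub>G\<^esub> x = x"
    and free: "\<And>g x. g \<in> carrier G \<Longrightarrow> x \<in> carrier L \<Longrightarrow> \<rho> g x = x \<Longrightarrow> g = \<one>\<^bsub>G\<^esub> \<or> x = \<one>\<^bsub>L\<^esub>"
begin

definition m :: nat where "m = order G"

definition \<Gamma> :: "('l \<times> 'g) monoid" where "\<Gamma> = semidirect_product L G \<rho>"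

sublocale G: group G by (rule G_group)
sublocale L: comm_group L by (rule L_group)

lemma m_pos: "m > 0"
  unfolding m_def by (rule G.order_gt_0_iff_finite[THEN iffD2, OF G_finite])

lemma carrier_\<Gamma>: "carrier \<Gamma> = carrier L \<times> carrier G"
  by (simp add: \<Gamma>_def semidirect_product_def)

lemma one_\<Gamma>: "\<one>\<^bsub>\<Gamma>\<^esub> = (\<one>\<^bsub>L\<^esub>, \<one>\<^bsub>G\<^esub>)"
  by (simp add: \<Gamma>_def semidirect_product_def)

lemma mult_\<Gamma>: "(x, g) \<otimes>\<^bsub>\<Gamma>\<^esub> (y, h) = (x \<otimes>\<^bsub>L\<^esub> \<rho> g y, g \<otimes>\<^bsub>G\<^esub> h)"
  by (simp add: \<Gamma>_def semidirect_product_def)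

lemma \<rho>_one_L: "g \<in> carrier G \<Longrightarrow> \<rho> g \<one>\<^bsub>L\<^esub> = \<one>\<^bsub>L\<^esub>"
  using \<rho>_mult[of g "\<one>\<^bsub>L\<^esub>" "\<one>\<^bsub>L\<^esub>"] \<rho>_closed[of g "\<one>\<^bsub>L\<^esub>"] by (simp add: L.l_cancel_one)

lemma \<rho>_inv_L: "g \<in> carrier G \<Longrightarrow> x \<in> carrier L \<Longrightarrow> \<rho> g (inv\<^bsub>L\<^esub> x) = inv\<^bsub>L\<^esub> (\<rho> g x)"
  using \<rho>_mult[of g "inv\<^bsub>L\<^esub> x" x] \<rho>_one_L \<rho>_closed by (intro L.inv_equality[symmetric]) auto

lemma \<rho>_pow: "g \<in> carrier G \<Longrightarrow> x \<in> carrier L \<Longrightarrow> \<rho> g (x [^]\<^bsub>L\<^esub> (k::nat)) = \<rho> g x [^]\<^bsub>L\<^esub> k"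
  by (induction k) (auto simp: \<rho>_one_L \<rho>_mult \<rho>_closed)

lemma \<rho>_inv_G [simp]:
  "g \<in> carrier G \<Longrightarrow> x \<in> carrier L \<Longrightarrow> \<rho> (inv\<^bsub>G\<^esub> g) (\<rho> g x) = x"
  "g \<in> carrier G \<Longrightarrow> x \<in> carrier L \<Longrightarrow> \<rho> g (\<rho> (inv\<^bsub>G\<^esub> g) x) = x"
  by (simp_all add: \<rho>_comp[symmetric] \<rho>_one)

lemma group_\<Gamma>: "group \<Gamma>"
proof (rule groupI)
  fix u v w assume "u \<in> carrier \<Gamma>" "v \<in> carrier \<Gamma>" "w \<in> carrier \<Gamma>"
  then show "u \<otimes>\<^bsub>\<Gamma>\<^esub> v \<otimes>\<^bsub>\<Gamma>\<^esub> w = u \<otimes>\<^bsub>\<Gamma>\<^esub> (v \<otimes>\<^bsub>\<Gamma>\<^esub> w)"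
    by (auto simp: carrier_\<Gamma> mult_\<Gamma> \<rho>_mult \<rho>_comp \<rho>_closed L.m_assoc G.m_assoc)
next
  fix u assume "u \<in> carrier \<Gamma>"
  then obtain x g where u: "u = (x, g)" "x \<in> carrier L" "g \<in> carrier G" by (auto simp: carrier_\<Gamma>)
  show "\<exists>v\<in>carrier \<Gamma>. v \<otimes>\<^bsub>\<Gamma>\<^esub> u = \<one>\<^bsub>\<Gamma>\<^esub>"
    by (rule bexI[of _ "(\<rho> (inv\<^bsub>G\<^esub> g) (inv\<^bsub>L\<^esub> x), inv\<^bsub>G\<^esub> g)"])
      (use u in \<open>auto simp: carrier_\<Gamma> mult_\<Gamma> one_\<Gamma> \<rho>_closed \<rho>_mult[symmetric] \<rho>_one_L\<close>)
qed (auto simp: carrier_\<Gamma> mult_\<Gamma> one_\<Gamma> \<rho>_closed \<rho>_one)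

sublocale \<Gamma>: group \<Gamma> by (rule group_\<Gamma>)

lemma co_one: "j < n \<Longrightarrow> co \<one>\<^bsub>L\<^esub> j = 0"
  using co_mult[of "\<one>\<^bsub>L\<^esub>" "\<one>\<^bsub>L\<^esub>" j] by simp

lemma co_pow: "x \<in> carrier L \<Longrightarrow> j < n \<Longrightarrow> co (x [^]\<^bsub>L\<^esub> (k::nat)) j = int k * co x j"
  by (induction k) (auto simp: co_one co_mult algebra_simps)

lemma co_eq_zero: "x \<in> carrier L \<Longrightarrow> (\<And>j. j < n \<Longrightarrow> co x j = 0) \<Longrightarrow> x = \<one>\<^bsub>L\<^esub>"
  by (rule co_inj) (auto simp: co_one)

lemma torsion_free: "x \<in> carrier L \<Longrightarrow> x [^]\<^bsub>L\<^esub> m = \<one>\<^bsub>L\<^esub> \<Longrightarrow> x = \<one>\<^bsub>L\<^esub>"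
  using co_pow[of x _ m] m_pos co_one by (intro co_eq_zero) auto

text \<open>Scaling the translations by \<open>m\<close> makes the fixed points of the finite subgroups, which in general
  only lie in \<open>(1/m)L\<close>, integral.\<close>

definition ax :: "'l \<times> 'g \<Rightarrow> 'l \<Rightarrow> 'l" where
  "ax u y = fst u [^]\<^bsub>L\<^esub> m \<otimes>\<^bsub>L\<^esub> \<rho> (snd u) y"

sublocale X: gset \<Gamma> "carrier L" ax
proof unfold_locales
  fix u v y assume "u \<in> carrier \<Gamma>" "v \<in> carrier \<Gamma>" "y \<in> carrier L"
  then show "ax (u \<otimes>\<^bsub>\<Gamma>\<^esub> v) y = ax u (ax v y)"
    by (auto simp: carrier_\<Gamma> mult_\<Gamma> ax_def \<rho>_mult \<rho>_pow \<rho>_comp \<rho>_closed L.nat_pow_distrib L.m_assoc)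
qed (auto simp: carrier_\<Gamma> ax_def \<rho>_closed \<rho>_one one_\<Gamma>)

text \<open>The quotient of two fixed points is fixed by the linear part. By freeness this leaves
  only pure translations, and a nontrivial one has no fixed point as \<open>L\<close> is
  torsion-free.\<close>

lemma fixed_point_unique:
  assumes u: "u \<in> carrier \<Gamma>" "u \<noteq> \<one>\<^bsub>\<Gamma>\<^esub>" and y: "y \<in> carrier L" "y' \<in> carrier L" "ax u y = y" "ax u y' = y'"
  shows "y = y'"
proof -
  obtain x g where xg: "u = (x, g)" "x \<in> carrier L" "g \<in> carrier G" using u(1) by (auto simp: carrier_\<Gamma>)
  let ?p = "x [^]\<^bsub>L\<^esub> m"
  have e: "?p \<otimes>\<^bsub>L\<^esub> \<rho> g y = y" "?p \<otimes>\<^bsub>L\<^esub> \<rho> g y' = y'" using y(3,4) xg by (auto simp: ax_def)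
  have p: "?p \<in> carrier L" "\<rho> g y \<in> carrier L" "\<rho> g y' \<in> carrier L" using xg y by (auto simp: \<rho>_closed)
  have "\<rho> g (y \<otimes>\<^bsub>L\<^esub> inv\<^bsub>L\<^esub> y') = \<rho> g y \<otimes>\<^bsub>L\<^esub> inv\<^bsub>L\<^esub> (\<rho> g y')"
    using xg y by (simp add: \<rho>_mult \<rho>_inv_L)
  also have "\<dots> = (?p \<otimes>\<^bsub>L\<^esub> \<rho> g y) \<otimes>\<^bsub>L\<^esub> inv\<^bsub>L\<^esub> (?p \<otimes>\<^bsub>L\<^esub> \<rho> g y')"
    using p by (simp add: L.inv_mult L.m_ac)
  also have "\<dots> = y \<otimes>\<^bsub>L\<^esub> inv\<^bsub>L\<^esub> y'" by (simp only: e)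
  finally have "g = \<one>\<^bsub>G\<^esub> \<or> y \<otimes>\<^bsub>L\<^esub> inv\<^bsub>L\<^esub> y' = \<one>\<^bsub>L\<^esub>"
    using free xg y by simp
  then show ?thesis
  proof
    assume g: "g = \<one>\<^bsub>G\<^esub>"
    then have "?p \<otimes>\<^bsub>L\<^esub> y = y" using e(1) by (simp only: \<rho>_one[OF y(1)])
    then have "?p = \<one>\<^bsub>L\<^esub>" using L.r_cancel_one[OF y(1) p(1)] by blast
    then have "x = \<one>\<^bsub>L\<^esub>" by (rule torsion_free[OF xg(2)])
    then show ?thesis using xg(1) g u(2) one_\<Gamma> by simp
  next
    assume *: "y \<otimes>\<^bsub>L\<^esub> inv\<^bsub>L\<^esub> y' = \<one>\<^bsub>L\<^esub>"
    have "y = y \<otimes>\<^bsub>L\<^esub> inv\<^bsub>L\<^esub> y' \<otimes>\<^bsub>L\<^esub> y'" using y by (simp add: L.m_assoc)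
    then show ?thesis using y by (simp add: *)
  qed
qed

lemma translation_free:
  assumes "u \<in> carrier \<Gamma>" "snd u = \<one>\<^bsub>G\<^esub>" "y \<in> carrier L" "ax u y = y"
  shows "u = \<one>\<^bsub>\<Gamma>\<^esub>"
proof -
  have f: "fst u \<in> carrier L" using assms(1) by (auto simp: carrier_\<Gamma>)
  have "fst u [^]\<^bsub>L\<^esub> m \<otimes>\<^bsub>L\<^esub> y = y"
    using assms(4) unfolding ax_def assms(2) \<rho>_one[OF assms(3)] .
  then have "fst u [^]\<^bsub>L\<^esub> m = \<one>\<^bsub>L\<^esub>"
    using L.r_cancel_one[OF assms(3) L.nat_pow_closed[OF f]] by blast
  then have "fst u = \<one>\<^bsub>L\<^esub>" by (rule torsion_free[OF f])
  then show ?thesis using assms(2) by (simp add: one_\<Gamma> prod_eq_iff)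
qed

lemma snd_hom: "u \<in> carrier \<Gamma> \<Longrightarrow> v \<in> carrier \<Gamma> \<Longrightarrow> snd (u \<otimes>\<^bsub>\<Gamma>\<^esub> v) = snd u \<otimes>\<^bsub>G\<^esub> snd v"
  by (auto simp: carrier_\<Gamma> mult_\<Gamma>)

lemma snd_inv: "u \<in> carrier \<Gamma> \<Longrightarrow> snd (inv\<^bsub>\<Gamma>\<^esub> u) = inv\<^bsub>G\<^esub> (snd u)"
  using snd_hom[of "inv\<^bsub>\<Gamma>\<^esub> u" u] \<Gamma>.inv_closed[of u]
  by (intro G.inv_equality[symmetric]) (auto simp: carrier_\<Gamma> one_\<Gamma> simp del: \<Gamma>.inv_closed)

lemma snd_inj_on:
  assumes H: "subgroup H \<Gamma>" and tr: "\<And>u. u \<in> H \<Longrightarrow> snd u = \<one>\<^bsub>G\<^esub> \<Longrightarrow> u = \<one>\<^bsub>\<Gamma>\<^esub>"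
  shows "inj_on snd H"
proof (rule inj_onI)
  fix u v assume u: "u \<in> H" and v: "v \<in> H" and e: "snd u = snd v"
  have c: "u \<in> carrier \<Gamma>" "v \<in> carrier \<Gamma>" using u v subgroup.mem_carrier[OF H] by auto
  have "snd (u \<otimes>\<^bsub>\<Gamma>\<^esub> inv\<^bsub>\<Gamma>\<^esub> v) = \<one>\<^bsub>G\<^esub>"
    using c e snd_hom[OF c(1) \<Gamma>.inv_closed[OF c(2)]] snd_inv[OF c(2)]
    by (auto simp: carrier_\<Gamma> mem_Times_iff)
  then have *: "u \<otimes>\<^bsub>\<Gamma>\<^esub> inv\<^bsub>\<Gamma>\<^esub> v = \<one>\<^bsub>\<Gamma>\<^esub>"
    by (intro tr subgroup.m_closed[OF H u] subgroup.m_inv_closed[OF H v])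
  have "u = u \<otimes>\<^bsub>\<Gamma>\<^esub> inv\<^bsub>\<Gamma>\<^esub> v \<otimes>\<^bsub>\<Gamma>\<^esub> v" using c by (simp add: \<Gamma>.m_assoc)
  then show "u = v" using c by (simp add: *)
qed

lemma finite_subgroup:
  assumes H: "subgroup H \<Gamma>" and tr: "\<And>u. u \<in> H \<Longrightarrow> snd u = \<one>\<^bsub>G\<^esub> \<Longrightarrow> u = \<one>\<^bsub>\<Gamma>\<^esub>"
  shows "finite H"
proof (rule inj_on_finite[OF snd_inj_on[OF H tr] _ G_finite])
  show "snd ` H \<subseteq> carrier G" using subgroup.subset[OF H] by (auto simp: carrier_\<Gamma>)
qed

abbreviation "stab y \<equiv> stabilizer \<Gamma> ax y"

lemma stab_subgroup: "y \<in> carrier L \<Longrightarrow> subgroup (stab y) \<Gamma>"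
  by (rule subgroup_stabilizer[OF X.gset_axioms])

lemma stab_finite: "y \<in> carrier L \<Longrightarrow> finite (stab y)"
  using finite_subgroup[OF stab_subgroup] translation_free by (auto simp: stabilizer_def)

lemma pow_eq_one_of_finite:
  assumes H: "subgroup H \<Gamma>" "finite H" and u: "u \<in> H" "snd u = \<one>\<^bsub>G\<^esub>"
  shows "u = \<one>\<^bsub>\<Gamma>\<^esub>"
proof -
  interpret H: group "\<Gamma>\<lparr>carrier := H\<rparr>"
    using H(1) by (rule subgroup.subgroup_is_group) (rule \<Gamma>.is_group)
  obtain x where x: "u = (x, \<one>\<^bsub>G\<^esub>)" "x \<in> carrier L"
    using u subgroup.mem_carrier[OF H(1)] by (cases u) (auto simp: carrier_\<Gamma>)
  have pow: "u [^]\<^bsub>\<Gamma>\<^esub> (k::nat) = (x [^]\<^bsub>L\<^esub> k, \<one>\<^bsub>G\<^esub>)" for k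
    using x by (induction k) (auto simp: one_\<Gamma> mult_\<Gamma> \<rho>_one)
  have "u [^]\<^bsub>\<Gamma>\<lparr>carrier := H\<rparr>\<^esub> card H = \<one>\<^bsub>\<Gamma>\<^esub>"
    using H.pow_order_eq_1[of u] u by (simp add: order_def)
  then have "x [^]\<^bsub>L\<^esub> card H = \<one>\<^bsub>L\<^esub>"
    using pow[of "card H"] by (simp add: \<Gamma>.nat_pow_consistent[symmetric] one_\<Gamma>)
  moreover have "card H > 0" using H u by (auto simp: card_gt_0_iff)
  ultimately have "x = \<one>\<^bsub>L\<^esub>"
    using co_pow[of x _ "card H"] co_one x by (intro co_eq_zero) force+
  then show ?thesis using x by (simp add: one_\<Gamma>)
qed

text \<open>The orbit of the origin under \<open>H\<close> consists of the m-th powers of the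
  elements \<open>fst v\<close>. Its barycentre is fixed, and it lies in \<open>L\<close> because
  the order of \<open>H\<close> divides m.\<close>

lemma finite_subgroup_fixed_point:
  assumes H: "subgroup H \<Gamma>" "finite H"
  obtains y where "y \<in> carrier L" "H \<subseteq> stab y"
proof -
  have inj: "inj_on snd H"
    by (rule snd_inj_on[OF H(1) pow_eq_one_of_finite[OF H]])
  have sub: "subgroup (snd ` H) G"
  proof (rule G.subgroupI)
    show "snd ` H \<subseteq> carrier G" using subgroup.subset[OF H(1)] by (auto simp: carrier_\<Gamma>)
    show "snd ` H \<noteq> {}" using subgroup.one_closed[OF H(1)] by blast
  next
    fix g assume "g \<in> snd ` H"
    then obtain u where u: "u \<in> H" "g = snd u" by blast
    then show "inv\<^bsub>G\<^esub> g \<in> snd ` H"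
      using subgroup.m_inv_closed[OF H(1) u(1)] snd_inv subgroup.mem_carrier[OF H(1)]
      by (intro image_eqI[of _ _ "inv\<^bsub>\<Gamma>\<^esub> u"]) auto
  next
    fix g h assume "g \<in> snd ` H" "h \<in> snd ` H"
    then obtain u v where "u \<in> H" "g = snd u" "v \<in> H" "h = snd v" by blast
    then show "g \<otimes>\<^bsub>G\<^esub> h \<in> snd ` H"
      using subgroup.m_closed[OF H(1)] snd_hom subgroup.mem_carrier[OF H(1)]
      by (intro image_eqI[of _ _ "u \<otimes>\<^bsub>\<Gamma>\<^esub> v"]) auto
  qed
  have "card H dvd m"
    using G.lagrange[OF sub] card_image[OF inj] by (metis dvd_triv_right m_def)
  then obtain d where d: "m = card H * d" by (auto simp: dvd_def)
  define y where "y = (\<Otimes>\<^bsub>L\<^esub>v\<in>H. fst v) [^]\<^bsub>L\<^esub> d"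
  have fst_L: "fst v \<in> carrier L" if "v \<in> H" for v
    using subgroup.mem_carrier[OF H(1) that] by (auto simp: carrier_\<Gamma>)
  have prod: "(\<Otimes>\<^bsub>L\<^esub>v\<in>H. fst v) \<in> carrier L" using fst_L by (intro L.finprod_closed) auto
  have yL: "y \<in> carrier L" using prod by (simp add: y_def)
  have "ax u y = y" if u: "u \<in> H" for u
  proof -
    obtain x g where xg: "u = (x, g)" "x \<in> carrier L" "g \<in> carrier G"
      using subgroup.mem_carrier[OF H(1) u] by (auto simp: carrier_\<Gamma>)
    have \<rho>_prod: "\<rho> g (\<Otimes>\<^bsub>L\<^esub>v\<in>K. fst v) = (\<Otimes>\<^bsub>L\<^esub>v\<in>K. \<rho> g (fst v))" if "K \<subseteq> H" for K
      using finite_subset[OF that H(2)] that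
    proof (induction K rule: finite_induct)
      case (insert v K)
      have "(\<lambda>v. fst v) \<in> K \<rightarrow> carrier L" "(\<lambda>v. \<rho> g (fst v)) \<in> K \<rightarrow> carrier L"
        "fst v \<in> carrier L"
        using insert fst_L xg by (auto simp: \<rho>_closed)
      then show ?case using insert xg by (simp add: \<rho>_mult \<rho>_closed L.finprod_closed)
    qed (simp add: \<rho>_one_L xg)
    have bij: "(\<lambda>v. u \<otimes>\<^bsub>\<Gamma>\<^esub> v) ` H = H"
      using \<Gamma>.coset_join3[of u H] H(1) u subgroup.mem_carrier[OF H(1)] by (auto simp: l_coset_def)
    have inj_u: "inj_on (\<lambda>v. u \<otimes>\<^bsub>\<Gamma>\<^esub> v) H"
      using u subgroup.mem_carrier[OF H(1)] by (auto simp: inj_on_def)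
    have fst_mult: "fst (u \<otimes>\<^bsub>\<Gamma>\<^esub> v) = x \<otimes>\<^bsub>L\<^esub> \<rho> g (fst v)" for v
      using xg by (cases v) (simp add: mult_\<Gamma>)
    have "(\<Otimes>\<^bsub>L\<^esub>v\<in>H. fst v) = (\<Otimes>\<^bsub>L\<^esub>v\<in>(\<lambda>v. u \<otimes>\<^bsub>\<Gamma>\<^esub> v) ` H. fst v)"
      by (simp only: bij)
    also have "\<dots> = (\<Otimes>\<^bsub>L\<^esub>v\<in>H. fst (u \<otimes>\<^bsub>\<Gamma>\<^esub> v))"
      by (rule L.finprod_reindex) (use fst_L inj_u bij in auto)
    also have "\<dots> = (\<Otimes>\<^bsub>L\<^esub>v\<in>H. x \<otimes>\<^bsub>L\<^esub> \<rho> g (fst v))"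
      by (simp add: fst_mult)
    also have "\<dots> = (\<Otimes>\<^bsub>L\<^esub>v\<in>H. x) \<otimes>\<^bsub>L\<^esub> (\<Otimes>\<^bsub>L\<^esub>v\<in>H. \<rho> g (fst v))"
      by (rule L.finprod_multf) (use xg fst_L \<rho>_closed in auto)
    also have "(\<Otimes>\<^bsub>L\<^esub>v\<in>H. x) = x [^]\<^bsub>L\<^esub> card H"
      by (rule L.finprod_const) (use xg in auto)
    also have "(\<Otimes>\<^bsub>L\<^esub>v\<in>H. \<rho> g (fst v)) = \<rho> g (\<Otimes>\<^bsub>L\<^esub>v\<in>H. fst v)"
      by (rule \<rho>_prod[symmetric]) simp
    finally have e: "(\<Otimes>\<^bsub>L\<^esub>v\<in>H. fst v) = x [^]\<^bsub>L\<^esub> card H \<otimes>\<^bsub>L\<^esub> \<rho> g (\<Otimes>\<^bsub>L\<^esub>v\<in>H. fst v)" .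
    have "ax u y = x [^]\<^bsub>L\<^esub> (card H * d) \<otimes>\<^bsub>L\<^esub> \<rho> g (\<Otimes>\<^bsub>L\<^esub>v\<in>H. fst v) [^]\<^bsub>L\<^esub> d"
      using xg prod by (simp add: ax_def y_def d \<rho>_pow)
    also have "\<dots> = (x [^]\<^bsub>L\<^esub> card H \<otimes>\<^bsub>L\<^esub> \<rho> g (\<Otimes>\<^bsub>L\<^esub>v\<in>H. fst v)) [^]\<^bsub>L\<^esub> d"
      using xg prod by (simp add: L.nat_pow_distrib \<rho>_closed L.nat_pow_pow)
    also have "\<dots> = y" by (simp only: e[symmetric] y_def)
    finally show ?thesis .
  qed
  then have "H \<subseteq> stab y" using subgroup.subset[OF H(1)] by (auto simp: stabilizer_def)
  with yL show thesis by (rule that)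
qed

section \<open>Maximal finite subgroups as stabilizers\<close>

lemma maximal_finite_stab:
  assumes "maximal_finite_subgroup H \<Gamma>"
  obtains y where "y \<in> carrier L" "H = stab y"
proof -
  obtain y where y: "y \<in> carrier L" "H \<subseteq> stab y"
    using finite_subgroup_fixed_point assms unfolding maximal_finite_subgroup_def by metis
  then have "stab y = H"
    using assms stab_subgroup stab_finite unfolding maximal_finite_subgroup_def by blast
  then show thesis using that y by blast
qed

text \<open>A finite overgroup fixes some point, and this must be \<open>y\<close>, the unique fixed
  point of any nontrivial element of the stabilizer.\<close>

lemma stab_maximal_finite:
  assumes y: "y \<in> carrier L" and nt: "stab y \<noteq> {\<one>\<^bsub>\<Gamma>\<^esub>}"
  shows "maximal_finite_subgroup (stab y) \<Gamma>"
  unfolding maximal_finite_subgroup_def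
proof (intro conjI allI impI)
  show "subgroup (stab y) \<Gamma>" "finite (stab y)" using stab_subgroup stab_finite y by auto
  obtain u where u: "u \<in> stab y" "u \<noteq> \<one>\<^bsub>\<Gamma>\<^esub>"
    using nt subgroup.one_closed[OF stab_subgroup[OF y]] by blast
  fix N assume N: "subgroup N \<Gamma> \<and> finite N \<and> stab y \<subseteq> N"
  obtain y' where y': "y' \<in> carrier L" "N \<subseteq> stab y'"
    using finite_subgroup_fixed_point N by metis
  then have "u \<in> stab y'" using u N by blast
  then have "y = y'"
    using fixed_point_unique[of u y y'] u y y' by (auto simp: stabilizer_def)
  then show "N = stab y" using y' N by blast
qed

lemma conj_mem_iff:
  assumes "u \<in> carrier \<Gamma>" "v \<in> carrier \<Gamma>" "H \<subseteq> carrier \<Gamma>"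
  shows "v \<in> u <#\<^bsub>\<Gamma>\<^esub> H #>\<^bsub>\<Gamma>\<^esub> inv\<^bsub>\<Gamma>\<^esub> u \<longleftrightarrow> inv\<^bsub>\<Gamma>\<^esub> u \<otimes>\<^bsub>\<Gamma>\<^esub> v \<otimes>\<^bsub>\<Gamma>\<^esub> u \<in> H"
proof
  assume "v \<in> u <#\<^bsub>\<Gamma>\<^esub> H #>\<^bsub>\<Gamma>\<^esub> inv\<^bsub>\<Gamma>\<^esub> u"
  then obtain h where h: "h \<in> H" "v = u \<otimes>\<^bsub>\<Gamma>\<^esub> h \<otimes>\<^bsub>\<Gamma>\<^esub> inv\<^bsub>\<Gamma>\<^esub> u" by (auto simp: l_coset_def r_coset_def)
  have hc: "h \<in> carrier \<Gamma>" using h assms(3) by blast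
  have "inv\<^bsub>\<Gamma>\<^esub> u \<otimes>\<^bsub>\<Gamma>\<^esub> v \<otimes>\<^bsub>\<Gamma>\<^esub> u = (inv\<^bsub>\<Gamma>\<^esub> u \<otimes>\<^bsub>\<Gamma>\<^esub> u) \<otimes>\<^bsub>\<Gamma>\<^esub> h \<otimes>\<^bsub>\<Gamma>\<^esub> (inv\<^bsub>\<Gamma>\<^esub> u \<otimes>\<^bsub>\<Gamma>\<^esub> u)"
    unfolding h(2) using assms(1) hc by (simp only: \<Gamma>.m_assoc \<Gamma>.m_closed \<Gamma>.inv_closed)
  then show "inv\<^bsub>\<Gamma>\<^esub> u \<otimes>\<^bsub>\<Gamma>\<^esub> v \<otimes>\<^bsub>\<Gamma>\<^esub> u \<in> H" using h(1) hc assms(1) by simp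
next
  assume h: "inv\<^bsub>\<Gamma>\<^esub> u \<otimes>\<^bsub>\<Gamma>\<^esub> v \<otimes>\<^bsub>\<Gamma>\<^esub> u \<in> H"
  have "v = (u \<otimes>\<^bsub>\<Gamma>\<^esub> inv\<^bsub>\<Gamma>\<^esub> u) \<otimes>\<^bsub>\<Gamma>\<^esub> v \<otimes>\<^bsub>\<Gamma>\<^esub> (u \<otimes>\<^bsub>\<Gamma>\<^esub> inv\<^bsub>\<Gamma>\<^esub> u)"
    using assms by simp
  also have "\<dots> = u \<otimes>\<^bsub>\<Gamma>\<^esub> (inv\<^bsub>\<Gamma>\<^esub> u \<otimes>\<^bsub>\<Gamma>\<^esub> v \<otimes>\<^bsub>\<Gamma>\<^esub> u) \<otimes>\<^bsub>\<Gamma>\<^esub> inv\<^bsub>\<Gamma>\<^esub> u"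
    using assms by (simp only: \<Gamma>.m_assoc \<Gamma>.m_closed \<Gamma>.inv_closed)
  finally show "v \<in> u <#\<^bsub>\<Gamma>\<^esub> H #>\<^bsub>\<Gamma>\<^esub> inv\<^bsub>\<Gamma>\<^esub> u"
    using h by (auto simp: l_coset_def r_coset_def)
qed

lemma stab_conj:
  assumes u: "u \<in> carrier \<Gamma>" and y: "y \<in> carrier L"
  shows "stab (ax u y) = u <#\<^bsub>\<Gamma>\<^esub> stab y #>\<^bsub>\<Gamma>\<^esub> inv\<^bsub>\<Gamma>\<^esub> u"
proof (rule Set.set_eqI)
  fix v
  have H: "stab y \<subseteq> carrier \<Gamma>" by (auto simp: stabilizer_def)
  show "v \<in> stab (ax u y) \<longleftrightarrow> v \<in> u <#\<^bsub>\<Gamma>\<^esub> stab y #>\<^bsub>\<Gamma>\<^esub> inv\<^bsub>\<Gamma>\<^esub> u"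
  proof (cases "v \<in> carrier \<Gamma>")
    case True
    have "ax (inv\<^bsub>\<Gamma>\<^esub> u \<otimes>\<^bsub>\<Gamma>\<^esub> v \<otimes>\<^bsub>\<Gamma>\<^esub> u) y = ax (inv\<^bsub>\<Gamma>\<^esub> u) (ax v (ax u y))"
      using True u y by (simp add: X.a_mult X.a_closed)
    moreover have "ax v (ax u y) = ax u y \<longleftrightarrow> ax (inv\<^bsub>\<Gamma>\<^esub> u) (ax v (ax u y)) = y"
      using X.a_inv[OF u y] X.a_inv2[OF u, of "ax v (ax u y)"] True u y by (metis X.a_closed)
    ultimately show ?thesis
      using conj_mem_iff[OF u True H] True u by (auto simp: stabilizer_def)
  next
    case False
    moreover have "u <#\<^bsub>\<Gamma>\<^esub> stab y #>\<^bsub>\<Gamma>\<^esub> inv\<^bsub>\<Gamma>\<^esub> u \<subseteq> carrier \<Gamma>"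
      using u H by (auto simp: l_coset_def r_coset_def)
    ultimately show ?thesis by (auto simp: stabilizer_def)
  qed
qed

end

section \<open>Comparison with the stabilizers\<close>

lemma map_act_subgroup:
  assumes "group G" "subgroup H G" "h \<in> H"
  shows "map_act (G\<lparr>carrier := H\<rparr>) Y a act h = map_act G Y a act h"
  using group.m_inv_consistent[OF assms] by (simp add: map_act_def fun_eq_iff)

lemma acyclic_at_act_cong:
  assumes "\<And>g x. g \<in> carrier G \<Longrightarrow> x \<in> A \<Longrightarrow> act g x = act' g x"
  shows "acyclic_at G A act i = acyclic_at G A act' i"
proof -
  have "hcochain G A act k = hcochain G A act' k" for k
    using assms by (auto simp: hcochain_def fun_eq_iff)
  then show ?thesis by (simp add: acyclic_at_def hcocycle_def hexact_def)
qed

context free_semidirect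
begin

definition dlog :: "'g \<Rightarrow> nat" where
  "dlog g = (SOME j. j < m \<and> g = z [^]\<^bsub>G\<^esub> j)"

lemma dlog: "g \<in> carrier G \<Longrightarrow> dlog g < m \<and> g = z [^]\<^bsub>G\<^esub> dlog g"
  unfolding dlog_def m_def by (rule someI_ex) (rule z(2))

lemma dlog_unique:
  assumes "i < m" "j < m" "z [^]\<^bsub>G\<^esub> i = z [^]\<^bsub>G\<^esub> j"
  shows "i = j"
proof -
  \<comment> \<open>The m exponents reach all m elements of \<open>G\<close>, so injectivity follows
    by counting.\<close>
  have "(\<lambda>j. z [^]\<^bsub>G\<^esub> j) ` {..<m} = carrier G"
    using z unfolding m_def by auto
  then have "inj_on (\<lambda>j. z [^]\<^bsub>G\<^esub> j) {..<m}"
    by (intro eq_card_imp_inj_on) (auto simp: m_def order_def)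
  then show ?thesis using assms by (auto simp: inj_on_def)
qed

lemma pow_mod: "z [^]\<^bsub>G\<^esub> (k mod m) = z [^]\<^bsub>G\<^esub> k"
proof -
  have "z [^]\<^bsub>G\<^esub> k = z [^]\<^bsub>G\<^esub> (m * (k div m) + k mod m)" by simp
  also have "\<dots> = (z [^]\<^bsub>G\<^esub> m) [^]\<^bsub>G\<^esub> (k div m) \<otimes>\<^bsub>G\<^esub> z [^]\<^bsub>G\<^esub> (k mod m)"
    using z(1) by (simp only: G.nat_pow_mult[symmetric] G.nat_pow_pow)
  also have "z [^]\<^bsub>G\<^esub> m = \<one>\<^bsub>G\<^esub>" unfolding m_def by (rule G.pow_order_eq_1[OF z(1)])
  finally show ?thesis using z(1) by simp
qed

definition e :: "'l \<times> 'g \<Rightarrow> nat" where "e u = dlog (snd u)"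

abbreviation "rot \<equiv> (\<lambda>u k. (e u + k) mod m)"

lemma e_mult:
  assumes "u \<in> carrier \<Gamma>" "v \<in> carrier \<Gamma>"
  shows "e (u \<otimes>\<^bsub>\<Gamma>\<^esub> v) = (e u + e v) mod m"
proof (rule dlog_unique)
  have s: "snd u \<in> carrier G" "snd v \<in> carrier G" using assms by (auto simp: carrier_\<Gamma>)
  have "z [^]\<^bsub>G\<^esub> e (u \<otimes>\<^bsub>\<Gamma>\<^esub> v) = snd u \<otimes>\<^bsub>G\<^esub> snd v"
    using dlog[of "snd u \<otimes>\<^bsub>G\<^esub> snd v"] s by (simp add: e_def snd_hom[OF assms])
  also have "\<dots> = z [^]\<^bsub>G\<^esub> e u \<otimes>\<^bsub>G\<^esub> z [^]\<^bsub>G\<^esub> e v"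
    unfolding e_def using dlog s by simp
  also have "\<dots> = z [^]\<^bsub>G\<^esub> ((e u + e v) mod m)"
    by (simp add: pow_mod G.nat_pow_mult z(1))
  finally show "z [^]\<^bsub>G\<^esub> e (u \<otimes>\<^bsub>\<Gamma>\<^esub> v) = z [^]\<^bsub>G\<^esub> ((e u + e v) mod m)" .
  show "e (u \<otimes>\<^bsub>\<Gamma>\<^esub> v) < m"
    unfolding e_def snd_hom[OF assms] using dlog s by simp
qed (simp add: m_pos)

lemma e_eq_0_iff: "u \<in> carrier \<Gamma> \<Longrightarrow> e u = 0 \<longleftrightarrow> snd u = \<one>\<^bsub>G\<^esub>"
  using dlog[of "snd u"] dlog_unique[of "dlog \<one>\<^bsub>G\<^esub>" 0] dlog[of "\<one>\<^bsub>G\<^esub>"] m_pos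
  by (auto simp: e_def carrier_\<Gamma>)

lemma e_less: "u \<in> carrier \<Gamma> \<Longrightarrow> e u < m"
  using dlog by (auto simp: e_def carrier_\<Gamma>)

lemma gset_rot: "gset \<Gamma> {..<m} rot"
proof unfold_locales
  show "rot \<one>\<^bsub>\<Gamma>\<^esub> k = k" if "k \<in> {..<m}" for k
    using that e_eq_0_iff[OF \<Gamma>.one_closed] by (simp add: one_\<Gamma>)
  show "rot (u \<otimes>\<^bsub>\<Gamma>\<^esub> v) k = rot u (rot v k)" if "u \<in> carrier \<Gamma>" "v \<in> carrier \<Gamma>" for u v k
    using that by (simp add: e_mult mod_simps add.assoc)
qed (use m_pos in auto)

text \<open>The copy of \<open>L\<close> in \<open>\<Gamma>\<close>, which is the kernel of the map
  to Z/m behind \<open>rot\<close>.\<close>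

definition T :: "('l \<times> 'g) set" where "T = {u \<in> carrier \<Gamma>. snd u = \<one>\<^bsub>G\<^esub>}"

lemma stabilizer_rot: "k < m \<Longrightarrow> stabilizer \<Gamma> rot k = T"
proof -
  assume k: "k < m"
  have "(e u + k) mod m = k \<longleftrightarrow> e u = 0" if "u \<in> carrier \<Gamma>" for u
    using e_less[OF that] k by (cases "e u + k < m") (auto simp: mod_if)
  then show ?thesis using e_eq_0_iff by (auto simp: stabilizer_def T_def)
qed

lemma T_subgroup: "subgroup T \<Gamma>"
  using subgroup_stabilizer[OF gset_rot, of 0] stabilizer_rot[of 0] m_pos by simp

definition translate :: "'l \<times> 'g \<Rightarrow> (nat \<Rightarrow> int) \<Rightarrow> nat \<Rightarrow> int" where
  "translate u v = (\<lambda>j. if j < n then v j + co (fst u) j else 0)"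

text \<open>Nontrivial translations fix no simplex, so all modules of the resolution are coinduced
  from the trivial group; n is the dimension of the triangulated space.\<close>

lemma acyclic_T: "i > n \<Longrightarrow> acyclic_at (\<Gamma>\<lparr>carrier := T\<rparr>) (UNIV :: int set) trivial_act i"
proof -
  assume i: "i > n"
  interpret Tg: group "\<Gamma>\<lparr>carrier := T\<rparr>"
    using T_subgroup by (rule subgroup.subgroup_is_group) (rule \<Gamma>.is_group)
  interpret A: gmodule "\<Gamma>\<lparr>carrier := T\<rparr>" "UNIV :: int set" trivial_act
    by (rule gmodule_trivial) (rule Tg.is_group)
  interpret V: lattice_action "\<Gamma>\<lparr>carrier := T\<rparr>" "UNIV :: int set" trivial_act "{..<n}" translate
  proof unfold_locales
    show "translate (u \<otimes>\<^bsub>\<Gamma>\<lparr>carrier := T\<rparr>\<^esub> u') v = translate u (translate u' v)"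
      if "u \<in> carrier (\<Gamma>\<lparr>carrier := T\<rparr>)" "u' \<in> carrier (\<Gamma>\<lparr>carrier := T\<rparr>)" for u u' v
      using that by (auto simp: T_def carrier_\<Gamma> mult_\<Gamma> translate_def \<rho>_one co_mult fun_eq_iff)
  qed (auto simp: translate_def lattice_def T_def carrier_\<Gamma> one_\<Gamma> co_one fun_eq_iff le_fun_def)
  have "acyclic_at (\<Gamma>\<lparr>carrier := T\<rparr>) (V.C (Suc k)) (V.C_act (Suc k)) i" for k i
  proof (rule V.C.acyclic_free)
    fix u vs assume u: "u \<in> carrier (\<Gamma>\<lparr>carrier := T\<rparr>)" and vs: "vs \<in> simplices {..<n} (Suc k)"
      and "map (translate u) vs = vs"
    \<comment> \<open>Simplices are ordered lists, so fixing a simplex means fixing its first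
      vertex.\<close>
    then obtain v where v: "translate u v = v" by (cases vs) (auto simp: simplices_def)
    have "co (fst u) j = 0" if "j < n" for j
      using fun_cong[OF v, of j] that by (simp add: translate_def)
    then have "fst u = \<one>\<^bsub>L\<^esub>" using u by (intro co_eq_zero) (auto simp: T_def carrier_\<Gamma>)
    then show "u = \<one>\<^bsub>\<Gamma>\<lparr>carrier := T\<rparr>\<^esub>" using u by (auto simp: T_def one_\<Gamma> prod_eq_iff)
  qed
  then show ?thesis
    by (rule V.acyclic_above_dimension) (use i in simp)
qed

sublocale B: based_map_module \<Gamma> "carrier L" ax "UNIV :: int set" trivial_act "\<one>\<^bsub>L\<^esub>"
  unfolding based_map_module_def map_module_def based_map_module_axioms_def
  using X.gset_axioms gmodule_trivial[OF group_\<Gamma>] by simp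

abbreviation "XZ \<equiv> map_mod (carrier L) (UNIV :: int set)"
abbreviation "XZ_act \<equiv> map_act \<Gamma> (carrier L) ax trivial_act"

text \<open>\<open>H\<close> embeds into \<open>G\<close>, hence is finite and fixes a point;
  elsewhere it acts freely by uniqueness of fixed points.\<close>

lemma acyclic_Q_finite:
  assumes H: "subgroup H \<Gamma>" and tr: "\<And>u. u \<in> H \<Longrightarrow> snd u = \<one>\<^bsub>G\<^esub> \<Longrightarrow> u = \<one>\<^bsub>\<Gamma>\<^esub>"
  shows "acyclic_at (\<Gamma>\<lparr>carrier := H\<rparr>) B.Q B.Q_act i"
proof -
  obtain y where y: "y \<in> carrier L" "H \<subseteq> stab y"
    using finite_subgroup_fixed_point[OF H finite_subgroup[OF assms]] by blast
  interpret Hb: based_map_module "\<Gamma>\<lparr>carrier := H\<rparr>" "carrier L" ax "UNIV :: int set" trivial_act "\<one>\<^bsub>L\<^esub>"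
    unfolding based_map_module_def map_module_def based_map_module_axioms_def
    using gset_subgroup[OF X.gset_axioms H] gmodule_subgroup[OF gmodule_trivial[OF group_\<Gamma>] H] by simp
  have "acyclic_at (\<Gamma>\<lparr>carrier := H\<rparr>) Hb.Q Hb.Q_act i"
  proof (rule Hb.acyclic_Q[OF y(1)])
    fix u y' assume "u \<in> carrier (\<Gamma>\<lparr>carrier := H\<rparr>)" "y' \<in> carrier L" "y' \<noteq> y" "ax u y' = y'"
    moreover from this have "ax u y = y" "u \<in> carrier \<Gamma>" using y(2) by (auto simp: stabilizer_def)
    ultimately show "u = \<one>\<^bsub>\<Gamma>\<lparr>carrier := H\<rparr>\<^esub>" using fixed_point_unique[of u y y'] y(1) by auto
  qed (use y(2) in \<open>auto simp: stabilizer_def\<close>)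
  moreover have "Hb.Q_act u x = B.Q_act u x" if "u \<in> carrier (\<Gamma>\<lparr>carrier := H\<rparr>)" for u x
    using that by (simp add: Hb.Q_act_def B.Q_act_def map_act_subgroup[OF group_\<Gamma> H])
  ultimately show ?thesis using acyclic_at_act_cong[of "\<Gamma>\<lparr>carrier := H\<rparr>" Hb.Q Hb.Q_act B.Q_act] by simp
qed

text \<open>The action on the lattice of \<open>\<int>\<^sup>n\<close>-valued functions on \<open>G\<close> (coinduced from the translations
  of \<open>\<int>\<^sup>n\<close>); unlike the action on \<open>L\<close> itself it preserves the coordinatewise order.\<close>

definition coind :: "'l \<times> 'g \<Rightarrow> ('g \<times> nat \<Rightarrow> int) \<Rightarrow> 'g \<times> nat \<Rightarrow> int" where
  "coind u v = (\<lambda>(k, j). if k \<in> carrier G \<and> j < n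
     then v (inv\<^bsub>G\<^esub> (snd u) \<otimes>\<^bsub>G\<^esub> k, j) + co (\<rho> (inv\<^bsub>G\<^esub> k) (fst u)) j else 0)"

text \<open>The summand with \<open>\<rho> (inv k)\<close> comes from the map sending
  \<open>y\<close> in \<open>L\<close> to the function with value
  \<open>co (\<rho> (inv k) y)\<close> at \<open>k\<close>: it carries the affine action y -> x + g
  y to \<open>coind\<close>.\<close>

lemma coind_mult:
  assumes u: "u \<in> carrier \<Gamma>" and u': "u' \<in> carrier \<Gamma>"
  shows "coind (u \<otimes>\<^bsub>\<Gamma>\<^esub> u') v = coind u (coind u' v)"
proof
  fix kj :: "'g \<times> nat"
  obtain k j where kj: "kj = (k, j)" by (cases kj)
  obtain x g x' g' where x: "u = (x, g)" "u' = (x', g')" "x \<in> carrier L" "g \<in> carrier G"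
    "x' \<in> carrier L" "g' \<in> carrier G" using u u' by (auto simp: carrier_\<Gamma>)
  show "coind (u \<otimes>\<^bsub>\<Gamma>\<^esub> u') v kj = coind u (coind u' v) kj"
  proof (cases "k \<in> carrier G \<and> j < n")
    case True
    have "\<rho> (inv\<^bsub>G\<^esub> (inv\<^bsub>G\<^esub> g \<otimes>\<^bsub>G\<^esub> k)) x' = \<rho> (inv\<^bsub>G\<^esub> k) (\<rho> g x')"
      using True x by (simp add: G.inv_mult_group \<rho>_comp)
    then show ?thesis
      using True x unfolding kj
      by (simp add: coind_def mult_\<Gamma> \<rho>_mult co_mult \<rho>_closed G.inv_mult_group G.m_assoc)
  qed (auto simp: coind_def kj)
qed

text \<open>An element of \<open>T\<close> fixing a vertex is trivial, so
  \<open>acyclic_Q_finite\<close> applies to the stabilizers of simplices; m n is the rank of the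
  coinduced lattice.\<close>

lemma acyclic_Q_above:
  assumes i: "i > m * n"
  shows "acyclic_at \<Gamma> B.Q B.Q_act i"
proof -
  let ?S = "carrier G \<times> {..<n}"
  interpret Qm: gmodule \<Gamma> B.Q B.Q_act by (rule B.gmodule_Q)
  interpret V: lattice_action \<Gamma> B.Q B.Q_act ?S coind
  proof unfold_locales
    show "coind (u \<otimes>\<^bsub>\<Gamma>\<^esub> u') v = coind u (coind u' v)"
      if "u \<in> carrier \<Gamma>" "u' \<in> carrier \<Gamma>" for u u' v
      using that by (rule coind_mult)
    show "coind \<one>\<^bsub>\<Gamma>\<^esub> v = v" if "v \<in> lattice ?S" for v
      using that by (auto simp: coind_def one_\<Gamma> lattice_def \<rho>_one_L co_one fun_eq_iff)
    show "finite ?S" using G_finite by simp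
  qed (auto simp: coind_def lattice_def le_fun_def)
  have "acyclic_at \<Gamma> (V.C (Suc k)) (V.C_act (Suc k)) i" for k i
  proof (rule V.C.shapiro_acyclic)
    fix vs assume vs: "vs \<in> simplices ?S (Suc k)"
    then obtain v ws where v: "vs = v # ws" by (cases vs) (auto simp: simplices_def)
    let ?H = "stabilizer \<Gamma> (\<lambda>g. map (coind g)) vs"
    show "acyclic_at (\<Gamma>\<lparr>carrier := ?H\<rparr>) B.Q B.Q_act i"
    proof (rule acyclic_Q_finite)
      show "subgroup ?H \<Gamma>" by (rule subgroup_stabilizer[OF V.chains.gset_axioms vs])
      fix u assume "u \<in> ?H" and s: "snd u = \<one>\<^bsub>G\<^esub>"
      then have u: "u \<in> carrier \<Gamma>" and c: "coind u v = v" by (auto simp: stabilizer_def v)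
      \<comment> \<open>At the neutral element of \<open>G\<close> a translation shifts the
        coordinates by those of \<open>fst u\<close>.\<close>
      have "co (fst u) j = 0" if "j < n" for j
        using fun_cong[OF c, of "(\<one>\<^bsub>G\<^esub>, j)"] that u s by (auto simp: coind_def \<rho>_one carrier_\<Gamma>)
      then have "fst u = \<one>\<^bsub>L\<^esub>" using u by (intro co_eq_zero) (auto simp: carrier_\<Gamma>)
      then show "u = \<one>\<^bsub>\<Gamma>\<^esub>" using s by (simp add: one_\<Gamma> prod_eq_iff)
    qed
  qed
  then show ?thesis
    by (rule V.acyclic_above_dimension) (use i in \<open>simp add: card_cartesian_product m_def order_def\<close>)
qed

lemma cyclic_modules:
  "cyclic_module \<Gamma> (UNIV :: int set) trivial_act m e"
  "cyclic_module \<Gamma> XZ XZ_act m e"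
  unfolding cyclic_module_def cyclic_module_axioms_def
  using gmodule_trivial[OF group_\<Gamma>] B.M.gmodule_axioms m_pos gset_rot by auto

text \<open>Shapiro's lemma reduces functions on Z/m to the stabilizer \<open>T\<close>, where
  \<open>acyclic_T\<close> supplies the bound n.\<close>

lemma acyclic_rot_Z:
  assumes "i > n"
  shows "acyclic_at \<Gamma> (map_mod {..<m} (UNIV :: int set)) (map_act \<Gamma> {..<m} rot trivial_act) i"
proof -
  interpret R: cyclic_module \<Gamma> "UNIV :: int set" trivial_act m e by (rule cyclic_modules)
  show ?thesis
    by (rule R.P.shapiro_acyclic) (simp add: stabilizer_rot acyclic_T assms)
qed

text \<open>Translations act freely on the points of \<open>L\<close>, so over \<open>T\<close> the
  module is coinduced from the trivial group and acyclic in every degree.\<close>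

lemma acyclic_rot_XZ: "acyclic_at \<Gamma> (map_mod {..<m} XZ) (map_act \<Gamma> {..<m} rot XZ_act) i"
proof -
  interpret R: cyclic_module \<Gamma> XZ XZ_act m e by (rule cyclic_modules)
  interpret Tm: map_module "\<Gamma>\<lparr>carrier := T\<rparr>" "carrier L" ax "UNIV :: int set" trivial_act
    unfolding map_module_def
    using gset_subgroup[OF X.gset_axioms T_subgroup] gmodule_subgroup[OF gmodule_trivial[OF group_\<Gamma>] T_subgroup]
    by simp
  have "acyclic_at (\<Gamma>\<lparr>carrier := T\<rparr>) XZ (map_act (\<Gamma>\<lparr>carrier := T\<rparr>) (carrier L) ax trivial_act) i"
    by (rule Tm.acyclic_free) (auto simp: T_def intro: translation_free)
  then have "acyclic_at (\<Gamma>\<lparr>carrier := T\<rparr>) XZ XZ_act i"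
    using acyclic_at_act_cong[of "\<Gamma>\<lparr>carrier := T\<rparr>" XZ "map_act (\<Gamma>\<lparr>carrier := T\<rparr>) (carrier L) ax trivial_act" XZ_act]
    by (simp add: map_act_subgroup[OF group_\<Gamma> T_subgroup])
  then show ?thesis
    by (intro R.P.shapiro_acyclic) (simp add: stabilizer_rot)
qed

theorem iso_XZ:
  assumes "i > n"
  shows "cohomology_iso \<Gamma> (UNIV :: int set) trivial_act XZ XZ_act B.cst i"
proof -
  interpret gses \<Gamma> "UNIV :: int set" trivial_act XZ XZ_act B.Q B.Q_act B.cst B.normalize
    by (rule B.gses_Q)
  \<comment> \<open>\<open>Q\<close> has to be acyclic in the degrees i - 1 and i, whence the +
    1.\<close>
  have large: "cohomology_iso \<Gamma> (UNIV :: int set) trivial_act XZ XZ_act B.cst i" if "i > m * n + 1" for i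
  proof -
    obtain j where j: "i = Suc (Suc j)" using \<open>i > m * n + 1\<close> by (metis add_lessD1 less_imp_Suc_add add_Suc_right add.commute plus_1_eq_Suc)
    show ?thesis
      unfolding j by (rule cohomology_iso_\<iota>) (use that j acyclic_Q_above in auto)
  qed
  \<comment> \<open>\<open>d\<close> bounds the number of periods of length 2 between i and the
    range of \<open>large\<close>.\<close>
  have "cohomology_iso \<Gamma> (UNIV :: int set) trivial_act XZ XZ_act B.cst i"
    if "i > n" "i + 2 * d > m * n + 1" for d i
    using that
  proof (induction d arbitrary: i)
    case 0
    then show ?case using large by simp
  next
    case (Suc d)
    obtain j where j: "i = Suc j" using Suc.prems(1) by (cases i) auto
    show ?case
      unfolding j
    proof (rule periodic_iso_descent[OF cyclic_modules B.cst_hom])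
      show "cohomology_iso \<Gamma> UNIV trivial_act XZ XZ_act B.cst (Suc (Suc (Suc j)))"
        using Suc.IH[of "Suc (Suc i)"] Suc.prems j by simp
      show "acyclic_at \<Gamma> (map_mod {..<m} (UNIV :: int set)) (map_act \<Gamma> {..<m} rot trivial_act) (Suc k)"
        if "k \<in> {j, Suc j, Suc (Suc j)}" for k
        using that Suc.prems(1) j by (intro acyclic_rot_Z) auto
      show "acyclic_at \<Gamma> (map_mod {..<m} XZ) (map_act \<Gamma> {..<m} rot XZ_act) (Suc k)" for k
        by (rule acyclic_rot_XZ)
    qed
  qed
  from this[of i "m * n + 2"] assms show ?thesis by simp
qed

text \<open>Degree 1 is Shapiro's lemma with \<open>acyclic_finite_1\<close>; periodicity climbs
  from there by 2, with no lower bound on the degree thanks to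
  \<open>acyclic_rot_XZ\<close>.\<close>

lemma acyclic_XZ_odd: "acyclic_at \<Gamma> XZ XZ_act (2 * k + 1)"
proof (induction k)
  case 0
  have "acyclic_at \<Gamma> XZ XZ_act 1"
  proof (rule B.shapiro_acyclic)
    fix y assume y: "y \<in> carrier L"
    show "acyclic_at (\<Gamma>\<lparr>carrier := stab y\<rparr>) (UNIV :: int set) trivial_act 1"
      using stab_finite[OF y] subgroup.subgroup_is_group[OF stab_subgroup[OF y] group_\<Gamma>]
      by (intro acyclic_finite_1) auto
  qed
  then show ?case by simp
next
  case (Suc k)
  interpret R: cyclic_module \<Gamma> XZ XZ_act m e by (rule cyclic_modules)
  show ?case
    using R.periodic_acyclic[OF _ acyclic_rot_XZ acyclic_rot_XZ, of "2 * k"] Suc by simp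
qed

theorem hexact_odd:
  assumes "2 * k + 1 > n" "hcocycle \<Gamma> (UNIV :: int set) trivial_act (2 * k + 1) c"
  shows "hexact \<Gamma> (UNIV :: int set) trivial_act (2 * k + 1) c"
proof -
  interpret cst: gmodule_hom \<Gamma> "UNIV :: int set" trivial_act XZ XZ_act B.cst by (rule B.cst_hom)
  have "hexact \<Gamma> XZ XZ_act (2 * k + 1) (\<lambda>gs. B.cst (c gs))"
    using acyclic_XZ_odd cst.hcocycle_hom[OF assms(2)] unfolding acyclic_at_def by blast
  then show ?thesis
    using iso_XZ[OF assms(1)] assms(2) unfolding cohomology_iso_def by blast
qed

text \<open>By \<open>iso_XZ\<close> and Shapiro's lemma one point in each orbit suffices. A trivial
  stabilizer has no obstruction; a nontrivial one is maximal finite, and its orbit contains the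
  fixed point of the conjugate representative in \<open>\<M>\<close>.\<close>

theorem hexact_from_maximal_finite:
  assumes M: "complete_maximal_finite_representatives \<M> \<Gamma>"
    and i: "i > n" and c: "hcocycle \<Gamma> (UNIV :: int set) trivial_act i c"
    and ex: "\<And>H. H \<in> \<M> \<Longrightarrow> hexact (\<Gamma>\<lparr>carrier := H\<rparr>) (UNIV :: int set) trivial_act i c"
  shows "hexact \<Gamma> (UNIV :: int set) trivial_act i c"
proof -
  interpret cst: gmodule_hom \<Gamma> "UNIV :: int set" trivial_act XZ XZ_act B.cst by (rule B.cst_hom)
  have cc: "hcocycle \<Gamma> XZ XZ_act i (\<lambda>gs. B.cst (c gs))" by (rule cst.hcocycle_hom[OF c])
  have "hexact \<Gamma> XZ XZ_act i (\<lambda>gs. B.cst (c gs))"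
  proof (rule B.shapiro_injective[OF cc])
    fix y assume y: "y \<in> carrier L"
    have cst_y: "(\<lambda>hs. B.cst (c hs) y') = c" if "y' \<in> carrier L" for y'
      using that by (simp add: B.cst_def)
    show "\<exists>g\<in>carrier \<Gamma>. hexact (\<Gamma>\<lparr>carrier := stab (ax g y)\<rparr>) UNIV trivial_act i (\<lambda>hs. B.cst (c hs) (ax g y))"
    proof (cases "stab y = {\<one>\<^bsub>\<Gamma>\<^esub>}")
      case True
      have "acyclic_at (\<Gamma>\<lparr>carrier := stab y\<rparr>) (UNIV :: int set) trivial_act i"
        using True gmodule_subgroup[OF gmodule_trivial[OF group_\<Gamma>] stab_subgroup[OF y]]
        by (intro acyclic_trivial_group) auto
      then have "hexact (\<Gamma>\<lparr>carrier := stab y\<rparr>) UNIV trivial_act i c"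
        using hcocycle_subgroup[OF c stab_subgroup[OF y]] by (simp add: acyclic_at_def)
      then show ?thesis using y by (intro bexI[of _ "\<one>\<^bsub>\<Gamma>\<^esub>"]) (simp_all add: X.a_one cst_y)
    next
      case False
      then obtain H where H: "H \<in> \<M>" "conjugate_subgroups \<Gamma> H (stab y)"
        using M stab_maximal_finite[OF y] unfolding complete_maximal_finite_representatives_def by blast
      then have "maximal_finite_subgroup H \<Gamma>"
        using M unfolding complete_maximal_finite_representatives_def by blast
      then obtain y' where y': "y' \<in> carrier L" "H = stab y'" by (rule maximal_finite_stab)
      obtain g where g: "g \<in> carrier \<Gamma>" "stab y = stab (ax g y')"
        using H(2) stab_conj y' unfolding conjugate_subgroups_def by metis
      obtain u where u: "u \<in> stab y" "u \<noteq> \<one>\<^bsub>\<Gamma>\<^esub>"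
        using False subgroup.one_closed[OF stab_subgroup[OF y]] by blast
      have uf: "u \<in> carrier \<Gamma>" "ax u y = y" using u(1) by (auto simp: stabilizer_def)
      have uf': "ax u (ax g y') = ax g y'" using u(1) unfolding g(2) by (auto simp: stabilizer_def)
      \<comment> \<open>Equal nontrivial stabilizers force equal points.\<close>
      have "y = ax g y'"
        by (rule fixed_point_unique[OF uf(1) u(2) y X.a_closed[OF g(1) y'(1)] uf(2) uf'])
      then have "ax (inv\<^bsub>\<Gamma>\<^esub> g) y = y'" using g(1) y'(1) by simp
      then show ?thesis
        using ex[OF H(1)] y' g(1) by (intro bexI[of _ "inv\<^bsub>\<Gamma>\<^esub> g"]) (simp_all add: cst_y)
    qed
  qed
  then show ?thesis
    using iso_XZ[OF i] c unfolding cohomology_iso_def by blast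
qed

text \<open>Points of one orbit have conjugate stabilizers, so distinct members of
  \<open>\<M>\<close> yield distinct orbits, as \<open>shapiro_surjective\<close> requires.\<close>

lemma representative_points:
  assumes M: "complete_maximal_finite_representatives \<M> \<Gamma>"
  obtains p where "\<And>H. H \<in> \<M> \<Longrightarrow> p H \<in> carrier L \<and> stab (p H) = H"
    "\<And>H H' g. H \<in> \<M> \<Longrightarrow> H' \<in> \<M> \<Longrightarrow> g \<in> carrier \<Gamma> \<Longrightarrow> ax g (p H) = p H' \<Longrightarrow> H = H'"
proof -
  have max: "maximal_finite_subgroup H \<Gamma>" if "H \<in> \<M>" for H
    using M that unfolding complete_maximal_finite_representatives_def by blast
  define p where "p = (\<lambda>H. SOME y. y \<in> carrier L \<and> stab y = H)"
  have p: "p H \<in> carrier L \<and> stab (p H) = H" if "H \<in> \<M>" for H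
    unfolding p_def by (rule someI_ex) (use maximal_finite_stab[OF max[OF that]] in metis)
  have "H = H'" if H: "H \<in> \<M>" "H' \<in> \<M>" and g: "g \<in> carrier \<Gamma>" "ax g (p H) = p H'" for H H' g
  proof -
    have conj: "conjugate_subgroups \<Gamma> K (stab (ax h (p K)))" if "K \<in> \<M>" "h \<in> carrier \<Gamma>" for K h
      using stab_conj[OF that(2), of "p K"] p[OF that(1)] that(2) unfolding conjugate_subgroups_def by metis
    have "conjugate_subgroups \<Gamma> H H'" using conj[OF H(1) g(1)] p[OF H(2)] g(2) by simp
    moreover have "conjugate_subgroups \<Gamma> H' H'"
      using conj[OF H(2) \<Gamma>.one_closed] p[OF H(2)] by (simp add: X.a_one)
    ultimately show "H = H'"
      using M max[OF H(2)] H unfolding complete_maximal_finite_representatives_def by blast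
  qed
  then show thesis using that p by blast
qed

text \<open>The given cocycles are placed at the representative points, extended to a cocycle with
  values in Z^X, and brought back to Z by \<open>iso_XZ\<close>; the last step costs a
  coboundary.\<close>

theorem cocycle_extension:
  assumes M: "complete_maximal_finite_representatives \<M> \<Gamma>" and i: "i > n"
    and c: "\<And>H. H \<in> \<M> \<Longrightarrow> hcocycle (\<Gamma>\<lparr>carrier := H\<rparr>) (UNIV :: int set) trivial_act i (c H)"
  obtains f where "hcocycle \<Gamma> (UNIV :: int set) trivial_act i f"
    "\<And>H. H \<in> \<M> \<Longrightarrow> hexact (\<Gamma>\<lparr>carrier := H\<rparr>) (UNIV :: int set) trivial_act i (\<lambda>hs. c H hs - f hs)"
proof -
  obtain p where p: "\<And>H. H \<in> \<M> \<Longrightarrow> p H \<in> carrier L \<and> stab (p H) = H"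
    "\<And>H H' g. H \<in> \<M> \<Longrightarrow> H' \<in> \<M> \<Longrightarrow> g \<in> carrier \<Gamma> \<Longrightarrow> ax g (p H) = p H' \<Longrightarrow> H = H'"
    using M by (rule representative_points) blast
  obtain F where F: "hcocycle \<Gamma> XZ XZ_act i F"
    "\<And>y hs. y \<in> p ` \<M> \<Longrightarrow> hs \<in> tuples (\<Gamma>\<lparr>carrier := stab y\<rparr>) (Suc i) \<Longrightarrow> F hs y = c (stab y) hs"
  proof (rule B.shapiro_surjective[of "p ` \<M>" i "\<lambda>y. c (stab y)"])
    show "p ` \<M> \<subseteq> carrier L" using p(1) by blast
    show "ax g y = y" if "y \<in> p ` \<M>" "g \<in> carrier \<Gamma>" "ax g y \<in> p ` \<M>" for y g
      using that p(2) by blast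
    show "hcocycle (\<Gamma>\<lparr>carrier := stab y\<rparr>) UNIV trivial_act i (c (stab y))" if "y \<in> p ` \<M>" for y
      using that c p(1) by auto
  qed blast
  obtain f where f: "hcocycle \<Gamma> (UNIV :: int set) trivial_act i f"
    "hexact \<Gamma> XZ XZ_act i (\<lambda>gs. F gs - B.cst (f gs))"
    using iso_XZ[OF i] F(1) unfolding cohomology_iso_def by blast
  have "hexact (\<Gamma>\<lparr>carrier := H\<rparr>) (UNIV :: int set) trivial_act i (\<lambda>hs. c H hs - f hs)" if H: "H \<in> \<M>" for H
  proof -
    have pH: "p H \<in> carrier L" "stab (p H) = H" using p(1)[OF H] by auto
    have "hexact (\<Gamma>\<lparr>carrier := stab (p H)\<rparr>) UNIV trivial_act i (\<lambda>hs. (F hs - B.cst (f hs)) (p H))"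
      by (rule B.evaluation_hexact[OF f(2) pH(1)])
    then show ?thesis
      unfolding pH(2) by (rule hexact_cong) (use F(2)[of "p H"] H pH in \<open>simp add: B.cst_def\<close>)
  qed
  then show thesis using that f(1) by blast
qed

text \<open>Needed to identify the direct sum with the product. The translation by \<open>x\<close>
  shifts points by the m-th power of \<open>x\<close>, so points with congruent coordinates modulo m
  lie in one orbit.\<close>

lemma finite_representatives:
  assumes M: "complete_maximal_finite_representatives \<M> \<Gamma>"
  shows "finite \<M>"
proof -
  obtain p where p: "\<And>H. H \<in> \<M> \<Longrightarrow> p H \<in> carrier L \<and> stab (p H) = H"
    "\<And>H H' g. H \<in> \<M> \<Longrightarrow> H' \<in> \<M> \<Longrightarrow> g \<in> carrier \<Gamma> \<Longrightarrow> ax g (p H) = p H' \<Longrightarrow> H = H'"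
    using M by (rule representative_points) blast
  define r where "r H = (\<lambda>j\<in>{..<n}. co (p H) j mod int m)" for H
  have "inj_on r \<M>"
  proof (rule inj_onI)
    fix H H' assume H: "H \<in> \<M>" "H' \<in> \<M>" and r: "r H = r H'"
    have y: "p H \<in> carrier L" "p H' \<in> carrier L" using p(1) H by auto
    define q where "q j = (co (p H') j - co (p H) j) div int m" for j
    have q: "co (p H') j - co (p H) j = int m * q j" if "j < n" for j
    proof -
      have "co (p H') j mod int m = co (p H) j mod int m"
        using fun_cong[OF r, of j] that by (simp add: r_def)
      then have "int m dvd co (p H') j - co (p H) j" by (simp only: mod_eq_dvd_iff)
      then show ?thesis unfolding q_def by (rule dvd_mult_div_cancel[symmetric])
    qed
    obtain x where x: "x \<in> carrier L" "\<And>j. j < n \<Longrightarrow> co x j = q j" using co_surj[of q] by blast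
    have "ax (x, \<one>\<^bsub>G\<^esub>) (p H) = p H'"
    proof (rule co_inj)
      fix j assume j: "j < n"
      show "co (ax (x, \<one>\<^bsub>G\<^esub>) (p H)) j = co (p H') j"
        using q[OF j] x j y by (simp add: ax_def \<rho>_one co_mult co_pow)
    qed (use x y in \<open>auto simp: ax_def \<rho>_one\<close>)
    then show "H = H'" by (intro p(2)[OF H, of "(x, \<one>\<^bsub>G\<^esub>)"]) (simp_all add: carrier_\<Gamma> x(1))
  qed
  moreover have "r ` \<M> \<subseteq> (\<Pi>\<^sub>E j\<in>{..<n}. {0..<int m})"
    using m_pos by (auto simp: r_def)
  ultimately show ?thesis
    by (rule inj_on_finite) (intro finite_PiE; simp)
qed

end

section \<open>Inhomogeneous cochains\<close>

text \<open>Passage from homogeneous to inhomogeneous tuples, unchanged under left translation;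
  \<open>partials\<close> is its section with prescribed first entry.\<close>

fun diffs :: "('g, 'b) monoid_scheme \<Rightarrow> 'g list \<Rightarrow> 'g list" where
  "diffs G (g # h # gs) = (inv\<^bsub>G\<^esub> g \<otimes>\<^bsub>G\<^esub> h) # diffs G (h # gs)"
| "diffs G gs = []"

fun partials :: "('g, 'b) monoid_scheme \<Rightarrow> 'g \<Rightarrow> 'g list \<Rightarrow> 'g list" where
  "partials G g [] = [g]"
| "partials G g (h # hs) = g # partials G (g \<otimes>\<^bsub>G\<^esub> h) hs"

text \<open>All terms of the coboundary but the first, with the opposite sign, in a recursion
  parallel to \<open>bd\<close>; \<open>g\<close> is the entry waiting to be merged.\<close>

fun merge_sum :: "('g, 'b) monoid_scheme \<Rightarrow> ('g list \<Rightarrow> int) \<Rightarrow> 'g \<Rightarrow> 'g list \<Rightarrow> int" where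
  "merge_sum G c g [] = c []"
| "merge_sum G c g (h # hs) = c ((g \<otimes>\<^bsub>G\<^esub> h) # hs) - merge_sum G (\<lambda>ks. c (g # ks)) h hs"

lemma merge_sum_eq:
  "merge_sum G c g hs =
    - ((\<Sum>i<length hs. (-1) ^ Suc i * c (take i (g # hs) @ [(g # hs) ! i \<otimes>\<^bsub>G\<^esub> (g # hs) ! Suc i] @ drop (i + 2) (g # hs)))
      + (-1) ^ Suc (length hs) * c (butlast (g # hs)))"
proof (induction hs arbitrary: c g)
  case (Cons h hs)
  show ?case
    by (simp only: merge_sum.simps Cons.IH list.size add_Suc_right add_0_right sum.lessThan_Suc_shift)
       (simp add: sum_negf)
qed simp

lemma coboundary_eq:
  assumes "g # hs \<in> tuples G (Suc n)"
  shows "coboundary G n c (g # hs) = c hs - merge_sum G c g hs"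
proof -
  have "length hs = n" using assms by (simp add: tuples_def)
  then show ?thesis using assms merge_sum_eq[of G c g hs] by (simp add: coboundary_def)
qed

text \<open>Omitting the vertex \<open>h\<close> multiplies the neighbouring quotients: (g^-1
  h)(h^-1 k) = g^-1 k. The vertex \<open>g\<close> stays in front throughout.\<close>

lemma bd_diffs_Cons:
  assumes "group G" "g \<in> carrier G" "h \<in> carrier G" "set hs \<subseteq> carrier G"
  shows "bd (\<lambda>ys. c (diffs G (g # ys))) (h # hs) = merge_sum G c (inv\<^bsub>G\<^esub> g \<otimes>\<^bsub>G\<^esub> h) (diffs G (h # hs))"
  using assms(2-)
proof (induction hs arbitrary: c g h)
  case (Cons k hs)
  interpret group G by fact
  have "bd (\<lambda>ys. c (diffs G (g # h # ys))) (k # hs) =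
      merge_sum G (\<lambda>ks. c ((inv\<^bsub>G\<^esub> g \<otimes>\<^bsub>G\<^esub> h) # ks)) (inv\<^bsub>G\<^esub> h \<otimes>\<^bsub>G\<^esub> k) (diffs G (k # hs))"
    using Cons.IH[of h k "\<lambda>ks. c ((inv\<^bsub>G\<^esub> g \<otimes>\<^bsub>G\<^esub> h) # ks)"] Cons.prems by simp
  moreover have "inv\<^bsub>G\<^esub> g \<otimes>\<^bsub>G\<^esub> h \<otimes>\<^bsub>G\<^esub> (inv\<^bsub>G\<^esub> h \<otimes>\<^bsub>G\<^esub> k) = inv\<^bsub>G\<^esub> g \<otimes>\<^bsub>G\<^esub> k"
  proof -
    have "inv\<^bsub>G\<^esub> g \<otimes>\<^bsub>G\<^esub> h \<otimes>\<^bsub>G\<^esub> (inv\<^bsub>G\<^esub> h \<otimes>\<^bsub>G\<^esub> k) = inv\<^bsub>G\<^esub> g \<otimes>\<^bsub>G\<^esub> (h \<otimes>\<^bsub>G\<^esub> inv\<^bsub>G\<^esub> h) \<otimes>\<^bsub>G\<^esub> k"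
      using Cons.prems by (simp only: m_assoc inv_closed m_closed list.set insert_subset)
    then show ?thesis using Cons.prems by simp
  qed
  ultimately show ?case by simp
qed simp

lemma diffs_tuples: "group G \<Longrightarrow> gs \<in> tuples G (Suc k) \<Longrightarrow> diffs G gs \<in> tuples G k"
proof (induction gs arbitrary: k rule: induct_list012)
  case (3 g h gs)
  interpret group G by fact
  obtain k' where k: "k = Suc k'" using 3(4) by (cases k) (auto simp: tuples_def)
  have "diffs G (h # gs) \<in> tuples G k'" using 3 k by (auto simp: tuples_def)
  then show ?case using 3(4) k by (auto simp: tuples_def)
qed (auto simp: tuples_def)

lemma bd_diffs:
  assumes "group G" "gs \<in> tuples G (Suc (Suc n))"
  shows "bd (\<lambda>hs. c (diffs G hs)) gs = coboundary G n c (diffs G gs)"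
proof -
  obtain g h hs where gs: "gs = g # h # hs"
    using assms(2) by (auto simp: tuples_def length_Suc_conv)
  then have c: "g \<in> carrier G" "h \<in> carrier G" "set hs \<subseteq> carrier G" using assms(2) by (auto simp: tuples_def)
  have "(inv\<^bsub>G\<^esub> g \<otimes>\<^bsub>G\<^esub> h) # diffs G (h # hs) \<in> tuples G (Suc n)"
    using diffs_tuples[OF assms] by (simp add: gs)
  then show ?thesis
    using bd_diffs_Cons[OF assms(1) c, of "c"] by (simp add: gs coboundary_eq)
qed

lemma diffs_mult:
  assumes "group G" "g \<in> carrier G" "set gs \<subseteq> carrier G"
  shows "diffs G (map (\<lambda>x. g \<otimes>\<^bsub>G\<^esub> x) gs) = diffs G gs"
  using assms(3)
proof (induction gs rule: induct_list012)
  case (3 x y gs)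
  interpret group G by fact
  have "inv\<^bsub>G\<^esub> (g \<otimes>\<^bsub>G\<^esub> x) \<otimes>\<^bsub>G\<^esub> (g \<otimes>\<^bsub>G\<^esub> y) = inv\<^bsub>G\<^esub> x \<otimes>\<^bsub>G\<^esub> (inv\<^bsub>G\<^esub> g \<otimes>\<^bsub>G\<^esub> g) \<otimes>\<^bsub>G\<^esub> y"
    using 3(3) assms(2) by (simp only: inv_mult_group m_assoc inv_closed m_closed list.set insert_subset)
  then show ?case using 3 assms(2) by simp
qed auto

lemma partials_tuples:
  "group G \<Longrightarrow> g \<in> carrier G \<Longrightarrow> hs \<in> tuples G k \<Longrightarrow> partials G g hs \<in> tuples G (Suc k)"
proof (induction hs arbitrary: g k)
  case (Cons h hs)
  interpret group G by fact
  obtain k' where k: "k = Suc k'" using Cons.prems(3) by (cases k) (auto simp: tuples_def)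
  have "partials G (g \<otimes>\<^bsub>G\<^esub> h) hs \<in> tuples G (Suc k')"
    using Cons k by (auto simp: tuples_def)
  then show ?case using Cons.prems k by (auto simp: tuples_def)
qed (auto simp: tuples_def)

lemma partials_hd: "\<exists>gs. partials G g hs = g # gs"
  by (cases hs) auto

lemma diffs_partials:
  assumes "group G" "g \<in> carrier G" "set hs \<subseteq> carrier G"
  shows "diffs G (partials G g hs) = hs"
  using assms(2,3)
proof (induction hs arbitrary: g)
  case (Cons h hs)
  interpret group G by fact
  obtain gs where gs: "partials G (g \<otimes>\<^bsub>G\<^esub> h) hs = (g \<otimes>\<^bsub>G\<^esub> h) # gs" using partials_hd by metis
  have "diffs G (partials G (g \<otimes>\<^bsub>G\<^esub> h) hs) = hs" using Cons by simp
  moreover have "inv\<^bsub>G\<^esub> g \<otimes>\<^bsub>G\<^esub> (g \<otimes>\<^bsub>G\<^esub> h) = h"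
    using Cons.prems by (simp add: m_assoc[symmetric])
  ultimately show ?case by (simp add: gs)
qed simp

lemma partials_diffs:
  assumes "group G" "x \<in> carrier G" "g \<in> carrier G" "set gs \<subseteq> carrier G"
  shows "partials G (x \<otimes>\<^bsub>G\<^esub> g) (diffs G (g # gs)) = map (\<lambda>y. x \<otimes>\<^bsub>G\<^esub> y) (g # gs)"
  using assms(3,4)
proof (induction gs arbitrary: g)
  case (Cons h gs)
  interpret group G by fact
  have "x \<otimes>\<^bsub>G\<^esub> g \<otimes>\<^bsub>G\<^esub> (inv\<^bsub>G\<^esub> g \<otimes>\<^bsub>G\<^esub> h) = x \<otimes>\<^bsub>G\<^esub> (g \<otimes>\<^bsub>G\<^esub> inv\<^bsub>G\<^esub> g) \<otimes>\<^bsub>G\<^esub> h"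
    using Cons.prems assms(2) by (simp only: m_assoc inv_closed m_closed list.set insert_subset)
  then show ?case using Cons assms(2) by simp
qed simp

section \<open>The cohomology groups in terms of homogeneous cochains\<close>

lemma carrier_cochain_group: "carrier (cochain_group G n) = (\<Pi>\<^sub>E gs\<in>tuples G n. UNIV)"
  by (simp add: cochain_group_def)

lemma mult_cochain_group: "c \<otimes>\<^bsub>cochain_group G n\<^esub> c' = (\<lambda>gs\<in>tuples G n. c gs + c' gs)"
  by (simp add: cochain_group_def)

lemma one_cochain_group: "\<one>\<^bsub>cochain_group G n\<^esub> = (\<lambda>gs\<in>tuples G n. 0)"
  by (simp add: cochain_group_def)

lemma inv_cochain_group:
  "c \<in> carrier (cochain_group G n) \<Longrightarrow> inv\<^bsub>cochain_group G n\<^esub> c = (\<lambda>gs\<in>tuples G n. - c gs)"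
  unfolding cochain_group_def by (subst inv_product_group) auto

lemma comm_group_cochain_group: "comm_group (cochain_group G n)"
proof (rule group.group_comm_groupI)
  show "group (cochain_group G n)" unfolding cochain_group_def by simp
qed (auto simp: mult_cochain_group add.commute)

definition hom_cochain :: "('g, 'b) monoid_scheme \<Rightarrow> ('g list \<Rightarrow> int) \<Rightarrow> 'g list \<Rightarrow> int" where
  "hom_cochain G c = (\<lambda>gs. c (diffs G gs))"

abbreviation "zhcocycle G \<equiv> hcocycle G (UNIV :: int set) trivial_act"
abbreviation "zhexact G \<equiv> hexact G (UNIV :: int set) trivial_act"

lemma hcochain_hom_cochain:
  assumes "group G"
  shows "hcochain G (UNIV :: int set) trivial_act (Suc k) (hom_cochain G c)"
  using diffs_mult[OF assms] by (auto simp: hcochain_def hom_cochain_def tuples_def)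

text \<open>An equivariant cochain is determined by its values on tuples starting with the neutral
  element, and \<open>partials\<close> parametrizes these.\<close>

lemma hcochain_inhomogeneous:
  assumes "group G" and E: "hcochain G (UNIV :: int set) trivial_act (Suc k) E"
  obtains c where "c \<in> carrier (cochain_group G k)" "\<And>gs. gs \<in> tuples G (Suc k) \<Longrightarrow> hom_cochain G c gs = E gs"
proof -
  interpret group G by fact
  define c where "c = (\<lambda>hs\<in>tuples G k. E (partials G \<one>\<^bsub>G\<^esub> hs))"
  have "hom_cochain G c gs = E gs" if gs: "gs \<in> tuples G (Suc k)" for gs
  proof -
    obtain g hs where g: "gs = g # hs" "g \<in> carrier G" "set hs \<subseteq> carrier G"
      using gs by (auto simp: tuples_def length_Suc_conv)
    have "partials G \<one>\<^bsub>G\<^esub> (diffs G gs) = map (\<lambda>y. inv\<^bsub>G\<^esub> g \<otimes>\<^bsub>G\<^esub> y) gs"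
      using partials_diffs[OF assms(1), of "inv\<^bsub>G\<^esub> g" g hs] g by simp
    moreover have "E (map (\<lambda>y. inv\<^bsub>G\<^esub> g \<otimes>\<^bsub>G\<^esub> y) gs) = E gs"
      using E gs g(2) by (simp add: hcochain_def)
    ultimately show ?thesis
      using diffs_tuples[OF assms(1) gs] by (simp add: hom_cochain_def c_def)
  qed
  moreover have "c \<in> carrier (cochain_group G k)" by (simp add: carrier_cochain_group c_def)
  ultimately show thesis using that by blast
qed

lemma cocycles_iff:
  assumes "group G"
  shows "c \<in> cocycles G i \<longleftrightarrow> c \<in> carrier (cochain_group G i) \<and> zhcocycle G i (hom_cochain G c)"
proof -
  interpret group G by fact
  have "coboundary G i c = \<one>\<^bsub>cochain_group G (Suc i)\<^esub> \<longleftrightarrow> (\<forall>gs\<in>tuples G (Suc (Suc i)). bd (hom_cochain G c) gs = 0)"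
  proof
    assume "coboundary G i c = \<one>\<^bsub>cochain_group G (Suc i)\<^esub>"
    then show "\<forall>gs\<in>tuples G (Suc (Suc i)). bd (hom_cochain G c) gs = 0"
      using bd_diffs[OF assms] diffs_tuples[OF assms] by (simp add: hom_cochain_def one_cochain_group)
  next
    assume *: "\<forall>gs\<in>tuples G (Suc (Suc i)). bd (hom_cochain G c) gs = 0"
    have "coboundary G i c hs = 0" if hs: "hs \<in> tuples G (Suc i)" for hs
    proof -
      have p: "partials G \<one>\<^bsub>G\<^esub> hs \<in> tuples G (Suc (Suc i))" by (rule partials_tuples[OF assms _ hs]) simp
      have "diffs G (partials G \<one>\<^bsub>G\<^esub> hs) = hs"
        using diffs_partials[OF assms, of "\<one>\<^bsub>G\<^esub>" hs] hs by (simp add: tuples_def)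
      then show ?thesis using bd_diffs[OF assms p, of c] * p by (simp add: hom_cochain_def)
    qed
    then show "coboundary G i c = \<one>\<^bsub>cochain_group G (Suc i)\<^esub>"
      by (auto simp: one_cochain_group coboundary_def fun_eq_iff restrict_def)
  qed
  then show ?thesis
    using hcochain_hom_cochain[OF assms] by (auto simp: cocycles_def kernel_def hcocycle_def)
qed

text \<open>Stated for positive degrees because \<open>hexact\<close> in degree 0 admits constants
  from the empty tuple, whereas \<open>coboundaries G 0\<close> is zero.\<close>

lemma coboundaries_iff:
  assumes "group G"
  shows "c \<in> coboundaries G (Suc k) \<longleftrightarrow> c \<in> carrier (cochain_group G (Suc k)) \<and> zhexact G (Suc k) (hom_cochain G c)"
proof
  interpret group G by fact
  assume "c \<in> coboundaries G (Suc k)"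
  then obtain b where b: "c = coboundary G k b" by (auto simp: coboundaries_def)
  have "zhexact G (Suc k) (hom_cochain G c)"
    by (rule hexactI[OF hcochain_hom_cochain[OF assms, of k b]])
       (simp only: bd_diffs[OF assms] hom_cochain_def b)
  moreover have "c \<in> carrier (cochain_group G (Suc k))"
    unfolding b coboundary_def carrier_cochain_group by simp
  ultimately show "c \<in> carrier (cochain_group G (Suc k)) \<and> zhexact G (Suc k) (hom_cochain G c)"
    by blast
next
  interpret group G by fact
  assume c: "c \<in> carrier (cochain_group G (Suc k)) \<and> zhexact G (Suc k) (hom_cochain G c)"
  then obtain E where E: "hcochain G (UNIV :: int set) trivial_act (Suc k) E"
    "\<And>gs. gs \<in> tuples G (Suc (Suc k)) \<Longrightarrow> hom_cochain G c gs = bd E gs"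
    by (meson hexactE)
  obtain b where b: "b \<in> carrier (cochain_group G k)" "\<And>gs. gs \<in> tuples G (Suc k) \<Longrightarrow> hom_cochain G b gs = E gs"
    by (rule hcochain_inhomogeneous[OF assms E(1)]) blast
  have "c hs = coboundary G k b hs" for hs
  proof (cases "hs \<in> tuples G (Suc k)")
    case True
    have p: "partials G \<one>\<^bsub>G\<^esub> hs \<in> tuples G (Suc (Suc k))" by (rule partials_tuples[OF assms _ True]) simp
    have d: "diffs G (partials G \<one>\<^bsub>G\<^esub> hs) = hs"
      using diffs_partials[OF assms, of "\<one>\<^bsub>G\<^esub>" hs] True by (simp add: tuples_def)
    have "c hs = bd E (partials G \<one>\<^bsub>G\<^esub> hs)"
      using E(2)[OF p] d by (simp add: hom_cochain_def)
    also have "\<dots> = bd (hom_cochain G b) (partials G \<one>\<^bsub>G\<^esub> hs)"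
      by (rule bd_tuples_cong[OF p]) (simp add: b(2))
    also have "\<dots> = coboundary G k b hs"
      using bd_diffs[OF assms p, of b] d by (simp add: hom_cochain_def)
    finally show ?thesis .
  next
    case False
    then show ?thesis
      using PiE_arb[OF conjunct1[OF c, unfolded carrier_cochain_group] False]
      by (simp add: coboundary_def)
  qed
  then have "c = coboundary G k b" by blast
  then show "c \<in> coboundaries G (Suc k)"
    unfolding coboundaries_def nat.case using b(1) by (rule image_eqI)
qed

lemma hcocycle_inhomogeneous:
  assumes "group G" "zhcocycle G i F"
  obtains c where "c \<in> cocycles G i" "\<And>gs. gs \<in> tuples G (Suc i) \<Longrightarrow> hom_cochain G c gs = F gs"
proof -
  interpret group G by fact
  obtain c where c: "c \<in> carrier (cochain_group G i)" "\<And>gs. gs \<in> tuples G (Suc i) \<Longrightarrow> hom_cochain G c gs = F gs"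
    using hcochain_inhomogeneous[OF assms(1), of i F] assms(2) unfolding hcocycle_def by blast
  moreover have "zhcocycle G i (hom_cochain G c)"
    by (rule hcocycle_cong[OF assms(2) c(2) is_monoid])
  ultimately show thesis using that cocycles_iff[OF assms(1)] by blast
qed

lemma hom_cochain_add:
  assumes "group G" "gs \<in> tuples G (Suc i)"
  shows "hom_cochain G (c \<otimes>\<^bsub>cochain_group G i\<^esub> c') gs = hom_cochain G c gs + hom_cochain G c' gs"
  using diffs_tuples[OF assms] by (simp add: hom_cochain_def mult_cochain_group)

lemma hom_cochain_inv:
  assumes "group G" "gs \<in> tuples G (Suc i)" "c \<in> carrier (cochain_group G i)"
  shows "hom_cochain G (inv\<^bsub>cochain_group G i\<^esub> c) gs = - hom_cochain G c gs"
  using diffs_tuples[OF assms(1,2)] assms(3) by (simp add: hom_cochain_def inv_cochain_group)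

text \<open>A common argument for cocycles and coboundaries. The last assumption on \<open>P\<close>
  is there because \<open>hom_cochain\<close> is additive only on tuples of the right
  length.\<close>

lemma subgroup_hom_cochain:
  assumes "group G"
    and P: "P (\<lambda>gs. 0)" "\<And>F F'. P F \<Longrightarrow> P F' \<Longrightarrow> P (\<lambda>gs. F gs - F' gs)"
      "\<And>F F'. P F \<Longrightarrow> (\<And>gs. gs \<in> tuples G (Suc i) \<Longrightarrow> F' gs = F gs) \<Longrightarrow> P F'"
  shows "subgroup {c \<in> carrier (cochain_group G i). P (hom_cochain G c)} (cochain_group G i)"
    (is "subgroup ?H _")
proof -
  interpret C: comm_group "cochain_group G i" by (rule comm_group_cochain_group)
  have inv: "P (\<lambda>gs. - F gs)" if "P F" for F
    using P(2)[OF P(1) that] by simp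
  show ?thesis
  proof (rule C.subgroupI)
    have "P (hom_cochain G \<one>\<^bsub>cochain_group G i\<^esub>)"
      by (rule P(3)[OF P(1)]) (simp add: hom_cochain_def one_cochain_group diffs_tuples[OF assms(1)])
    then show "?H \<noteq> {}" by blast
  next
    fix c assume c: "c \<in> ?H"
    have "P (hom_cochain G (inv\<^bsub>cochain_group G i\<^esub> c))"
      by (rule P(3)[OF inv[of "hom_cochain G c"]]) (use c hom_cochain_inv[OF assms(1)] in auto)
    then show "inv\<^bsub>cochain_group G i\<^esub> c \<in> ?H" using c by simp
    fix d assume d: "d \<in> ?H"
    have "P (hom_cochain G (c \<otimes>\<^bsub>cochain_group G i\<^esub> d))"
      by (rule P(3)[OF P(2)[OF _ inv, of "hom_cochain G c" "hom_cochain G d"]])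
         (use c d hom_cochain_add[OF assms(1)] in auto)
    then show "c \<otimes>\<^bsub>cochain_group G i\<^esub> d \<in> ?H" using c d by simp
  qed auto
qed

lemma subgroup_cocycles:
  assumes "group G"
  shows "subgroup (cocycles G i) (cochain_group G i)"
proof -
  interpret A: gmodule G "UNIV :: int set" trivial_act by (rule gmodule_trivial[OF assms])
  have "cocycles G i = {c \<in> carrier (cochain_group G i). zhcocycle G i (hom_cochain G c)}"
    using cocycles_iff[OF assms] by blast
  moreover have "subgroup \<dots> (cochain_group G i)"
    by (rule subgroup_hom_cochain[OF assms])
       (auto intro: A.hexact_hcocycle[OF A.hexact_zero] A.hcocycle_diff hcocycle_cong[OF _ _ A.is_monoid])
  ultimately show ?thesis by (rule ssubst)
qed

lemma comm_group_cocycle_group: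
  assumes "group G"
  shows "comm_group (cocycle_group G i)"
proof (rule group.group_comm_groupI)
  interpret C: comm_group "cochain_group G i" by (rule comm_group_cochain_group)
  show "group (cocycle_group G i)"
    unfolding cocycle_group_def by (rule subgroup.subgroup_is_group[OF subgroup_cocycles[OF assms] C.is_group])
  show "c \<otimes>\<^bsub>cocycle_group G i\<^esub> d = d \<otimes>\<^bsub>cocycle_group G i\<^esub> c"
    if "c \<in> carrier (cocycle_group G i)" "d \<in> carrier (cocycle_group G i)" for c d
    using that C.m_comm[of c d] by (simp add: cocycle_group_def cocycles_iff[OF assms])
qed

lemma carrier_cocycle_group: "carrier (cocycle_group G i) = cocycles G i"
  by (simp add: cocycle_group_def)

lemma mult_cocycle_group: "c \<otimes>\<^bsub>cocycle_group G i\<^esub> d = c \<otimes>\<^bsub>cochain_group G i\<^esub> d"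
  by (simp add: cocycle_group_def)

lemma inv_cocycle_group:
  assumes "group G" "c \<in> cocycles G i"
  shows "inv\<^bsub>cocycle_group G i\<^esub> c = inv\<^bsub>cochain_group G i\<^esub> c"
  unfolding cocycle_group_def
  using group.m_inv_consistent[OF comm_group.axioms(2)[OF comm_group_cochain_group] subgroup_cocycles[OF assms(1)] assms(2)] .

lemma coboundaries_subset:
  assumes "group G" "c \<in> coboundaries G (Suc k)"
  shows "c \<in> cocycles G (Suc k)"
proof -
  interpret A: gmodule G "UNIV :: int set" trivial_act by (rule gmodule_trivial[OF assms(1)])
  show ?thesis
    using assms(2) A.hexact_hcocycle by (simp add: coboundaries_iff[OF assms(1)] cocycles_iff[OF assms(1)])
qed

lemma subgroup_coboundaries:
  assumes "group G"
  shows "subgroup (coboundaries G (Suc k)) (cocycle_group G (Suc k))"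
proof -
  interpret A: gmodule G "UNIV :: int set" trivial_act by (rule gmodule_trivial[OF assms])
  interpret C: comm_group "cochain_group G (Suc k)" by (rule comm_group_cochain_group)
  have "coboundaries G (Suc k) = {c \<in> carrier (cochain_group G (Suc k)). zhexact G (Suc k) (hom_cochain G c)}"
    using coboundaries_iff[OF assms] by blast
  moreover have "subgroup \<dots> (cochain_group G (Suc k))"
    by (rule subgroup_hom_cochain[OF assms]) (auto intro: A.hexact_zero A.hexact_diff hexact_cong)
  ultimately have "subgroup (coboundaries G (Suc k)) (cochain_group G (Suc k))" by (rule ssubst)
  then show ?thesis
    unfolding cocycle_group_def
    by (rule C.subgroup_incl[OF _ subgroup_cocycles[OF assms]]) (use coboundaries_subset[OF assms] in blast)
qed

definition cohomology_class :: "('g, 'b) monoid_scheme \<Rightarrow> nat \<Rightarrow> ('g list \<Rightarrow> int) \<Rightarrow> ('g list \<Rightarrow> int) set" where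
  "cohomology_class G i c = coboundaries G i #>\<^bsub>cocycle_group G i\<^esub> c"

lemma carrier_cohomology: "carrier (cohomology G i) = cohomology_class G i ` cocycles G i"
  by (simp add: cohomology_def carrier_FactGroup carrier_cocycle_group cohomology_class_def)

lemma comm_group_cohomology: "group G \<Longrightarrow> comm_group (cohomology G (Suc k))"
  unfolding cohomology_def
  by (rule comm_group.abelian_FactGroup[OF comm_group_cocycle_group subgroup_coboundaries])

lemma cohomology_class_mult:
  assumes "group G" "c \<in> cocycles G (Suc k)" "d \<in> cocycles G (Suc k)"
  shows "cohomology_class G (Suc k) c \<otimes>\<^bsub>cohomology G (Suc k)\<^esub> cohomology_class G (Suc k) d =
    cohomology_class G (Suc k) (c \<otimes>\<^bsub>cochain_group G (Suc k)\<^esub> d)"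
proof -
  interpret Z: comm_group "cocycle_group G (Suc k)" by (rule comm_group_cocycle_group[OF assms(1)])
  have "coboundaries G (Suc k) \<lhd> cocycle_group G (Suc k)"
    by (rule Z.normal_iff_subgroup[THEN iffD2, OF subgroup_coboundaries[OF assms(1)]])
  then show ?thesis
    using normal.rcos_sum assms(2,3)
    by (fastforce simp: cohomology_class_def cohomology_def carrier_cocycle_group mult_cocycle_group)
qed

lemma cohomology_class_eq_iff:
  assumes "group G" "c \<in> cocycles G (Suc k)" "d \<in> cocycles G (Suc k)"
  shows "cohomology_class G (Suc k) c = cohomology_class G (Suc k) d \<longleftrightarrow>
    zhexact G (Suc k) (\<lambda>gs. hom_cochain G c gs - hom_cochain G d gs)"
proof -
  interpret Z: comm_group "cocycle_group G (Suc k)" by (rule comm_group_cocycle_group[OF assms(1)])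
  interpret C: comm_group "cochain_group G (Suc k)" by (rule comm_group_cochain_group)
  note sub = subgroup_coboundaries[OF assms(1), of k]
  have cZ: "c \<in> carrier (cocycle_group G (Suc k))" and dZ: "d \<in> carrier (cocycle_group G (Suc k))"
    using assms by (simp_all add: carrier_cocycle_group)
  have cc: "c \<in> carrier (cochain_group G (Suc k))" "d \<in> carrier (cochain_group G (Suc k))"
    using assms by (auto simp: cocycles_iff)
  have "cohomology_class G (Suc k) c = cohomology_class G (Suc k) d \<longleftrightarrow>
      c \<otimes>\<^bsub>cocycle_group G (Suc k)\<^esub> inv\<^bsub>cocycle_group G (Suc k)\<^esub> d \<in> coboundaries G (Suc k)"
  proof
    assume "cohomology_class G (Suc k) c = cohomology_class G (Suc k) d"
    then have "c \<in> coboundaries G (Suc k) #>\<^bsub>cocycle_group G (Suc k)\<^esub> d"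
      using Z.rcos_self[OF _ sub, of c] assms(2) by (simp add: cohomology_class_def carrier_cocycle_group)
    then obtain b where b: "b \<in> coboundaries G (Suc k)" "c = b \<otimes>\<^bsub>cocycle_group G (Suc k)\<^esub> d"
      by (auto simp: r_coset_def)
    have "c \<otimes>\<^bsub>cocycle_group G (Suc k)\<^esub> inv\<^bsub>cocycle_group G (Suc k)\<^esub> d = b"
      unfolding b(2) using dZ subgroup.mem_carrier[OF sub b(1)] by (simp only: Z.m_assoc Z.inv_closed Z.r_inv Z.r_one)
    then show "c \<otimes>\<^bsub>cocycle_group G (Suc k)\<^esub> inv\<^bsub>cocycle_group G (Suc k)\<^esub> d \<in> coboundaries G (Suc k)"
      using b(1) by simp
  next
    assume *: "c \<otimes>\<^bsub>cocycle_group G (Suc k)\<^esub> inv\<^bsub>cocycle_group G (Suc k)\<^esub> d \<in> coboundaries G (Suc k)"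
    have "c = (c \<otimes>\<^bsub>cocycle_group G (Suc k)\<^esub> inv\<^bsub>cocycle_group G (Suc k)\<^esub> d) \<otimes>\<^bsub>cocycle_group G (Suc k)\<^esub> d"
      using cZ dZ by (simp only: Z.m_assoc Z.inv_closed Z.l_inv Z.r_one)
    then have "c \<in> coboundaries G (Suc k) #>\<^bsub>cocycle_group G (Suc k)\<^esub> d"
      using * unfolding r_coset_def by blast
    then show "cohomology_class G (Suc k) c = cohomology_class G (Suc k) d"
      using Z.repr_independence[OF _ _ sub] assms(3) by (simp add: cohomology_class_def carrier_cocycle_group)
  qed
  also have "c \<otimes>\<^bsub>cocycle_group G (Suc k)\<^esub> inv\<^bsub>cocycle_group G (Suc k)\<^esub> d =
      c \<otimes>\<^bsub>cochain_group G (Suc k)\<^esub> inv\<^bsub>cochain_group G (Suc k)\<^esub> d"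
    using assms by (simp add: mult_cocycle_group inv_cocycle_group)
  also have "\<dots> \<in> coboundaries G (Suc k) \<longleftrightarrow>
      zhexact G (Suc k) (hom_cochain G (c \<otimes>\<^bsub>cochain_group G (Suc k)\<^esub> inv\<^bsub>cochain_group G (Suc k)\<^esub> d))"
    using cc by (simp add: coboundaries_iff[OF assms(1)])
  also have "\<dots> \<longleftrightarrow> zhexact G (Suc k) (\<lambda>gs. hom_cochain G c gs - hom_cochain G d gs)"
    using hom_cochain_add[OF assms(1)] hom_cochain_inv[OF assms(1) _ cc(2)]
    by (auto elim!: hexact_cong)
  finally show ?thesis .
qed

section \<open>Restriction to subgroups\<close>

lemma diffs_subgroup:
  assumes "group G" "subgroup H G" "set gs \<subseteq> H"
  shows "diffs (G\<lparr>carrier := H\<rparr>) gs = diffs G gs"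
  using assms(3)
  by (induction gs rule: induct_list012) (auto simp: group.m_inv_consistent[OF assms(1,2)])

definition restrict_cochain :: "('g, 'b) monoid_scheme \<Rightarrow> 'g set \<Rightarrow> nat \<Rightarrow> ('g list \<Rightarrow> int) \<Rightarrow> 'g list \<Rightarrow> int" where
  "restrict_cochain G H i c = cochain_pullback (G\<lparr>carrier := H\<rparr>) (\<lambda>x. x) i c"

lemma hom_cochain_restrict:
  assumes "group G" "subgroup H G" "hs \<in> tuples (G\<lparr>carrier := H\<rparr>) (Suc i)"
  shows "hom_cochain (G\<lparr>carrier := H\<rparr>) (restrict_cochain G H i c) hs = hom_cochain G c hs"
proof -
  have "diffs (G\<lparr>carrier := H\<rparr>) hs \<in> tuples (G\<lparr>carrier := H\<rparr>) i"
    by (rule diffs_tuples[OF subgroup.subgroup_is_group[OF assms(2,1)] assms(3)])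
  moreover have "diffs (G\<lparr>carrier := H\<rparr>) hs = diffs G hs"
    by (rule diffs_subgroup[OF assms(1,2)]) (use assms(3) in \<open>simp add: tuples_def\<close>)
  ultimately show ?thesis
    by (simp add: hom_cochain_def restrict_cochain_def cochain_pullback_def)
qed

lemma restrict_cochain_cocycles:
  assumes "group G" "subgroup H G" "c \<in> cocycles G i"
  shows "restrict_cochain G H i c \<in> cocycles (G\<lparr>carrier := H\<rparr>) i"
proof -
  note gH = subgroup.subgroup_is_group[OF assms(2,1)]
  have "zhcocycle (G\<lparr>carrier := H\<rparr>) i (hom_cochain G c)"
    using assms hcocycle_subgroup by (auto simp: cocycles_iff)
  then have "zhcocycle (G\<lparr>carrier := H\<rparr>) i (hom_cochain (G\<lparr>carrier := H\<rparr>) (restrict_cochain G H i c))"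
    by (rule hcocycle_cong) (use hom_cochain_restrict[OF assms(1,2)] gH in \<open>auto simp: group.is_monoid\<close>)
  then show ?thesis
    by (simp add: cocycles_iff[OF gH] carrier_cochain_group restrict_cochain_def cochain_pullback_def)
qed

text \<open>Restriction carries coboundaries to coboundaries, so \<open>the_elem\<close> is applied
  to a singleton.\<close>

lemma cohomology_map_class:
  assumes "group G" "subgroup H G" "c \<in> cocycles G (Suc k)"
  shows "cohomology_map (G\<lparr>carrier := H\<rparr>) (\<lambda>x. x) (Suc k) (cohomology_class G (Suc k) c) =
    cohomology_class (G\<lparr>carrier := H\<rparr>) (Suc k) (restrict_cochain G H (Suc k) c)"
proof -
  interpret Z: comm_group "cocycle_group G (Suc k)" by (rule comm_group_cocycle_group[OF assms(1)])
  note sub = subgroup_coboundaries[OF assms(1), of k]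
  note gH = subgroup.subgroup_is_group[OF assms(2,1)]
  have eq: "cohomology_class (G\<lparr>carrier := H\<rparr>) (Suc k) (restrict_cochain G H (Suc k) d) =
      cohomology_class (G\<lparr>carrier := H\<rparr>) (Suc k) (restrict_cochain G H (Suc k) c)"
    if d: "d \<in> cohomology_class G (Suc k) c" for d
  proof -
    have dZ: "d \<in> cocycles G (Suc k)"
      using d Z.r_coset_subset_G[OF subgroup.subset[OF sub], of c] assms(3)
      by (auto simp: cohomology_class_def carrier_cocycle_group)
    have "cohomology_class G (Suc k) d = cohomology_class G (Suc k) c"
      using Z.repr_independence[OF _ _ sub, of d c] d assms(3) by (simp add: cohomology_class_def carrier_cocycle_group)
    then have "zhexact G (Suc k) (\<lambda>gs. hom_cochain G d gs - hom_cochain G c gs)"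
      using cohomology_class_eq_iff[OF assms(1) dZ assms(3)] by blast
    then have "zhexact (G\<lparr>carrier := H\<rparr>) (Suc k) (\<lambda>gs. hom_cochain G d gs - hom_cochain G c gs)"
      by (rule hexact_subgroup) (rule assms(2))
    then have "zhexact (G\<lparr>carrier := H\<rparr>) (Suc k)
       (\<lambda>gs. hom_cochain (G\<lparr>carrier := H\<rparr>) (restrict_cochain G H (Suc k) d) gs -
             hom_cochain (G\<lparr>carrier := H\<rparr>) (restrict_cochain G H (Suc k) c) gs)"
      by (rule hexact_cong) (simp add: hom_cochain_restrict[OF assms(1,2)])
    then show ?thesis
      using cohomology_class_eq_iff[OF gH] restrict_cochain_cocycles[OF assms(1,2)] dZ assms(3) by blast
  qed
  have self: "c \<in> cohomology_class G (Suc k) c"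
    using Z.rcos_self[OF _ sub, of c] assms(3) by (simp add: cohomology_class_def carrier_cocycle_group)
  have "(\<lambda>d. cohomology_class (G\<lparr>carrier := H\<rparr>) (Suc k) (restrict_cochain G H (Suc k) d)) `
      cohomology_class G (Suc k) c =
    {cohomology_class (G\<lparr>carrier := H\<rparr>) (Suc k) (restrict_cochain G H (Suc k) c)}"
    using eq self by blast
  then show ?thesis
    by (simp add: cohomology_map_def cohomology_class_def restrict_cochain_def)
qed

section \<open>Conclusion\<close>

lemma (in group) cyclic_nat_generator:
  assumes "cyclic_group G" "finite (carrier G)"
  obtains z where "z \<in> carrier G" "\<And>g. g \<in> carrier G \<Longrightarrow> \<exists>j. j < order G \<and> g = z [^] (j::nat)"
proof -
  obtain z where z: "z \<in> carrier G" "carrier G = range (\<lambda>n::int. z [^] n)"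
    using assms(1) cyclic_group by blast
  have pos: "order G > 0" using order_gt_0_iff_finite assms(2) by blast
  have "\<exists>j. j < order G \<and> g = z [^] (j::nat)" if "g \<in> carrier G" for g
  proof -
    have "g \<in> range (\<lambda>n::int. z [^] n)" using that by (simp only: z(2)[symmetric])
    then obtain k :: int where k: "g = z [^] k" by (rule rangeE)
    define q r where "q = k div int (order G)" and "r = nat (k mod int (order G))"
    have r: "int r = k mod int (order G)" "r < order G" using pos by (auto simp: r_def nat_less_iff)
    have "k = int (order G) * q + int r" by (simp add: q_def r(1))
    then have "g = z [^] (int (order G) * q) \<otimes> z [^] int r"
      unfolding k using z(1) by (simp only: int_pow_mult)
    also have "z [^] (int (order G) * q) = (z [^] int (order G)) [^] q"
      using z(1) by (simp only: int_pow_pow)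
    also have "z [^] int (order G) = \<one>"
      by (simp add: int_pow_int pow_order_eq_1 z(1))
    finally have "g = z [^] r" using z(1) by (simp add: int_pow_int)
    then show ?thesis using r(2) by blast
  qed
  then show thesis using that z(1) by blast
qed

theorem theorem0p3:
  fixes G :: "('g, 'c) monoid_scheme" and L :: "('l, 'b) monoid_scheme"
    and m n :: nat
    and \<rho> :: "'g \<Rightarrow> 'l \<Rightarrow> 'l"
    and \<Gamma> :: "('l \<times> 'g) monoid"
    and \<M> :: "('l \<times> 'g) set set"
  assumes "group G" and "cyclic_group G" and "finite (carrier G)" and "order G = m"
    and "comm_group L" and "L \<cong> product_group {..<n} (\<lambda>_. integer_group)"
    and "\<rho> \<in> hom G (AutoGroup L)"
    and "\<Gamma> = semidirect_product L G \<rho>"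
    and "acts_freely_outside_origin G L \<rho>"
    and "complete_maximal_finite_representatives \<M> \<Gamma>"
  shows "(\<forall>k. 2 * k > n \<longrightarrow>
             restriction_map \<Gamma> \<M> (2 * k)
               \<in> iso (cohomology \<Gamma> (2 * k))
                     (sum_group \<M> (\<lambda>M. reduced_cohomology (\<Gamma>\<lparr>carrier := M\<rparr>) (2 * k)))) \<and>
         (\<forall>k. 2 * k + 1 > n \<longrightarrow> trivial_group (cohomology \<Gamma> (2 * k + 1)))"
proof -
  interpret G: group G by fact
  interpret L: comm_group L by fact
  obtain z where z: "z \<in> carrier G" "\<And>g. g \<in> carrier G \<Longrightarrow> \<exists>j. j < order G \<and> g = z [^]\<^bsub>G\<^esub> (j::nat)"
    by (rule G.cyclic_nat_generator[OF assms(2,3)]) blast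
  obtain \<phi> where \<phi>: "\<phi> \<in> iso L (product_group {..<n} (\<lambda>_. integer_group))"
    using assms(6) by (auto simp: is_iso_def)
  have \<phi>_bij: "bij_betw \<phi> (carrier L) (\<Pi>\<^sub>E j\<in>{..<n}. UNIV)"
    using \<phi> by (simp add: iso_def)
  have \<phi>_mult: "\<phi> (x \<otimes>\<^bsub>L\<^esub> y) j = \<phi> x j + \<phi> y j" if "x \<in> carrier L" "y \<in> carrier L" "j < n" for x y j
    using \<phi> that by (simp add: iso_def hom_def)
  have \<rho>_auto: "\<rho> g \<in> hom L L \<inter> Bij (carrier L)" if "g \<in> carrier G" for g
    using hom_in_carrier[OF assms(7) that] by (simp add: AutoGroup_def auto_def)
  have \<rho>_closed: "\<rho> g x \<in> carrier L" if "g \<in> carrier G" "x \<in> carrier L" for g x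
    using \<rho>_auto[OF that(1)] that(2) by (auto dest: hom_in_carrier)
  have \<rho>_comp: "\<rho> (g \<otimes>\<^bsub>G\<^esub> h) x = \<rho> g (\<rho> h x)" if "g \<in> carrier G" "h \<in> carrier G" "x \<in> carrier L" for g h x
  proof -
    have "\<rho> (g \<otimes>\<^bsub>G\<^esub> h) = compose (carrier L) (\<rho> g) (\<rho> h)"
      using hom_mult[OF assms(7) that(1,2)] \<rho>_auto[OF that(1)] \<rho>_auto[OF that(2)]
      by (simp add: AutoGroup_def BijGroup_def)
    then show ?thesis using that(3) by (simp add: compose_def)
  qed
  have \<rho>_one: "\<rho> \<one>\<^bsub>G\<^esub> x = x" if "x \<in> carrier L" for x
    using hom_one[OF assms(7) assms(1) L.AutoGroup] that by (simp add: AutoGroup_def BijGroup_def)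
  interpret S: free_semidirect G L n \<rho> \<phi> z
  proof unfold_locales
    show "x = y" if "x \<in> carrier L" "y \<in> carrier L" "\<And>j. j < n \<Longrightarrow> \<phi> x j = \<phi> y j" for x y
    proof -
      have "\<phi> x \<in> (\<Pi>\<^sub>E j\<in>{..<n}. UNIV)" "\<phi> y \<in> (\<Pi>\<^sub>E j\<in>{..<n}. UNIV)"
        using \<phi>_bij that(1,2) by (auto dest: bij_betwE)
      then have "\<phi> x = \<phi> y" by (rule PiE_ext) (use that(3) in simp)
      then show ?thesis using bij_betw_imp_inj_on[OF \<phi>_bij] that(1,2) by (auto dest: inj_onD)
    qed
    show "\<exists>x\<in>carrier L. \<forall>j<n. \<phi> x j = f j" for f
    proof -
      have "restrict f {..<n} \<in> \<phi> ` carrier L" using bij_betw_imp_surj_on[OF \<phi>_bij] by auto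
      then obtain x where "x \<in> carrier L" "\<phi> x = restrict f {..<n}" by (metis imageE)
      then show ?thesis by (intro bexI[of _ x]) auto
    qed
    show "\<rho> g (x \<otimes>\<^bsub>L\<^esub> y) = \<rho> g x \<otimes>\<^bsub>L\<^esub> \<rho> g y" if "g \<in> carrier G" "x \<in> carrier L" "y \<in> carrier L" for g x y
      using \<rho>_auto[OF that(1)] hom_mult[of "\<rho> g" L L x y] that by simp
    show "g = \<one>\<^bsub>G\<^esub> \<or> x = \<one>\<^bsub>L\<^esub>" if "g \<in> carrier G" "x \<in> carrier L" "\<rho> g x = x" for g x
      using assms(9) that unfolding acts_freely_outside_origin_def by blast
  qed (use assms(3) z \<phi>_mult \<rho>_closed \<rho>_comp \<rho>_one in auto)
  have \<Gamma>: "S.\<Gamma> = \<Gamma>" by (simp add: S.\<Gamma>_def assms(8))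
  note gr = S.group_\<Gamma>[unfolded \<Gamma>]
  note M = assms(10)
  interpret A: gmodule \<Gamma> "UNIV :: int set" trivial_act by (rule gmodule_trivial[OF gr])
  have sub: "subgroup H \<Gamma>" if "H \<in> \<M>" for H
    using M that unfolding complete_maximal_finite_representatives_def maximal_finite_subgroup_def by blast
  have grH: "group (\<Gamma>\<lparr>carrier := H\<rparr>)" if "H \<in> \<M>" for H
    by (rule subgroup.subgroup_is_group[OF sub[OF that] gr])
  have fin: "finite \<M>" using S.finite_representatives[of \<M>] M by (simp add: \<Gamma>)
  show ?thesis
  proof (intro conjI allI impI)
    fix k assume k: "n < 2 * k"
    \<comment> \<open>The degree is positive, so reduced and ordinary cohomology agree.\<close>
    then obtain i where i: "2 * k = Suc i" by (cases "2 * k") auto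
    let ?S = "sum_group \<M> (\<lambda>M. reduced_cohomology (\<Gamma>\<lparr>carrier := M\<rparr>) (Suc i))"
    have red: "reduced_cohomology (\<Gamma>\<lparr>carrier := H\<rparr>) (Suc i) = cohomology (\<Gamma>\<lparr>carrier := H\<rparr>) (Suc i)" for H
      by (simp add: reduced_cohomology_def)
    have grc: "group (cohomology (\<Gamma>\<lparr>carrier := H\<rparr>) (Suc i))" if "H \<in> \<M>" for H
      using comm_group_cohomology[OF grH[OF that]] by (rule comm_group.axioms)
    \<comment> \<open>For a finite family \<open>\<M>\<close> every element of the product has
      finite support.\<close>
    have carrier_S: "carrier ?S = (\<Pi>\<^sub>E H\<in>\<M>. carrier (cohomology (\<Gamma>\<lparr>carrier := H\<rparr>) (Suc i)))"
      using fin by (subst carrier_sum_group) (auto simp: red grc)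
    have res: "restriction_map \<Gamma> \<M> (Suc i) (cohomology_class \<Gamma> (Suc i) c) =
        (\<lambda>H\<in>\<M>. cohomology_class (\<Gamma>\<lparr>carrier := H\<rparr>) (Suc i) (restrict_cochain \<Gamma> H (Suc i) c))"
      if "c \<in> cocycles \<Gamma> (Suc i)" for c
      unfolding restriction_map_def
      by (rule restrict_ext) (simp add: to_reduced_def cohomology_map_class[OF gr sub that])
    have cl: "cohomology_class (\<Gamma>\<lparr>carrier := H\<rparr>) (Suc i) (restrict_cochain \<Gamma> H (Suc i) c)
        \<in> carrier (cohomology (\<Gamma>\<lparr>carrier := H\<rparr>) (Suc i))"
      if "c \<in> cocycles \<Gamma> (Suc i)" "H \<in> \<M>" for c H
      using restrict_cochain_cocycles[OF gr sub[OF that(2)] that(1)] by (simp add: carrier_cohomology)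
    have "restriction_map \<Gamma> \<M> (Suc i) \<in> hom (cohomology \<Gamma> (Suc i)) ?S"
    proof (rule homI)
      fix C assume "C \<in> carrier (cohomology \<Gamma> (Suc i))"
      then obtain c where c: "c \<in> cocycles \<Gamma> (Suc i)" "C = cohomology_class \<Gamma> (Suc i) c"
        by (auto simp: carrier_cohomology)
      then show "restriction_map \<Gamma> \<M> (Suc i) C \<in> carrier ?S"
        using cl[OF c(1)] by (simp add: carrier_S res)
      fix D assume "D \<in> carrier (cohomology \<Gamma> (Suc i))"
      then obtain d where d: "d \<in> cocycles \<Gamma> (Suc i)" "D = cohomology_class \<Gamma> (Suc i) d"
        by (auto simp: carrier_cohomology)
      have cd: "c \<otimes>\<^bsub>cochain_group \<Gamma> (Suc i)\<^esub> d \<in> cocycles \<Gamma> (Suc i)"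
        by (rule subgroup.m_closed[OF subgroup_cocycles[OF gr] c(1) d(1)])
      have "restriction_map \<Gamma> \<M> (Suc i) (C \<otimes>\<^bsub>cohomology \<Gamma> (Suc i)\<^esub> D) H =
        (restriction_map \<Gamma> \<M> (Suc i) C \<otimes>\<^bsub>?S\<^esub> restriction_map \<Gamma> \<M> (Suc i) D) H" for H
      proof (cases "H \<in> \<M>")
        case True
        have "restrict_cochain \<Gamma> H (Suc i) (c \<otimes>\<^bsub>cochain_group \<Gamma> (Suc i)\<^esub> d) =
          restrict_cochain \<Gamma> H (Suc i) c \<otimes>\<^bsub>cochain_group (\<Gamma>\<lparr>carrier := H\<rparr>) (Suc i)\<^esub> restrict_cochain \<Gamma> H (Suc i) d"
          using tuples_subgroup[OF sub[OF True]]
          by (auto simp: restrict_cochain_def cochain_pullback_def mult_cochain_group fun_eq_iff)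
        then show ?thesis
          using True c d cd
          by (simp add: cohomology_class_mult[OF gr] cohomology_class_mult[OF grH] res red
              restrict_cochain_cocycles[OF gr sub])
      qed (use c d cd in \<open>simp add: cohomology_class_mult[OF gr] res\<close>)
      then show "restriction_map \<Gamma> \<M> (Suc i) (C \<otimes>\<^bsub>cohomology \<Gamma> (Suc i)\<^esub> D) =
        restriction_map \<Gamma> \<M> (Suc i) C \<otimes>\<^bsub>?S\<^esub> restriction_map \<Gamma> \<M> (Suc i) D" by blast
    qed
    moreover have "inj_on (restriction_map \<Gamma> \<M> (Suc i)) (carrier (cohomology \<Gamma> (Suc i)))"
    proof (rule inj_onI)
      fix C D assume "C \<in> carrier (cohomology \<Gamma> (Suc i))" "D \<in> carrier (cohomology \<Gamma> (Suc i))"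
        and eq: "restriction_map \<Gamma> \<M> (Suc i) C = restriction_map \<Gamma> \<M> (Suc i) D"
      then obtain c d where c: "c \<in> cocycles \<Gamma> (Suc i)" "C = cohomology_class \<Gamma> (Suc i) c"
        and d: "d \<in> cocycles \<Gamma> (Suc i)" "D = cohomology_class \<Gamma> (Suc i) d"
        by (auto simp: carrier_cohomology)
      have "zhexact (\<Gamma>\<lparr>carrier := H\<rparr>) (Suc i) (\<lambda>gs. hom_cochain \<Gamma> c gs - hom_cochain \<Gamma> d gs)"
        if H: "H \<in> \<M>" for H
      proof -
        have "cohomology_class (\<Gamma>\<lparr>carrier := H\<rparr>) (Suc i) (restrict_cochain \<Gamma> H (Suc i) c) =
          cohomology_class (\<Gamma>\<lparr>carrier := H\<rparr>) (Suc i) (restrict_cochain \<Gamma> H (Suc i) d)"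
          using fun_cong[OF eq, of H] H by (simp add: c(2) d(2) res[OF c(1)] res[OF d(1)])
        then have "zhexact (\<Gamma>\<lparr>carrier := H\<rparr>) (Suc i)
          (\<lambda>gs. hom_cochain (\<Gamma>\<lparr>carrier := H\<rparr>) (restrict_cochain \<Gamma> H (Suc i) c) gs -
                hom_cochain (\<Gamma>\<lparr>carrier := H\<rparr>) (restrict_cochain \<Gamma> H (Suc i) d) gs)"
          using cohomology_class_eq_iff[OF grH[OF H]] restrict_cochain_cocycles[OF gr sub[OF H]] c(1) d(1) by blast
        then show ?thesis
          by (rule hexact_cong) (simp add: hom_cochain_restrict[OF gr sub[OF H]])
      qed
      moreover have "zhcocycle \<Gamma> (Suc i) (\<lambda>gs. hom_cochain \<Gamma> c gs - hom_cochain \<Gamma> d gs)"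
        using c(1) d(1) by (intro A.hcocycle_diff) (simp_all add: cocycles_iff[OF gr])
      ultimately have "zhexact \<Gamma> (Suc i) (\<lambda>gs. hom_cochain \<Gamma> c gs - hom_cochain \<Gamma> d gs)"
        using S.hexact_from_maximal_finite[unfolded \<Gamma>, OF M] k i by simp
      then show "C = D"
        using cohomology_class_eq_iff[OF gr c(1) d(1)] c(2) d(2) by simp
    qed
    moreover have "carrier ?S \<subseteq> restriction_map \<Gamma> \<M> (Suc i) ` carrier (cohomology \<Gamma> (Suc i))"
    proof
      fix x assume x: "x \<in> carrier ?S"
      have "\<exists>c. c \<in> cocycles (\<Gamma>\<lparr>carrier := H\<rparr>) (Suc i) \<and> x H = cohomology_class (\<Gamma>\<lparr>carrier := H\<rparr>) (Suc i) c"
        if "H \<in> \<M>" for H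
        using x that by (auto simp: carrier_S carrier_cohomology dest!: PiE_mem)
      then obtain c where c: "\<And>H. H \<in> \<M> \<Longrightarrow> c H \<in> cocycles (\<Gamma>\<lparr>carrier := H\<rparr>) (Suc i)"
        "\<And>H. H \<in> \<M> \<Longrightarrow> x H = cohomology_class (\<Gamma>\<lparr>carrier := H\<rparr>) (Suc i) (c H)"
        by metis
      \<comment> \<open>Cocycles chosen on all members of \<open>\<M>\<close> come from a single
        cocycle on \<open>\<Gamma>\<close>, up to coboundaries.\<close>
      obtain f where f: "zhcocycle \<Gamma> (Suc i) f"
        "\<And>H. H \<in> \<M> \<Longrightarrow> zhexact (\<Gamma>\<lparr>carrier := H\<rparr>) (Suc i) (\<lambda>hs. hom_cochain (\<Gamma>\<lparr>carrier := H\<rparr>) (c H) hs - f hs)"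
      proof (rule S.cocycle_extension[unfolded \<Gamma>, OF M])
        show "n < Suc i" using k i by simp
        show "zhcocycle (\<Gamma>\<lparr>carrier := H\<rparr>) (Suc i) (hom_cochain (\<Gamma>\<lparr>carrier := H\<rparr>) (c H))" if "H \<in> \<M>" for H
          using c(1)[OF that] by (simp add: cocycles_iff[OF grH[OF that]])
      qed blast
      obtain d where d: "d \<in> cocycles \<Gamma> (Suc i)"
        "\<And>gs. gs \<in> tuples \<Gamma> (Suc (Suc i)) \<Longrightarrow> hom_cochain \<Gamma> d gs = f gs"
        by (rule hcocycle_inhomogeneous[OF gr f(1)]) blast
      have "restriction_map \<Gamma> \<M> (Suc i) (cohomology_class \<Gamma> (Suc i) d) H = x H" for H
      proof (cases "H \<in> \<M>")
        case True
        have "zhexact (\<Gamma>\<lparr>carrier := H\<rparr>) (Suc i) (\<lambda>hs. hom_cochain (\<Gamma>\<lparr>carrier := H\<rparr>) (c H) hs -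
            hom_cochain (\<Gamma>\<lparr>carrier := H\<rparr>) (restrict_cochain \<Gamma> H (Suc i) d) hs)"
          by (rule hexact_cong[OF f(2)[OF True]])
            (simp add: hom_cochain_restrict[OF gr sub[OF True]] d(2) tuples_subgroup[OF sub[OF True]])
        then have "x H = cohomology_class (\<Gamma>\<lparr>carrier := H\<rparr>) (Suc i) (restrict_cochain \<Gamma> H (Suc i) d)"
          using cohomology_class_eq_iff[OF grH[OF True] c(1)[OF True] restrict_cochain_cocycles[OF gr sub[OF True] d(1)]]
            c(2)[OF True] by simp
        then show ?thesis unfolding res[OF d(1)] restrict_apply if_P[OF True] by (rule sym)
      next
        case False
        have "x H = undefined" using x unfolding carrier_S by (rule PiE_arb) (rule False)
        then show ?thesis unfolding res[OF d(1)] restrict_apply if_not_P[OF False] by (rule sym)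
      qed
      then have "x = restriction_map \<Gamma> \<M> (Suc i) (cohomology_class \<Gamma> (Suc i) d)" by (intro ext) (rule sym)
      then show "x \<in> restriction_map \<Gamma> \<M> (Suc i) ` carrier (cohomology \<Gamma> (Suc i))"
        using d(1) by (auto simp: carrier_cohomology)
    qed
    ultimately show "restriction_map \<Gamma> \<M> (2 * k) \<in> iso (cohomology \<Gamma> (2 * k))
        (sum_group \<M> (\<lambda>M. reduced_cohomology (\<Gamma>\<lparr>carrier := M\<rparr>) (2 * k)))"
      unfolding i iso_def bij_betw_def by (auto simp: hom_def)
  next
    fix k assume k: "n < 2 * k + 1"
    interpret H: comm_group "cohomology \<Gamma> (2 * k + 1)"
      using comm_group_cohomology[OF gr, of "2 * k"] by simp
    have "C = D" if CD: "C \<in> carrier (cohomology \<Gamma> (2 * k + 1))" "D \<in> carrier (cohomology \<Gamma> (2 * k + 1))" for C D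
    proof -
      obtain c d where c: "c \<in> cocycles \<Gamma> (Suc (2 * k))" "C = cohomology_class \<Gamma> (Suc (2 * k)) c"
        and d: "d \<in> cocycles \<Gamma> (Suc (2 * k))" "D = cohomology_class \<Gamma> (Suc (2 * k)) d"
        using CD by (auto simp: carrier_cohomology)
      have "zhcocycle \<Gamma> (2 * k + 1) (\<lambda>gs. hom_cochain \<Gamma> c gs - hom_cochain \<Gamma> d gs)"
        using c(1) d(1) by (intro A.hcocycle_diff) (simp_all add: cocycles_iff[OF gr])
      then have "zhexact \<Gamma> (2 * k + 1) (\<lambda>gs. hom_cochain \<Gamma> c gs - hom_cochain \<Gamma> d gs)"
        using S.hexact_odd[unfolded \<Gamma>] k by blast
      then show ?thesis using cohomology_class_eq_iff[OF gr c(1) d(1)] c(2) d(2) by simp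
    qed
    then show "trivial_group (cohomology \<Gamma> (2 * k + 1))"
      unfolding trivial_group_def using H.is_group H.one_closed by blast
  qed
qed

end
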